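(* For integers $d\ge2$ and $k\ge0$, consider the inequality $$\int_{\mathbb{S}^{d-1}} |f(x)|^2\,d\sigma(x)\le C_d\min_{e\in\mathbb{S}^{d-1}}\int_{\mathbb{S}^{d-1}}(1-\langle x,e\rangle)\left|(-\Delta_0)^{1/2}f(x)\right|^2d\sigma(x) \qquad ( * )$$ for functions $f\in L^2_{k}(\mathbb{S}^{d-1})\cap W_2^1(\mathbb{S}^{d-1})$. (i) For every $d\ge4$ there exists a nonnegative integer $n(d)\le 3(d-2)^3/16$ such that $( * )$ holds for all $f\in L^2_{n(d)}(\mathbb{S}^{d-1})\cap W_2^1(\mathbb{S}^{d-1})$ with $C_d=\frac{8}{(d-3)^2}$, and this constant is optimal (it cannot be replaced by a smaller one on this class). (ii) One has (i.e. the following are admissible values) $n(2)=n(4)=n(5)=0$ and $n(6)=4$; that is, $( * )$ with the optimal constant $C_d=\frac{8}{(d-3)^2}$ holds on $L_0^2(\mathbb{S}^{d-1})\cap W_2^1(\mathbb{S}^{d-1})$ for $d=2,4,5$, and on $L_4^2(\mathbb{S}^{5})\cap W_2^1(\mathbb{S}^{5})$ for $d=6$. (iii) For $d=3$, the inequality $( * )$ fails to hold (for all $f\in L^2_0(\mathbb{S}^2)\cap W_2^1(\mathbb{S}^2)$) for any finite constant $C_d$.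
   Context: $\mathbb{S}^{d-1}$ is the unit sphere of $\mathbb{R}^d$, $d\sigma$ its rotation-invariant surface measure; functions are real-valued when $d\ge3$. $\Pi_k^d$ is the space of real spherical polynomials of degree at most $k$ (restrictions to $\mathbb{S}^{d-1}$ of polynomials of total degree at most $k$ in $d$ variables), and $L_k^2(\mathbb{S}^{d-1})=\{f\in L^2(\mathbb{S}^{d-1}):\int_{\mathbb{S}^{d-1}}f(x)P(x)\,d\sigma(x)=0\ \ \forall P\in\Pi_k^d\}$; in particular $L^2_0$ consists of functions with zero mean. $\mathcal{H}_n^d$ is the space of spherical harmonics of degree $n$ and $\operatorname{proj}_n$ the orthogonal projection of $L^2(\mathbb{S}^{d-1})$ onto $\mathcal{H}_n^d$. $\Delta_0$ is the Laplace-Beltrami operator ($\Delta_0Y=-n(n+d-2)Y$ for $Y\in\mathcal{H}_n^d$). For $r\ne0$, $(-\Delta_0)^r$ is defined by $\operatorname{proj}_0[(-\Delta_0)^rf]=0$ and $\operatorname{proj}_n[(-\Delta_0)^rf]=(n(n+d-2))^r\operatorname{proj}_nf$, $n\ge1$. $W_2^1(\mathbb{S}^{d-1})=\{f\in L^2(\mathbb{S}^{d-1}):(-\Delta_0)^{1/2}f\in L^2(\mathbb{S}^{d-1})\}$. *)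

theory Defs
  imports "HOL-Analysis.Analysis"
begin

text \<open>
  The dimension \<open>d\<close> is \<open>CARD('n)\<close>. The codomain \<open>'b\<close> of the functions on the sphere is meant to
  be \<open>real\<close> or \<open>complex\<close>. Both are real inner product spaces, and on \<open>complex\<close> we have
  \<open>u \<bullet> v = Re (u * cnj v)\<close>, so for subspaces closed under multiplication by \<open>\<i>\<close> orthogonality
  with respect to the integral of \<open>u \<bullet> v\<close> is the usual Hermitian orthogonality.
\<close>

subsection \<open>Surface measure\<close>

text \<open>
  \<open>\<sigma>(A) = d * vol {x. 0 < |x| < 1 \<and> x / |x| \<in> A}\<close>, as a measure whose space is the unit sphere;
  values of functions off the sphere are therefore irrelevant.
\<close>

definition sphere_measure :: "(real ^ 'n) measure" where
  "sphere_measure = scale_measure (ennreal (real CARD('n)))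
     (distr (restrict_space lborel (ball 0 1 - {0})) (restrict_space borel (sphere 0 1)) sgn)"

lemma space_sphere_measure [simp]: "space sphere_measure = sphere 0 1"
  by (simp add: sphere_measure_def space_scale_measure space_restrict_space)

lemma sets_sphere_measure [measurable_cong]:
  "sets sphere_measure = sets (restrict_space borel (sphere 0 1))"
  by (simp add: sphere_measure_def)

lemma emeasure_sphere_measure:
  fixes A :: "(real ^ 'n) set"
  assumes "A \<in> sets borel" "A \<subseteq> sphere 0 1"
  shows "{x \<in> ball 0 1 - {0}. sgn x \<in> A} \<in> sets borel" (is "?B \<in> _")
    and "emeasure sphere_measure A = of_nat CARD('n) * emeasure lborel {x \<in> ball 0 1 - {0}. sgn x \<in> A}"
proof -
  have sgn_meas: "(sgn :: real ^ 'n \<Rightarrow> real ^ 'n) \<in> borel_measurable borel"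
    unfolding sgn_div_norm by measurable
  show B: "?B \<in> sets borel"
    using assms(1) sgn_meas by measurable
  have meas: "sgn \<in> measurable (restrict_space lborel (ball (0 :: real ^ 'n) 1 - {0}))
      (restrict_space borel (sphere 0 1))"
    using sgn_meas
    by (intro measurable_restrict_space2 measurable_restrict_space1)
       (auto simp: space_restrict_space norm_sgn)
  have A: "A \<in> sets (restrict_space borel (sphere 0 1))"
    using assms by (auto simp: sets_restrict_space_iff)
  have *: "sgn -` A \<inter> space (restrict_space lborel (ball 0 1 - {0})) = ?B"
    by (auto simp: space_restrict_space)
  show "emeasure sphere_measure A = of_nat CARD('n) * emeasure lborel ?B"
    unfolding sphere_measure_def emeasure_scale_measure emeasure_distr[OF meas A] *
    by (subst emeasure_restrict_space) (auto simp: ennreal_of_nat_eq_real_of_nat)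
qed

lemma finite_measure_sphere_measure: "finite_measure (sphere_measure :: (real ^ 'n) measure)"
proof
  have "emeasure lborel {x \<in> ball (0 :: real ^ 'n) 1 - {0}. sgn x \<in> sphere 0 1}
      \<le> emeasure lborel (ball (0 :: real ^ 'n) 1)"
    by (intro emeasure_mono) auto
  also have "\<dots> < \<infinity>"
    by (metis emeasure_lborel_ball_finite infinity_ennreal_def)
  finally show "emeasure sphere_measure (space (sphere_measure :: (real ^ 'n) measure)) \<noteq> \<infinity>"
    by (simp add: emeasure_sphere_measure(2) ennreal_mult_eq_top_iff of_nat_less_top less_top[symmetric]
        ennreal_mult_less_top)
qed

subsection \<open>Square-integrable functions, spherical polynomials and spherical harmonics\<close>

definition L2 :: "(real ^ 'n \<Rightarrow> 'b::euclidean_space) set" where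
  "L2 = {f \<in> borel_measurable sphere_measure. integrable sphere_measure (\<lambda>x. (norm (f x))\<^sup>2)}"

text \<open>
  The polynomial functions \<open>\<Sum>\<alpha> \<in> A. c\<^sub>\<alpha> x\<^sup>\<alpha>\<close>, where \<open>A\<close> is a finite set of multi-indices.
\<close>

definition poly_funs :: "('n \<Rightarrow> nat) set \<Rightarrow> (real ^ 'n \<Rightarrow> 'b::euclidean_space) set" where
  "poly_funs A = {P. \<exists>c. P = (\<lambda>x. \<Sum>\<alpha>\<in>A. (\<Prod>i\<in>UNIV. x $ i ^ \<alpha> i) *\<^sub>R c \<alpha>)}"

definition spherical_polys :: "nat \<Rightarrow> (real ^ 'n \<Rightarrow> 'b::euclidean_space) set" where
  "spherical_polys k = poly_funs {\<alpha>. (\<Sum>i\<in>UNIV. \<alpha> i) \<le> k}"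

definition laplacian :: "(real ^ 'n \<Rightarrow> 'b::euclidean_space) \<Rightarrow> real ^ 'n \<Rightarrow> 'b" where
  "laplacian P x = (\<Sum>i\<in>UNIV. vector_derivative
     (\<lambda>s. vector_derivative (\<lambda>t. P (x + t *\<^sub>R axis i 1)) (at s)) (at 0))"

text \<open>
  Elements of \<open>\<H>\<^sub>n\<close> are represented by the homogeneous harmonic polynomials on the whole space;
  by homogeneity such a polynomial is determined by its restriction to the sphere.
\<close>

definition spherical_harmonics :: "nat \<Rightarrow> (real ^ 'n \<Rightarrow> 'b::euclidean_space) set" where
  "spherical_harmonics n =
     {Y \<in> poly_funs {\<alpha>. (\<Sum>i\<in>UNIV. \<alpha> i) = n}. \<forall>x. laplacian Y x = 0}"

lemma finite_multi_indices [simp]: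
  "finite {\<alpha> :: 'n::finite \<Rightarrow> nat. (\<Sum>i\<in>UNIV. \<alpha> i) \<le> k}"
  "finite {\<alpha> :: 'n::finite \<Rightarrow> nat. (\<Sum>i\<in>UNIV. \<alpha> i) = k}"
proof -
  have le: "\<alpha> i \<le> (\<Sum>i\<in>UNIV. \<alpha> i)" for \<alpha> :: "'n \<Rightarrow> nat" and i
    by (rule member_le_sum) auto
  have fin: "finite (PiE UNIV (\<lambda>_ :: 'n. {..k}))"
    by (intro finite_PiE) auto
  show "finite {\<alpha> :: 'n::finite \<Rightarrow> nat. (\<Sum>i\<in>UNIV. \<alpha> i) \<le> k}"
    by (rule finite_subset[OF _ fin]) (auto simp: PiE_def intro: le order_trans)
  then show "finite {\<alpha> :: 'n::finite \<Rightarrow> nat. (\<Sum>i\<in>UNIV. \<alpha> i) = k}"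
    by (rule finite_subset[rotated]) auto
qed

definition L2_orth :: "nat \<Rightarrow> (real ^ 'n \<Rightarrow> 'b::euclidean_space) set" where
  "L2_orth k = {f \<in> L2. \<forall>P \<in> spherical_polys k.
     (LINT x|sphere_measure. (P x :: real) *\<^sub>R f x) = 0}"

definition proj :: "nat \<Rightarrow> (real ^ 'n \<Rightarrow> 'b::euclidean_space) \<Rightarrow> real ^ 'n \<Rightarrow> 'b" where
  "proj n f = (THE h. h \<in> spherical_harmonics n \<and>
     (\<forall>Y \<in> spherical_harmonics n. (LINT x|sphere_measure. (f x - h x) \<bullet> Y x) = 0))"

subsection \<open>Powers of the Laplace-Beltrami operator and the Sobolev space\<close>

text \<open>
  \<open>is_frac_LB r f g\<close> says that \<open>g \<in> L\<^sup>2\<close> is (a representative of) \<open>(-\<Delta>\<^sub>0)\<^sup>r f\<close>. The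
  conditions on the projections determine \<open>g\<close> only up to a null set; \<open>frac_LB\<close> selects one such
  function, to be used inside integrals.
\<close>

definition is_frac_LB ::
  "real \<Rightarrow> (real ^ 'n \<Rightarrow> 'b::euclidean_space) \<Rightarrow> (real ^ 'n \<Rightarrow> 'b) \<Rightarrow> bool" where
  "is_frac_LB r f g \<longleftrightarrow> g \<in> L2 \<and>
     (\<forall>x \<in> sphere 0 1. proj 0 g x = 0) \<and>
     (\<forall>n\<ge>1. \<forall>x \<in> sphere 0 1.
        proj n g x = ((real n * (real n + real CARD('n) - 2)) powr r) *\<^sub>R proj n f x)"

definition frac_LB :: "real \<Rightarrow> (real ^ 'n \<Rightarrow> 'b::euclidean_space) \<Rightarrow> real ^ 'n \<Rightarrow> 'b" where
  "frac_LB r f = (SOME g. is_frac_LB r f g)"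

definition W21 :: "(real ^ 'n \<Rightarrow> 'b::euclidean_space) set" where
  "W21 = {f \<in> L2. \<exists>g. is_frac_LB (1/2) f g}"

subsection \<open>The inequality\<close>

definition weighted_integral :: "(real ^ 'n \<Rightarrow> 'b::euclidean_space) \<Rightarrow> real ^ 'n \<Rightarrow> real" where
  "weighted_integral g e = (LINT x|sphere_measure. (1 - x \<bullet> e) * (norm (g x))\<^sup>2)"

text \<open>The infimum over the sphere used below is a minimum:\<close>

lemma weighted_integral_attains_min:
  fixes g :: "real ^ 'n \<Rightarrow> 'b::euclidean_space"
  assumes "g \<in> L2"
  shows "\<exists>e \<in> sphere 0 1. weighted_integral g e = (INF e \<in> sphere 0 1. weighted_integral g e)"
proof -
  have int: "integrable sphere_measure (\<lambda>x. (norm (g x))\<^sup>2)"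
    and [measurable]: "g \<in> borel_measurable sphere_measure"
    using assms by (auto simp: L2_def)
  have id_meas [measurable]: "(\<lambda>x. x) \<in> borel_measurable (sphere_measure :: (real ^ 'n) measure)"
    by (simp add: measurable_cong_sets[OF sets_sphere_measure refl] measurable_restrict_space1)
  have int': "integrable sphere_measure (\<lambda>x. (norm (g x))\<^sup>2 *\<^sub>R x)"
    by (rule Bochner_Integration.integrable_bound[OF int]) (auto intro!: AE_I2)
  have eq: "weighted_integral g e = (LINT x|sphere_measure. (norm (g x))\<^sup>2)
      - (LINT x|sphere_measure. (norm (g x))\<^sup>2 *\<^sub>R x) \<bullet> e" for e
  proof -
    have "weighted_integral g e =
        (LINT x|sphere_measure. (norm (g x))\<^sup>2 - ((norm (g x))\<^sup>2 *\<^sub>R x) \<bullet> e)"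
      unfolding weighted_integral_def by (simp add: algebra_simps)
    also have "\<dots> = (LINT x|sphere_measure. (norm (g x))\<^sup>2)
        - (LINT x|sphere_measure. ((norm (g x))\<^sup>2 *\<^sub>R x) \<bullet> e)"
      by (intro Bochner_Integration.integral_diff int integrable_inner_left int')
    finally show ?thesis
      by (simp only: integral_inner_left[OF int'])
  qed
  have "continuous_on (sphere 0 1) (weighted_integral g)"
    unfolding eq[abs_def] by (intro continuous_intros)
  moreover have "sphere (0 :: real ^ 'n) 1 \<noteq> {}"
    by simp
  ultimately obtain e where e: "e \<in> sphere 0 1"
    and min: "\<And>e'. e' \<in> sphere 0 1 \<Longrightarrow> weighted_integral g e \<le> weighted_integral g e'"
    using continuous_attains_inf[OF compact_sphere] by metis
  have "(INF e \<in> sphere 0 1. weighted_integral g e) = weighted_integral g e"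
    by (rule cInf_eq_minimum) (use e min in auto)
  with e show ?thesis
    by metis
qed

definition ineq_holds_on :: "(real ^ 'n \<Rightarrow> 'b::euclidean_space) set \<Rightarrow> real \<Rightarrow> bool" where
  "ineq_holds_on F C \<longleftrightarrow> (\<forall>f\<in>F.
     (LINT x|sphere_measure. (norm (f x))\<^sup>2)
       \<le> C * (INF e \<in> sphere 0 1. weighted_integral (frac_LB (1/2) f) e))"

definition optimal_constant :: "(real ^ 'n \<Rightarrow> 'b::euclidean_space) set \<Rightarrow> real \<Rightarrow> bool" where
  "optimal_constant F C \<longleftrightarrow> ineq_holds_on F C \<and> (\<forall>C'<C. \<not> ineq_holds_on F C')"

end

theory Submission
  imports Defs "HOL-Real_Asymp.Real_Asymp"
begin

text \<open>
  Put \<open>g = (-\<Delta>\<^sub>0)\<^bsup>1/2\<^esup> f\<close> and expand \<open>g\<close> into spherical harmonics \<open>Y\<^sub>n\<close> of degree \<open>n\<close>. By Parseval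
  (\<open>parseval\<close>), the left-hand side of the inequality is the sum of \<open>\<parallel>Y\<^sub>n\<parallel>\<^sup>2 / (n (n + d - 2))\<close>.
  Multiplication by \<open>t = \<langle>x, e\<rangle>\<close> couples neighbouring degrees only, so the weighted integral on the right
  is \<open>\<Sum> \<parallel>Y\<^sub>n\<parallel>\<^sup>2 - 2 \<Sum> \<langle>t Y\<^sub>n, Y\<^bsub>n+1\<^esub>\<rangle>\<close> (\<open>tip_harmonic_sum\<close>).

  The coupling is controlled by the sharp estimate \<open>\<bar>\<langle>t Y\<^sub>n, Y\<^bsub>n+1\<^esub>\<rangle>\<bar> \<le> a\<^sub>n \<parallel>Y\<^sub>n\<parallel> \<parallel>Y\<^bsub>n+1\<^esub>\<parallel>\<close>, where the \<open>a\<^sub>n\<close> are the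
  entries of the Jacobi matrix of the Gegenbauer polynomials; equality holds for zonal harmonics. Since
  \<open>\<langle>t Y\<^sub>n, Y\<^bsub>n+1\<^esub>\<rangle>\<close> is a multiple of \<open>\<langle>Y\<^sub>n, \<partial>\<^sub>e Y\<^bsub>n+1\<^esub>\<rangle>\<close>, it amounts to a bound for the directional derivative of a
  harmonic (\<open>sint_pd_harmonic_bound\<close>). This leaves a discrete Hardy inequality for the numbers
  \<open>\<parallel>Y\<^sub>n\<parallel>\<close>. As \<open>a\<^sub>n\<close> is \<open>1/2\<close> up to terms of order \<open>n\<^bsup>-2\<^esup>\<close>, its constant is the one of the classical Hardy
  inequality in \<open>d - 1\<close> dimensions, which is where \<open>(d - 3)\<^sup>2 / 8\<close> comes from. The ground state is close to
  \<open>\<surd>n\<close>. Weighting the arithmetic-geometric mean inequality accordingly, one is left with one rational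
  inequality in each degree (\<open>hardy_condition\<close>), equivalent to the nonnegativity of a quadratic
  polynomial in \<open>n\<close>. This holds in all degrees \<open>n \<ge> 1\<close> for \<open>d = 2, 4, 5, 6\<close>, and for
  \<open>n \<ge> (d - 2)\<^sup>2 / 2 + 1\<close> in general.

  The quadratic is small in comparison with the terms that cancel in it. Therefore zonal functions whose
  coefficients follow the ground state between two degrees far apart, with a logarithmic cutoff, come
  arbitrarily close to equality (\<open>trial_harmonics_exist\<close>). This shows that the constant is optimal, and
  that for \<open>d = 3\<close>, where the Hardy constant vanishes, no constant is admissible.

  The only geometric fact used about the surface measure, apart from its full support, is rotation
  invariance: it yields \<open>\<integral> \<partial>\<^sub>v P = (m + d - 1) \<integral> \<langle>x, v\<rangle> P\<close> for homogeneous polynomials \<open>P\<close> of degree \<open>m\<close>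
  (\<open>sint_pd\<close>), and every integral identity for harmonics follows from this. Completeness of the harmonics
  comes from the Stone--Weierstrass theorem.
\<close>

section \<open>Homogeneous polynomials and their derivatives\<close>

subsection \<open>Directional derivatives\<close>

text \<open>
  The directional derivative in the form in which the Laplacian is built from it, so that the
  Laplacian becomes a sum of iterated \<open>pd\<close>s.
\<close>

definition pd :: "real ^ 'n \<Rightarrow> (real ^ 'n \<Rightarrow> 'b::real_normed_vector) \<Rightarrow> real ^ 'n \<Rightarrow> 'b" where
  "pd v P x = vector_derivative (\<lambda>t. P (x + t *\<^sub>R v)) (at 0)"

lemma pd_eq:
  assumes "(P has_derivative P') (at x)"
  shows "pd v P x = P' v"
proof -
  have "((\<lambda>t. P (x + t *\<^sub>R v)) has_derivative (\<lambda>t. P' (t *\<^sub>R v))) (at 0)"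
    by (rule has_derivative_compose[of "\<lambda>t. x + t *\<^sub>R v" "\<lambda>t. t *\<^sub>R v" 0 UNIV P P'])
       (auto intro!: derivative_eq_intros assms)
  moreover have "P' (t *\<^sub>R v) = t *\<^sub>R P' v" for t
    using assms has_derivative_linear linear_scale by blast
  ultimately have "((\<lambda>t. P (x + t *\<^sub>R v)) has_vector_derivative P' v) (at 0)"
    by (simp add: has_vector_derivative_def)
  then show ?thesis
    unfolding pd_def by (rule vector_derivative_at)
qed

lemma has_vector_derivative_translate:
  fixes f :: "real \<Rightarrow> 'b::real_normed_vector"
  shows "((\<lambda>t. f (s + t)) has_vector_derivative D) (at 0) \<longleftrightarrow> (f has_vector_derivative D) (at s)"
proof
  assume "(f has_vector_derivative D) (at s)"
  then show "((\<lambda>t. f (s + t)) has_vector_derivative D) (at 0)"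
    using vector_diff_chain_at[of "\<lambda>t. s + t" 1 0 f D]
    by (simp add: o_def has_vector_derivative_add_const has_vector_derivative_id add.commute[of s])
next
  assume "((\<lambda>t. f (s + t)) has_vector_derivative D) (at 0)"
  then show "(f has_vector_derivative D) (at s)"
    using vector_diff_chain_at[of "\<lambda>t. t - s" 1 s "\<lambda>t. f (s + t)" D]
    by (simp add: o_def has_vector_derivative_diff_const has_vector_derivative_id)
qed

lemma laplacian_eq_sum_pd:
  "laplacian P x = (\<Sum>i\<in>UNIV. pd (axis i 1) (pd (axis i 1) P) x)"
proof -
  have "vector_derivative (\<lambda>t. P (x + t *\<^sub>R v)) (at s) = pd v P (x + s *\<^sub>R v)" for s v
  proof -
    have "(\<lambda>t. P (x + s *\<^sub>R v + t *\<^sub>R v)) = (\<lambda>t. P (x + t *\<^sub>R v)) \<circ> (+) s"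
      by (auto simp: algebra_simps)
    moreover have "vector_derivative (f \<circ> (+) s) (at 0) = vector_derivative f (at s)"
      for f :: "real \<Rightarrow> 'a"
      unfolding vector_derivative_def
      by (simp add: o_def has_vector_derivative_translate)
    ultimately show ?thesis
      unfolding pd_def by simp
  qed
  then show ?thesis
    by (simp add: laplacian_def pd_def)
qed

subsection \<open>Homogeneous polynomials\<close>

text \<open>
  Homogeneous polynomial functions as an inductive predicate: induction on the construction replaces
  all computations with multi-indices. The lemma \<open>poly_funs_homogeneous\<close> identifies them with
  the sums of monomials.
\<close>

inductive hpoly :: "nat \<Rightarrow> (real ^ 'n \<Rightarrow> real) \<Rightarrow> bool" where
  const: "hpoly 0 (\<lambda>x. c)" |
  var: "hpoly m P \<Longrightarrow> hpoly (Suc m) (\<lambda>x. x $ i * P x)" for m |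
  add: "hpoly m P \<Longrightarrow> hpoly m Q \<Longrightarrow> hpoly m (\<lambda>x. P x + Q x)" for m

lemma hpoly_cmult: "hpoly m P \<Longrightarrow> hpoly m (\<lambda>x. c * P x)"
proof (induction rule: hpoly.induct)
  case (var m P i)
  from hpoly.var[OF var.IH, of i] show ?case by (simp add: mult.left_commute)
qed (auto simp: distrib_left intro: hpoly.intros)

lemma hpoly_zero: "hpoly m (\<lambda>x. 0)"
proof (induction m)
  case (Suc m)
  from hpoly.var[OF this] show ?case by simp
qed (rule hpoly.const)

lemma hpoly_sum:
  assumes "\<And>i. i \<in> A \<Longrightarrow> hpoly m (P i)"
  shows "hpoly m (\<lambda>x. \<Sum>i\<in>A. P i x)"
  using assms
  by (induction A rule: infinite_finite_induct) (auto simp: hpoly_zero intro: hpoly.add)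

lemma hpoly_mult:
  assumes "hpoly m P" "hpoly k Q"
  shows "hpoly (m + k) (\<lambda>x. P x * Q x)"
  using assms(1)
proof (induction rule: hpoly.induct)
  case (var m P i)
  from hpoly.var[OF var.IH, of i] show ?case by (simp add: mult.assoc)
qed (auto simp: distrib_right assms intro: hpoly.intros hpoly_cmult)

lemma hpoly_coord: "hpoly 1 (\<lambda>x. x $ i)"
  using hpoly.var[OF hpoly.const, of i 1] by simp

lemma hpoly_inner: "hpoly 1 (\<lambda>x. x \<bullet> v)"
  using hpoly_sum[where A=UNIV and P="\<lambda>i x. v $ i * x $ i", OF hpoly_cmult[OF hpoly_coord]]
  by (simp add: inner_vec_def mult.commute)

lemma hpoly_normsq: "hpoly 2 (\<lambda>x. x \<bullet> x)"
  using hpoly_sum[where A=UNIV and P="\<lambda>i x. x $ i * x $ i", OF hpoly_mult[OF hpoly_coord hpoly_coord]]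
  by (simp add: inner_vec_def numeral_2_eq_2)

lemma hpoly_differentiable: "hpoly m P \<Longrightarrow> P differentiable (at x)"
proof (induction rule: hpoly.induct)
  case (var m P i)
  have "(\<lambda>x. x $ i) differentiable (at x)"
    by (intro bounded_linear_imp_differentiable bounded_linear_vec_nth)
  with var show ?case by (intro differentiable_mult)
qed (auto intro: differentiable_add)

lemma hpoly_continuous_on: "hpoly m P \<Longrightarrow> continuous_on S P"
  by (meson differentiable_imp_continuous_on differentiable_on_def differentiable_at_withinI hpoly_differentiable)

lemma pd_const [simp]: "pd v (\<lambda>x. c) x = 0"
  by (simp add: pd_eq[OF has_derivative_const])

lemma pd_inner [simp]: "pd v (\<lambda>x. x \<bullet> u) x = v \<bullet> u"
  by (rule pd_eq) (auto intro!: derivative_eq_intros)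

lemma pd_coord [simp]: "pd v (\<lambda>x. x $ i) x = v $ i"
  by (rule pd_eq) (auto intro!: bounded_linear_imp_has_derivative bounded_linear_vec_nth)

lemma pd_add:
  assumes "P differentiable (at x)" "Q differentiable (at x)"
  shows "pd v (\<lambda>x. P x + Q x) x = pd v P x + pd v Q x"
proof -
  obtain P' Q' where "(P has_derivative P') (at x)" "(Q has_derivative Q') (at x)"
    using assms by (auto simp: differentiable_def)
  then show ?thesis
    by (simp add: pd_eq pd_eq[OF has_derivative_add])
qed

lemma pd_diff:
  assumes "P differentiable (at x)" "Q differentiable (at x)"
  shows "pd v (\<lambda>x. P x - Q x) x = pd v P x - pd v Q x"
proof -
  obtain P' Q' where "(P has_derivative P') (at x)" "(Q has_derivative Q') (at x)"
    using assms by (auto simp: differentiable_def)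
  then show ?thesis
    by (simp add: pd_eq pd_eq[OF has_derivative_diff])
qed

lemma pd_mult:
  fixes P Q :: "real ^ 'n \<Rightarrow> real"
  assumes "P differentiable (at x)" "Q differentiable (at x)"
  shows "pd v (\<lambda>x. P x * Q x) x = pd v P x * Q x + P x * pd v Q x"
proof -
  obtain P' Q' where "(P has_derivative P') (at x)" "(Q has_derivative Q') (at x)"
    using assms by (auto simp: differentiable_def)
  then show ?thesis
    by (simp add: pd_eq pd_eq[OF has_derivative_mult])
qed

lemma pd_cmult:
  fixes P :: "real ^ 'n \<Rightarrow> real"
  assumes "P differentiable (at x)"
  shows "pd v (\<lambda>x. c * P x) x = c * pd v P x"
  using pd_mult[of "\<lambda>_. c" x P v] assms by simp

lemma pd_sum:
  assumes "\<And>i. i \<in> A \<Longrightarrow> P i differentiable (at x)"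
  shows "pd v (\<lambda>x. \<Sum>i\<in>A. P i x) x = (\<Sum>i\<in>A. pd v (P i) x)"
  using assms
  by (induction A rule: infinite_finite_induct) (auto simp: pd_add)

lemma pd_direction:
  assumes "P differentiable (at x)"
  shows "pd v P x = (\<Sum>i\<in>UNIV. v $ i *\<^sub>R pd (axis i 1) P x)"
proof -
  obtain P' where P': "(P has_derivative P') (at x)"
    using assms by (auto simp: differentiable_def)
  then interpret linear P' by (rule has_derivative_linear)
  have "P' v = P' (\<Sum>i\<in>UNIV. v $ i *\<^sub>R axis i 1)"
    using basis_expansion[of v] by (simp add: scalar_mult_eq_scaleR)
  then show ?thesis
    by (simp add: pd_eq[OF P'] sum scale)
qed

text \<open>
  The degree \<open>m - 1\<close> is truncated at \<open>m = 0\<close>; that is harmless because the derivative then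
  vanishes, and the induction has to carry this fact along.
\<close>

lemma pd_hpoly:
  assumes "hpoly m P"
  shows "hpoly (m - 1) (pd v P)" and "m = 0 \<Longrightarrow> pd v P = (\<lambda>x. 0)"
proof -
  have "hpoly (m - 1) (pd v P) \<and> (m = 0 \<longrightarrow> pd v P = (\<lambda>x. 0))"
    using assms
  proof (induction rule: hpoly.induct)
    case (const c)
    then show ?case by (simp add: pd_const[abs_def] hpoly.const)
  next
    case (var m P i)
    have "pd v (\<lambda>x. x $ i * P x) = (\<lambda>x. v $ i * P x + x $ i * pd v P x)"
      using var by (simp add: fun_eq_iff pd_mult hpoly_differentiable[OF hpoly_coord] hpoly_differentiable)
    moreover have "hpoly m (\<lambda>x. x $ i * pd v P x)"
    proof (cases m)
      case 0
      then have "pd v P = (\<lambda>x. 0)"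
        using var.IH by simp
      then show ?thesis by (simp add: hpoly_zero)
    next
      case (Suc l)
      then show ?thesis using hpoly.var[of _ "pd v P", of _ i] var.IH by simp
    qed
    ultimately show ?case using var by (simp add: hpoly.add hpoly_cmult)
  next
    case (add m P Q)
    have "pd v (\<lambda>x. P x + Q x) = (\<lambda>x. pd v P x + pd v Q x)"
      using add by (simp add: fun_eq_iff pd_add hpoly_differentiable)
    with add show ?case by (simp add: hpoly.add)
  qed
  then show "hpoly (m - 1) (pd v P)" "m = 0 \<Longrightarrow> pd v P = (\<lambda>x. 0)"
    by auto
qed


lemma pd_hpoly_Suc: "hpoly (Suc m) P \<Longrightarrow> hpoly m (pd v P)"
  using pd_hpoly(1)[of "Suc m"] by simp

lemma euler:
  assumes "hpoly m P"
  shows "pd x P x = real m * P x"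
  using assms
proof (induction rule: hpoly.induct)
  case (var m P i)
  then show ?case
    by (simp add: pd_mult hpoly_differentiable[OF hpoly_coord] hpoly_differentiable algebra_simps)
qed (auto simp: pd_add hpoly_differentiable algebra_simps)

lemma euler_sum:
  assumes "hpoly m P"
  shows "(\<Sum>i\<in>UNIV. x $ i * pd (axis i 1) P x) = real m * P x"
  using euler[OF assms] pd_direction[OF hpoly_differentiable[OF assms], of x x] by simp

lemma hpoly_scale:
  assumes "hpoly m P"
  shows "P (c *\<^sub>R x) = c ^ m * P x"
  using assms by (induction rule: hpoly.induct) (auto simp: algebra_simps)

lemma pd_commute:
  assumes "hpoly m P"
  shows "pd u (pd v P) = pd v (pd u P)"
  using assms
proof (induction rule: hpoly.induct)
  case (const c)
  then show ?case by (simp add: pd_const[abs_def])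
next
  case (var m P i)
  have *: "pd v (\<lambda>x. x $ i * P x) = (\<lambda>x. v $ i * P x + x $ i * pd v P x)" for v
    using var by (simp add: fun_eq_iff pd_mult hpoly_differentiable[OF hpoly_coord] hpoly_differentiable)
  have [simp]: "P differentiable at x" "pd v P differentiable at x" "(\<lambda>x. x $ i) differentiable at x" for v x
    using var hpoly_differentiable pd_hpoly hpoly_coord by blast+
  have "pd u (\<lambda>x. v $ i * P x + x $ i * pd v P x) x =
      v $ i * pd u P x + (u $ i * pd v P x + x $ i * pd u (pd v P) x)" for u v x
    by (simp add: pd_add pd_mult pd_cmult differentiable_mult)
  then show ?case
    unfolding * using var.IH by (simp add: fun_eq_iff)
next
  case (add m P Q)
  have *: "pd v (\<lambda>x. P x + Q x) = (\<lambda>x. pd v P x + pd v Q x)" for v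
    using add by (simp add: fun_eq_iff pd_add hpoly_differentiable)
  show ?case
    unfolding * using add by (simp add: fun_eq_iff pd_add hpoly_differentiable[OF pd_hpoly(1)])
qed

lemma laplacian_mult:
  fixes P Q :: "real ^ 'n \<Rightarrow> real"
  assumes P: "hpoly m P" and Q: "hpoly k Q"
  shows "laplacian (\<lambda>x. P x * Q x) x = laplacian P x * Q x + P x * laplacian Q x
           + 2 * (\<Sum>i\<in>UNIV. pd (axis i 1) P x * pd (axis i 1) Q x)"
proof -
  note [simp] = hpoly_differentiable[OF P] hpoly_differentiable[OF Q]
    hpoly_differentiable[OF pd_hpoly(1)[OF P]] hpoly_differentiable[OF pd_hpoly(1)[OF Q]]
  have *: "pd v (\<lambda>x. P x * Q x) = (\<lambda>x. pd v P x * Q x + P x * pd v Q x)" for v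
    by (simp add: fun_eq_iff pd_mult)
  have "pd v (pd v (\<lambda>x. P x * Q x)) x =
      pd v (pd v P) x * Q x + P x * pd v (pd v Q) x + 2 * (pd v P x * pd v Q x)" for v
    unfolding * by (simp add: pd_add pd_mult differentiable_mult)
  then show ?thesis
    by (simp add: laplacian_eq_sum_pd sum.distrib sum_distrib_left sum_distrib_right)
qed

lemma laplacian_add:
  assumes "hpoly m P" "hpoly k Q"
  shows "laplacian (\<lambda>x. P x + Q x) x = laplacian P x + laplacian Q x"
proof -
  have *: "pd v (\<lambda>x. P x + Q x) = (\<lambda>x. pd v P x + pd v Q x)" for v
    using assms by (simp add: fun_eq_iff pd_add hpoly_differentiable)
  show ?thesis
    using assms by (simp add: laplacian_eq_sum_pd * sum.distrib pd_add hpoly_differentiable[OF pd_hpoly(1)])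
qed

lemma laplacian_cmult:
  assumes "hpoly m P"
  shows "laplacian (\<lambda>x. c * P x) x = c * laplacian P x"
proof -
  have *: "pd v (\<lambda>x. c * P x) = (\<lambda>x. c * pd v P x)" for v
    using assms by (simp add: fun_eq_iff pd_cmult hpoly_differentiable)
  show ?thesis
    using assms by (simp add: laplacian_eq_sum_pd * sum_distrib_left pd_cmult hpoly_differentiable[OF pd_hpoly(1)])
qed

lemma laplacian_inner [simp]: "laplacian (\<lambda>x. x \<bullet> v) x = (0::real)"
  by (simp add: laplacian_eq_sum_pd pd_inner[abs_def])

lemma pd_normsq [simp]: "pd v (\<lambda>x. x \<bullet> x) x = 2 * (x \<bullet> v)"
  by (rule pd_eq) (auto intro!: derivative_eq_intros simp: inner_commute)

lemma laplacian_normsq [simp]: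
  "laplacian (\<lambda>x. x \<bullet> x) (x :: real ^ 'n) = 2 * real CARD('n)"
proof -
  have "pd v (\<lambda>x. 2 * (x \<bullet> v)) x = 2 * (v \<bullet> v)" for x v :: "real ^ 'n"
    by (simp add: pd_cmult hpoly_differentiable[OF hpoly_inner])
  then show ?thesis
    by (simp add: laplacian_eq_sum_pd pd_normsq[abs_def] inner_axis_axis)
qed

lemma laplacian_pd:
  assumes "hpoly m P"
  shows "laplacian (pd v P) x = pd v (laplacian P) x"
proof -
  have "laplacian P = (\<lambda>x. \<Sum>i\<in>UNIV. pd (axis i 1) (pd (axis i 1) P) x)"
    by (simp add: fun_eq_iff laplacian_eq_sum_pd)
  then have "pd v (laplacian P) x = (\<Sum>i\<in>UNIV. pd v (pd (axis i 1) (pd (axis i 1) P)) x)"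
    using assms by (simp add: pd_sum hpoly_differentiable[OF pd_hpoly(1)[OF pd_hpoly(1)]])
  moreover have "pd v (pd u (pd u P)) = pd u (pd u (pd v P))" for u
    using pd_commute[OF assms] pd_commute[OF pd_hpoly(1)[OF assms]] by metis
  ultimately show ?thesis
    by (simp add: laplacian_eq_sum_pd)
qed

subsection \<open>Comparison with finite sums of monomials\<close>

lemma hpoly_monomial:
  fixes \<alpha> :: "'n::finite \<Rightarrow> nat"
  shows "hpoly (\<Sum>i\<in>UNIV. \<alpha> i) (\<lambda>x. \<Prod>i\<in>UNIV. x $ i ^ \<alpha> i)"
proof -
  have pow: "hpoly a (\<lambda>x. x $ i ^ a)" for a and i :: 'n
    by (induction a) (auto intro: hpoly.intros)
  have "hpoly (\<Sum>i\<in>A. \<alpha> i) (\<lambda>x. \<Prod>i\<in>A. x $ i ^ \<alpha> i)" for A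
    by (induction A rule: infinite_finite_induct)
       (auto intro: hpoly.const hpoly_mult pow)
  then show ?thesis .
qed

lemma poly_funs_add:
  assumes "P \<in> poly_funs A" "Q \<in> poly_funs A"
  shows "(\<lambda>x. P x + Q x) \<in> poly_funs A"
proof -
  obtain c d where "P = (\<lambda>x. \<Sum>\<alpha>\<in>A. (\<Prod>i\<in>UNIV. x $ i ^ \<alpha> i) *\<^sub>R c \<alpha>)"
    "Q = (\<lambda>x. \<Sum>\<alpha>\<in>A. (\<Prod>i\<in>UNIV. x $ i ^ \<alpha> i) *\<^sub>R d \<alpha>)"
    using assms unfolding poly_funs_def by auto
  then show ?thesis
    unfolding poly_funs_def
    by (auto intro!: exI[of _ "\<lambda>\<alpha>. c \<alpha> + d \<alpha>"] simp: scaleR_add_right sum.distrib)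
qed

lemma poly_funs_sum:
  assumes "finite B" "\<And>i. i \<in> B \<Longrightarrow> P i \<in> poly_funs A"
  shows "(\<lambda>x. \<Sum>i\<in>B. P i x) \<in> poly_funs A"
  using assms
proof (induction B rule: finite_induct)
  case empty
  show ?case by (auto simp: poly_funs_def intro!: exI[of _ "\<lambda>_. 0"])
qed (auto intro: poly_funs_add)

lemma poly_funs_monomial:
  assumes "\<alpha> \<in> A" "finite A"
  shows "(\<lambda>x. (\<Prod>i\<in>UNIV. x $ i ^ \<alpha> i) *\<^sub>R c) \<in> poly_funs A"
proof -
  have "(\<Sum>\<beta>\<in>A. (\<Prod>i\<in>UNIV. x $ i ^ \<beta> i) *\<^sub>R (if \<beta> = \<alpha> then c else 0)) =
     (\<Prod>i\<in>UNIV. x $ i ^ \<alpha> i) *\<^sub>R c" for x :: "real ^ 'a"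
    using assms by (simp add: if_distrib[of "scaleR _"] sum.delta cong: if_cong)
  then show ?thesis
    unfolding poly_funs_def by (auto intro!: exI[of _ "\<lambda>\<beta>. if \<beta> = \<alpha> then c else 0"])
qed

lemma poly_funs_homogeneous: "poly_funs {\<alpha>. (\<Sum>i\<in>UNIV. \<alpha> i) = m} = {P. hpoly m P}"
proof (intro set_eqI iffI; (elim CollectE | intro CollectI)?)
  fix P :: "real ^ 'n \<Rightarrow> real"
  assume "P \<in> poly_funs {\<alpha>. (\<Sum>i\<in>UNIV. \<alpha> i) = m}"
  then obtain c where "P = (\<lambda>x. \<Sum>\<alpha>\<in>{\<alpha>. (\<Sum>i\<in>UNIV. \<alpha> i) = m}. c \<alpha> * (\<Prod>i\<in>UNIV. x $ i ^ \<alpha> i))"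
    unfolding poly_funs_def by (auto simp: mult.commute)
  then show "hpoly m P"
    using hpoly_monomial by (auto intro!: hpoly_sum hpoly_cmult)
next
  fix P :: "real ^ 'n \<Rightarrow> real"
  assume "hpoly m P"
  then show "P \<in> poly_funs {\<alpha>. (\<Sum>i\<in>UNIV. \<alpha> i) = m}"
  proof (induction rule: hpoly.induct)
    case (const c)
    show ?case
      using poly_funs_monomial[of "\<lambda>_::'n. 0" "{\<alpha>. (\<Sum>i\<in>UNIV. \<alpha> i) = 0}" c]
      finite_multi_indices(2)[of 0] by simp
  next
    case (var m P i)
    obtain c where P: "P = (\<lambda>x. \<Sum>\<alpha>\<in>{\<alpha>. (\<Sum>i\<in>UNIV. \<alpha> i) = m}. (\<Prod>i\<in>UNIV. x $ i ^ \<alpha> i) *\<^sub>R c \<alpha>)"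
      using var unfolding poly_funs_def by auto
    have shift: "x $ i * (\<Prod>j\<in>UNIV. x $ j ^ \<alpha> j) = (\<Prod>j\<in>UNIV. x $ j ^ (\<alpha>(i := Suc (\<alpha> i))) j)"
      for x :: "real ^ 'n" and \<alpha>
      by (subst (1 2) prod.remove[of UNIV i]) auto
    have deg: "(\<Sum>j\<in>UNIV. (\<alpha>(i := Suc (\<alpha> i))) j) = Suc (\<Sum>j\<in>UNIV. \<alpha> j)" for \<alpha>
      by (subst (1 2) sum.remove[of UNIV i]) auto
    have "(\<lambda>x. (\<Prod>j\<in>UNIV. x $ j ^ (\<alpha>(i := Suc (\<alpha> i))) j) *\<^sub>R c \<alpha>)
        \<in> poly_funs {\<alpha>. (\<Sum>i\<in>UNIV. \<alpha> i) = Suc m}" if "(\<Sum>i\<in>UNIV. \<alpha> i) = m" for \<alpha>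
      by (rule poly_funs_monomial) (use that deg in auto)
    then have "(\<lambda>x. \<Sum>\<alpha>\<in>{\<alpha>. (\<Sum>i\<in>UNIV. \<alpha> i) = m}.
        (\<Prod>j\<in>UNIV. x $ j ^ (\<alpha>(i := Suc (\<alpha> i))) j) *\<^sub>R c \<alpha>)
        \<in> poly_funs {\<alpha>. (\<Sum>i\<in>UNIV. \<alpha> i) = Suc m}"
      by (intro poly_funs_sum) auto
    then show ?case
      by (simp add: P sum_distrib_left mult.assoc[symmetric] shift del: fun_upd_apply)
  qed (rule poly_funs_add)
qed

lemma spherical_harmonics_iff: "Y \<in> spherical_harmonics n \<longleftrightarrow> hpoly n Y \<and> (\<forall>x. laplacian Y x = 0)"
  by (simp add: spherical_harmonics_def poly_funs_homogeneous)

text \<open>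
  Grouping the monomials by degree reduces orthogonality to polynomials of degree at most \<open>k\<close>
  to orthogonality to homogeneous ones.
\<close>

lemma spherical_polys_decompose:
  fixes P :: "real ^ 'n \<Rightarrow> real"
  assumes "P \<in> spherical_polys k"
  obtains Q where "\<And>m. hpoly m (Q m)" "\<And>x. P x = (\<Sum>m\<le>k. Q m x)"
proof -
  obtain c where P: "P = (\<lambda>x. \<Sum>\<alpha>\<in>{\<alpha>. (\<Sum>i\<in>UNIV. \<alpha> i) \<le> k}. (\<Prod>i\<in>UNIV. x $ i ^ \<alpha> i) *\<^sub>R c \<alpha>)"
    using assms unfolding spherical_polys_def poly_funs_def by auto
  define Q where "Q m x = (\<Sum>\<alpha>\<in>{\<alpha>. (\<Sum>i\<in>UNIV. \<alpha> i) = m}. c \<alpha> * (\<Prod>i\<in>UNIV. x $ i ^ \<alpha> i))"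
    for m and x :: "real ^ 'n"
  show thesis
  proof
    show "hpoly m (Q m)" for m
      unfolding Q_def using hpoly_monomial by (auto intro!: hpoly_sum hpoly_cmult)
    have "(\<Sum>m\<le>k. Q m x) = (\<Sum>m\<le>k. \<Sum>\<alpha>\<in>{\<alpha>\<in>{\<alpha>. (\<Sum>i\<in>UNIV. \<alpha> i) \<le> k}. (\<Sum>i\<in>UNIV. \<alpha> i) = m}. c \<alpha> * (\<Prod>i\<in>UNIV. x $ i ^ \<alpha> i))" for x
      unfolding Q_def by (intro sum.cong) auto
    also have "\<dots> x = P x" for x
      unfolding P by (subst sum.group) (auto simp: mult.commute)
    finally show "P x = (\<Sum>m\<le>k. Q m x)" for x ..
  qed
qed

section \<open>Integration over the sphere\<close>

subsection \<open>Rotation invariance\<close>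

text \<open>
  Elementary row operations generate all linear maps, and each of them changes volumes by a constant
  factor. The value of the factor is of no interest here: for an orthogonal map it must be \<open>1\<close>, since
  the unit ball is mapped onto itself.
\<close>

lemma linear_image_measure_factor:
  fixes f :: "real ^ 'n \<Rightarrow> real ^ 'n"
  assumes "linear f"
  shows "\<exists>c. \<forall>S \<in> lmeasurable. f ` S \<in> lmeasurable \<and> c * measure lebesgue S = measure lebesgue (f ` S)"
  using assms
proof (rule induct_linear_elementary)
  fix f g :: "real ^ 'n \<Rightarrow> real ^ 'n"
  assume "\<exists>c. \<forall>S \<in> lmeasurable. f ` S \<in> lmeasurable \<and> c * measure lebesgue S = measure lebesgue (f ` S)"
    and "\<exists>c. \<forall>S \<in> lmeasurable. g ` S \<in> lmeasurable \<and> c * measure lebesgue S = measure lebesgue (g ` S)"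
  then obtain b c where "\<And>S. S \<in> lmeasurable \<Longrightarrow> f ` S \<in> lmeasurable \<and> b * measure lebesgue S = measure lebesgue (f ` S)"
    and "\<And>S. S \<in> lmeasurable \<Longrightarrow> g ` S \<in> lmeasurable \<and> c * measure lebesgue S = measure lebesgue (g ` S)"
    by metis
  then show "\<exists>c. \<forall>S \<in> lmeasurable. (f \<circ> g) ` S \<in> lmeasurable \<and> c * measure lebesgue S = measure lebesgue ((f \<circ> g) ` S)"
    unfolding image_comp[symmetric] by (intro exI[of _ "b * c"] ballI) (metis mult.assoc)
next
  fix f :: "real ^ 'n \<Rightarrow> real ^ 'n" and i
  assume f: "linear f" "\<And>x. f x $ i = 0"
  have "negligible (f ` S)" for S
    by (rule negligible_subset[OF negligible_standard_hyperplane_cart[of i]]) (use f in auto)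
  then show "\<exists>c. \<forall>S \<in> lmeasurable. f ` S \<in> lmeasurable \<and> c * measure lebesgue S = measure lebesgue (f ` S)"
    by (intro exI[of _ 0]) (auto simp: negligible_iff_measure)
next
  fix c :: "'n \<Rightarrow> real"
  show "\<exists>a. \<forall>S \<in> lmeasurable. (\<lambda>x. \<chi> i. c i * x $ i) ` S \<in> lmeasurable \<and>
      a * measure lebesgue S = measure lebesgue ((\<lambda>x. \<chi> i. c i * x $ i) ` S)"
    by (intro exI[of _ "\<bar>prod c UNIV\<bar>"]) (auto simp: measurable_stretch measure_stretch)
next
  fix m n :: 'n
  let ?h = "\<lambda>x :: real ^ 'n. \<chi> i. x $ Transposition.transpose m n i"
  have lin: "linear ?h"
    by (rule linearI) (simp_all add: plus_vec_def scaleR_vec_def)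
  have "measure lebesgue (?h ` cbox a b) = measure lebesgue (cbox a b)" for a b
  proof (cases "cbox a b = {}")
    case False
    have eq: "?h ` cbox a b = cbox (?h a) (?h b)"
      by (auto simp: image_iff lambda_swap_Galois mem_box_cart) (metis transpose_involutory)+
    have "measure lborel (cbox (?h a) (?h b)) = (\<Prod>i\<in>UNIV. (b - a) $ Transposition.transpose m n i)"
      by (subst content_cbox_cart) (use False eq in auto)
    also have "\<dots> = (\<Prod>i\<in>UNIV. (b - a) $ i)"
      using prod.permute[OF permutes_swap_id, where S = UNIV and g = "\<lambda>i. (b - a) $ i"]
      by (simp add: o_def)
    also have "\<dots> = measure lborel (cbox a b)"
      using False by (simp add: content_cbox_cart)
    finally show ?thesis
      unfolding eq by simp
  qed simp
  then show "\<exists>c. \<forall>S \<in> lmeasurable. ?h ` S \<in> lmeasurable \<and> c * measure lebesgue S = measure lebesgue (?h ` S)"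
    by (intro exI[of _ 1] ballI measure_linear_sufficient[OF lin]) auto
next
  fix m n :: 'n
  assume "m \<noteq> n"
  let ?h = "\<lambda>x :: real ^ 'n. \<chi> i. if i = m then x $ m + x $ n else x $ i"
  have lin: "linear ?h"
    by (rule linearI) (auto simp: algebra_simps plus_vec_def scaleR_vec_def vec_eq_iff)
  have "measure lebesgue (?h ` cbox a b) = measure lebesgue (cbox a b)" for a b
  proof (cases "cbox a b = {}")
    case False
    define v where "v = - a"
    have ne: "cbox (v + a) (v + b) \<noteq> {}"
      using False by (simp add: cbox_translation)
    have "?h ` ((+) v ` cbox a b) = (+) (?h v) ` (?h ` cbox a b)"
      by (simp add: image_comp o_def linear_add[OF lin])
    then have "measure lebesgue (?h ` cbox a b) = measure lebesgue (?h ` cbox (v + a) (v + b))"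
      by (simp only: cbox_translation measure_translation)
    also have "\<dots> = measure lebesgue (cbox (v + a) (v + b))"
      by (rule measure_shear_interval) (use \<open>m \<noteq> n\<close> ne in \<open>auto simp: v_def\<close>)
    also have "\<dots> = measure lebesgue (cbox a b)"
      by (simp only: cbox_translation measure_translation)
    finally show ?thesis .
  qed simp
  then show "\<exists>c. \<forall>S \<in> lmeasurable. ?h ` S \<in> lmeasurable \<and> c * measure lebesgue S = measure lebesgue (?h ` S)"
    by (intro exI[of _ 1] ballI measure_linear_sufficient[OF lin]) auto
qed

lemma measure_orthogonal_image_cart:
  fixes f :: "real ^ 'n \<Rightarrow> real ^ 'n"
  assumes f: "orthogonal_transformation f" and S: "S \<in> lmeasurable"
  shows "f ` S \<in> lmeasurable" "measure lebesgue (f ` S) = measure lebesgue S"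
proof -
  obtain c where c: "\<And>S. S \<in> lmeasurable \<Longrightarrow> f ` S \<in> lmeasurable \<and> c * measure lebesgue S = measure lebesgue (f ` S)"
    using linear_image_measure_factor[OF orthogonal_transformation_linear[OF f]] by blast
  have "c * measure lebesgue (ball (0 :: real ^ 'n) 1) = measure lebesgue (ball (0 :: real ^ 'n) 1)"
    using c[of "ball 0 1"] image_orthogonal_transformation_ball[OF f, of 0 1] linear_0[OF orthogonal_transformation_linear[OF f]]
    by simp
  moreover have "measure lebesgue (ball (0 :: real ^ 'n) 1) > 0"
    using content_ball_pos[of 1 "0 :: real ^ 'n"] by simp
  ultimately have "c = 1" by simp
  with c[OF S] show "f ` S \<in> lmeasurable" "measure lebesgue (f ` S) = measure lebesgue S"
    by auto
qed

text \<open>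
  The surface measure of a set is the volume of the cone over it, and orthogonal maps send cones to
  cones.
\<close>

lemma distr_sphere_measure_orthogonal:
  fixes R :: "real ^ 'n \<Rightarrow> real ^ 'n"
  assumes R: "orthogonal_transformation R"
  shows "R \<in> measurable sphere_measure sphere_measure"
    and "distr sphere_measure sphere_measure R = sphere_measure"
proof -
  have lin: "linear R" and norm: "\<And>x. norm (R x) = norm x"
    using R by (auto simp: orthogonal_transformation)
  have borel: "R \<in> borel_measurable borel"
    using lin by (intro borel_measurable_continuous_onI linear_continuous_on) (simp add: linear_conv_bounded_linear)
  show meas: "R \<in> measurable sphere_measure sphere_measure"
    unfolding measurable_cong_sets[OF sets_sphere_measure sets_sphere_measure]
    using borel by (intro measurable_restrict_space2 measurable_restrict_space1) (auto simp: space_restrict_space norm)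
  show "distr sphere_measure sphere_measure R = sphere_measure"
  proof (rule measure_eqI)
    fix A assume "A \<in> sets (distr sphere_measure sphere_measure R)"
    then have "A \<in> sets sphere_measure" by simp
    then have A: "A \<in> sets borel" "A \<subseteq> sphere 0 1"
      by (auto simp: sets_sphere_measure sets_restrict_space_iff)
    let ?S = "{x \<in> ball 0 1 - {0}. sgn x \<in> A}"
    let ?B = "R -` A \<inter> sphere 0 1"
    let ?T = "{x \<in> ball 0 1 - {0}. sgn x \<in> ?B}"
    have B: "?B \<in> sets borel" "?B \<subseteq> sphere 0 1"
      using borel A(1) by (auto intro!: sets.Int borel_measurable_vimage simp: measurable_sets_borel)
    have fin: "U \<in> lmeasurable" "emeasure lborel U = ennreal (measure lebesgue U)"
      if "U \<in> sets borel" "U \<subseteq> ball 0 1" for U :: "(real ^ 'n) set"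
    proof -
      show "U \<in> lmeasurable"
        using that bounded_subset[OF bounded_ball] by (intro bounded_set_imp_lmeasurable) auto
      then show "emeasure lborel U = ennreal (measure lebesgue U)"
        using that emeasure_eq_measure2[of U lebesgue] by (simp add: fmeasurable_def emeasure_eq_ennreal_measure)
    qed
    have sgn: "sgn (R x) = R (sgn x)" for x
      using linear_scale[OF lin] by (simp add: sgn_div_norm norm)
    have "R ` ?T = ?S"
    proof (rule subset_antisym)
      show "R ` ?T \<subseteq> ?S"
        by (auto simp: norm sgn) (metis norm norm_eq_zero norm_zero)
      show "?S \<subseteq> R ` ?T"
      proof
        fix y assume y: "y \<in> ?S"
        obtain x where x: "y = R x"
          using orthogonal_transformation_surj[OF R] by (metis surjD)
        with y have "x \<in> ?T"
          by (auto simp: norm sgn linear_0[OF lin] norm_sgn)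
        with x show "y \<in> R ` ?T" by blast
      qed
    qed
    have "?S \<subseteq> ball 0 1" "?T \<subseteq> ball 0 1" by auto
    note S = fin[OF emeasure_sphere_measure(1)[OF A] \<open>?S \<subseteq> ball 0 1\<close>]
      and T = fin[OF emeasure_sphere_measure(1)[OF B] \<open>?T \<subseteq> ball 0 1\<close>]
    have "emeasure lborel ?T = emeasure lborel ?S"
      by (simp only: S(2) T(2) measure_orthogonal_image_cart(2)[OF R T(1), symmetric] \<open>R ` ?T = ?S\<close>)
    then show "emeasure (distr sphere_measure sphere_measure R) A = emeasure sphere_measure A"
      using \<open>A \<in> sets sphere_measure\<close> B A
      by (simp add: emeasure_distr[OF meas] emeasure_sphere_measure(2))
  qed simp
qed

abbreviation sint :: "(real ^ 'n \<Rightarrow> 'b::{banach, second_countable_topology}) \<Rightarrow> 'b" where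
  "sint F \<equiv> (LINT x|sphere_measure. F x)"

lemma continuous_borel_measurable_sphere:
  fixes F :: "real ^ 'n \<Rightarrow> 'b::topological_space"
  assumes "continuous_on (sphere 0 1) F"
  shows "F \<in> borel_measurable sphere_measure"
  unfolding measurable_cong_sets[OF sets_sphere_measure refl]
  using assms by (rule borel_measurable_continuous_on_restrict)

lemma integrable_bounded_sphere:
  fixes F :: "real ^ 'n \<Rightarrow> 'b::{banach, second_countable_topology}"
  assumes "F \<in> borel_measurable sphere_measure" "\<And>x. x \<in> sphere 0 1 \<Longrightarrow> norm (F x) \<le> B"
  shows "integrable sphere_measure F"
  by (rule finite_measure.integrable_const_bound[OF finite_measure_sphere_measure, of _ B])
     (use assms in \<open>auto intro!: AE_I2\<close>)

lemma integrable_continuous_sphere: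
  fixes F :: "real ^ 'n \<Rightarrow> 'b::{banach, second_countable_topology}"
  assumes "continuous_on (sphere 0 1) F"
  shows "integrable sphere_measure F"
proof -
  have "bounded (F ` sphere 0 1)"
    using assms by (intro compact_imp_bounded compact_continuous_image) auto
  then obtain B where "\<And>x. x \<in> sphere 0 1 \<Longrightarrow> norm (F x) \<le> B"
    unfolding bounded_iff by blast
  with continuous_borel_measurable_sphere[OF assms] show ?thesis
    by (rule integrable_bounded_sphere)
qed

lemma integrable_hpoly: "hpoly m P \<Longrightarrow> integrable sphere_measure P"
  by (intro integrable_continuous_sphere hpoly_continuous_on)

lemma sint_cong: "(\<And>x. x \<in> sphere 0 1 \<Longrightarrow> F x = G x) \<Longrightarrow> sint F = sint G"
  by (rule Bochner_Integration.integral_cong) auto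

lemma sint_orthogonal:
  fixes R :: "real ^ 'n \<Rightarrow> real ^ 'n" and F :: "real ^ 'n \<Rightarrow> real"
  assumes "orthogonal_transformation R" "continuous_on (sphere 0 1) F"
  shows "sint (\<lambda>x. F (R x)) = sint F"
  using integral_distr[OF distr_sphere_measure_orthogonal(1)[OF assms(1)] continuous_borel_measurable_sphere[OF assms(2)]]
    distr_sphere_measure_orthogonal(2)[OF assms(1)] by simp

subsection \<open>The divergence identity\<close>

text \<open>
  The bound that dominates the difference quotients when an integral is differentiated under the
  integral sign.
\<close>

lemma hpoly_Lipschitz:
  fixes P :: "real ^ 'n \<Rightarrow> real"
  assumes "hpoly m P"
  shows "\<exists>B. \<forall>x \<in> cball 0 1. \<forall>y \<in> cball 0 1. \<bar>P x - P y\<bar> \<le> B * norm (x - y)"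
  using assms
proof (induction rule: hpoly.induct)
  case (const c)
  show ?case by (intro exI[of _ 0]) auto
next
  case (var m P i)
  then obtain B where B: "\<And>x y. x \<in> cball 0 1 \<Longrightarrow> y \<in> cball 0 1 \<Longrightarrow> \<bar>P x - P y\<bar> \<le> B * norm (x - y)"
    by blast
  have "bounded (P ` cball 0 1)"
    using hpoly_continuous_on[OF var(1)] by (intro compact_imp_bounded compact_continuous_image) auto
  then obtain C where C: "\<And>x. x \<in> cball 0 1 \<Longrightarrow> \<bar>P x\<bar> \<le> C"
    unfolding bounded_iff real_norm_def by blast
  show ?case
  proof (intro exI[of _ "B + C"] ballI)
    fix x y :: "real ^ 'n" assume xy: "x \<in> cball 0 1" "y \<in> cball 0 1"
    have "x $ i * P x - y $ i * P y = x $ i * (P x - P y) + (x - y) $ i * P y"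
      by (simp add: algebra_simps)
    also have "\<bar>\<dots>\<bar> \<le> 1 * \<bar>P x - P y\<bar> + norm (x - y) * C"
      unfolding abs_mult[symmetric]
      using component_le_norm_cart[of x i] component_le_norm_cart[of "x - y" i] C[OF xy(2)] xy
      by (intro order_trans[OF abs_triangle_ineq] add_mono) (auto simp: abs_mult intro!: mult_mono mult_left_le_one_le)
    also have "\<dots> \<le> (B + C) * norm (x - y)"
      using B[OF xy] by (simp add: algebra_simps)
    finally show "\<bar>x $ i * P x - y $ i * P y\<bar> \<le> (B + C) * norm (x - y)" .
  qed
next
  case (add m P Q)
  then obtain B C where "\<forall>x \<in> cball 0 1. \<forall>y \<in> cball 0 1. \<bar>P x - P y\<bar> \<le> B * norm (x - y)"
    "\<forall>x \<in> cball 0 1. \<forall>y \<in> cball 0 1. \<bar>Q x - Q y\<bar> \<le> C * norm (x - y)"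
    by blast
  then show ?case
    by (intro exI[of _ "B + C"]) (fastforce simp: distrib_right)
qed

definition plane_rotation :: "'n \<Rightarrow> 'n \<Rightarrow> real \<Rightarrow> real ^ 'n \<Rightarrow> real ^ 'n" where
  "plane_rotation i k \<theta> x = (\<chi> j. if j = i then cos \<theta> * x $ i - sin \<theta> * x $ k
     else if j = k then sin \<theta> * x $ i + cos \<theta> * x $ k else x $ j)"

lemma orthogonal_plane_rotation:
  fixes i k :: "'n::finite"
  assumes "i \<noteq> k"
  shows "orthogonal_transformation (plane_rotation i k \<theta>)"
proof -
  have lin: "linear (plane_rotation i k \<theta>)"
    by (rule linearI) (auto simp: plane_rotation_def vec_eq_iff algebra_simps)
  have "(\<Sum>j\<in>UNIV. (plane_rotation i k \<theta> x $ j)\<^sup>2) = (\<Sum>j\<in>UNIV. (x $ j)\<^sup>2)" for x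
  proof -
    have split: "(\<Sum>j\<in>UNIV. f j) = f i + (f k + (\<Sum>j\<in>UNIV - {i} - {k}. f j))" for f :: "'n \<Rightarrow> real"
      using assms by (subst sum.remove[of UNIV i], simp, simp, subst sum.remove[of "UNIV - {i}" k], auto)
    have "(cos \<theta> * x $ i - sin \<theta> * x $ k)\<^sup>2 + (sin \<theta> * x $ i + cos \<theta> * x $ k)\<^sup>2
      = ((sin \<theta>)\<^sup>2 + (cos \<theta>)\<^sup>2) * ((x $ i)\<^sup>2 + (x $ k)\<^sup>2)"
      by (simp only: power2_eq_square) algebra
    also have "\<dots> = (x $ i)\<^sup>2 + (x $ k)\<^sup>2" by simp
    finally show ?thesis
      using assms by (simp add: split plane_rotation_def)
  qed
  then have "norm (plane_rotation i k \<theta> x) = norm x" for x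
    by (simp add: norm_vec_def L2_set_def)
  with lin show ?thesis by (simp add: orthogonal_transformation)
qed

lemma has_derivative_plane_rotation:
  fixes i k :: "'n::finite"
  assumes "i \<noteq> k"
  shows "((\<lambda>\<theta>. plane_rotation i k \<theta> x) has_vector_derivative
     (x $ i *\<^sub>R axis k 1 - x $ k *\<^sub>R axis i 1)) (at 0)"
proof -
  have "((\<lambda>\<theta>. (if j = i then cos \<theta> * x $ i - sin \<theta> * x $ k
     else if j = k then sin \<theta> * x $ i + cos \<theta> * x $ k else x $ j)) has_derivative
     (\<lambda>t. t * (x $ i *\<^sub>R axis k 1 - x $ k *\<^sub>R axis i 1) $ j)) (at 0)" for j
    using assms by (auto intro!: derivative_eq_intros simp: axis_def)
  then show ?thesis
    unfolding has_vector_derivative_def plane_rotation_def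
    by (subst has_derivative_componentwise_within)
       (auto simp: Basis_vec_def inner_axis simp del: vector_minus_component)
qed

text \<open>
  Rotations in the plane of \<open>i\<close> and \<open>k\<close> preserve the integral of \<open>F\<close>; differentiating under the
  integral sign at angle zero produces the angular derivative.
\<close>

lemma sint_angular_derivative:
  fixes F :: "real ^ 'n \<Rightarrow> real"
  assumes F: "hpoly m F"
  shows "sint (\<lambda>x. x $ i * pd (axis k 1) F x - x $ k * pd (axis i 1) F x) = 0"
proof (cases "i = k")
  case False
  let ?R = "plane_rotation i k"
  let ?D = "\<lambda>x. x $ i * pd (axis k 1) F x - x $ k * pd (axis i 1) F x"
  obtain B where B: "\<And>x y. x \<in> cball 0 1 \<Longrightarrow> y \<in> cball 0 1 \<Longrightarrow> \<bar>F x - F y\<bar> \<le> B * norm (x - y)"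
    using hpoly_Lipschitz[OF F] by blast
  have normR: "norm (?R \<theta> x) = norm x" for \<theta> x
    using orthogonal_plane_rotation[OF False] by (simp add: orthogonal_transformation)
  define h :: "nat \<Rightarrow> real" where "h n = 1 / real (Suc n)" for n
  have h0: "h n > 0" for n by (simp add: h_def)
  have hlim: "h \<longlonglongrightarrow> 0"
    unfolding h_def by (rule LIMSEQ_Suc[OF lim_1_over_n])
  have dist: "norm (?R \<theta> x - x) \<le> 4 * \<bar>\<theta>\<bar> * norm x" for \<theta> x
  proof -
    have c: "\<bar>cos \<theta> - 1\<bar> \<le> \<bar>\<theta>\<bar>"
    proof -
      have "\<bar>cos \<theta> - 1\<bar> = 2 * \<bar>sin (\<theta> / 2)\<bar> * \<bar>sin (\<theta> / 2)\<bar>"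
        using cos_double_sin[of "\<theta> / 2"] by (simp add: power2_eq_square abs_mult[symmetric])
      also have "\<dots> \<le> 2 * \<bar>\<theta> / 2\<bar> * 1"
        using abs_sin_x_le_abs_x[of "\<theta> / 2"] by (intro mult_mono) auto
      finally show ?thesis by simp
    qed
    have s: "\<bar>sin \<theta>\<bar> \<le> \<bar>\<theta>\<bar>" by (rule abs_sin_x_le_abs_x)
    have "?R \<theta> x - x = ((cos \<theta> - 1) * x $ i - sin \<theta> * x $ k) *\<^sub>R axis i 1 +
        (sin \<theta> * x $ i + (cos \<theta> - 1) * x $ k) *\<^sub>R axis k 1"
      using False by (auto simp: vec_eq_iff plane_rotation_def axis_def algebra_simps)
    also have "norm \<dots> \<le> \<bar>(cos \<theta> - 1) * x $ i - sin \<theta> * x $ k\<bar> + \<bar>sin \<theta> * x $ i + (cos \<theta> - 1) * x $ k\<bar>"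
      by (rule order_trans[OF norm_triangle_ineq]) simp
    also have "\<dots> \<le> (\<bar>cos \<theta> - 1\<bar> * \<bar>x $ i\<bar> + \<bar>sin \<theta>\<bar> * \<bar>x $ k\<bar>) + (\<bar>sin \<theta>\<bar> * \<bar>x $ i\<bar> + \<bar>cos \<theta> - 1\<bar> * \<bar>x $ k\<bar>)"
      unfolding abs_mult[symmetric] by linarith
    also have "\<dots> \<le> (\<bar>\<theta>\<bar> * norm x + \<bar>\<theta>\<bar> * norm x) + (\<bar>\<theta>\<bar> * norm x + \<bar>\<theta>\<bar> * norm x)"
      using c s component_le_norm_cart[of x] by (intro add_mono mult_mono) auto
    finally show ?thesis by simp
  qed
  have pointwise: "(\<lambda>n. (F (?R (h n) x) - F x) / h n) \<longlonglongrightarrow> ?D x" for x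
  proof -
    obtain F' where F': "(F has_derivative F') (at x)"
      using hpoly_differentiable[OF F, of x] by (auto simp: differentiable_def)
    interpret linear F' using F' by (rule has_derivative_linear)
    have R0: "?R 0 x = x" by (simp add: plane_rotation_def vec_eq_iff)
    have "((\<lambda>\<theta>. F (?R \<theta> x)) has_derivative (\<lambda>t. F' (t *\<^sub>R (x $ i *\<^sub>R axis k 1 - x $ k *\<^sub>R axis i 1)))) (at 0)"
      by (rule has_derivative_compose[of "\<lambda>\<theta>. ?R \<theta> x" _ 0 UNIV F F'])
         (use has_derivative_plane_rotation[OF False, of x] F' in \<open>auto simp: has_vector_derivative_def R0\<close>)
    moreover have "(\<lambda>t. F' (t *\<^sub>R (x $ i *\<^sub>R axis k 1 - x $ k *\<^sub>R axis i 1))) = (*) (?D x)"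
      by (simp add: fun_eq_iff scale diff pd_eq[OF F'] mult.commute)
    ultimately have "((\<lambda>\<theta>. F (?R \<theta> x)) has_field_derivative ?D x) (at 0)"
      by (simp add: has_field_derivative_def)
    then have "((\<lambda>\<theta>. (F (?R \<theta> x) - F x) / \<theta>) \<longlongrightarrow> ?D x) (at 0)"
      by (simp add: DERIV_def R0)
    moreover have "filterlim h (at 0) sequentially"
      unfolding filterlim_at using hlim h0 by (auto intro!: always_eventually simp: less_imp_neq[symmetric])
    ultimately show ?thesis
      by (rule filterlim_compose)
  qed
  have cont: "continuous_on S (\<lambda>x. F (?R \<theta> x))" for S \<theta>
    by (rule continuous_on_compose2[OF hpoly_continuous_on[OF F, of UNIV]])
       (use orthogonal_plane_rotation[OF False] in
         \<open>auto intro!: linear_continuous_on simp: orthogonal_transformation linear_conv_bounded_linear[symmetric]\<close>)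
  have zero: "sint (\<lambda>x. (F (?R (h n) x) - F x) / h n) = 0" for n
  proof -
    have "sint (\<lambda>x. F (?R (h n) x) - F x) = 0"
      using sint_orthogonal[OF orthogonal_plane_rotation[OF False] hpoly_continuous_on[OF F]]
      by (simp add: integrable_continuous_sphere[OF cont] integrable_hpoly[OF F])
    then show ?thesis by simp
  qed
  have "(\<lambda>n. sint (\<lambda>x. (F (?R (h n) x) - F x) / h n)) \<longlonglongrightarrow> sint ?D"
  proof (rule integral_dominated_convergence[where w = "\<lambda>_. \<bar>B\<bar> * 4"])
    have c: "continuous_on S (pd v F)" for S v
      using hpoly_continuous_on[OF pd_hpoly(1)[OF F]] .
    show "?D \<in> borel_measurable sphere_measure"
      by (intro continuous_borel_measurable_sphere continuous_intros c)
    show "(\<lambda>x. (F (?R (h n) x) - F x) / h n) \<in> borel_measurable sphere_measure" for n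
      using h0[of n] by (intro continuous_borel_measurable_sphere continuous_intros cont hpoly_continuous_on[OF F]) auto
    show "integrable sphere_measure (\<lambda>_::real^'n. \<bar>B\<bar> * 4)"
      by (intro integrable_continuous_sphere continuous_intros)
    show "AE x in sphere_measure. (\<lambda>n. (F (?R (h n) x) - F x) / h n) \<longlonglongrightarrow> ?D x"
      by (intro AE_I2 pointwise)
    show "AE x in sphere_measure. norm ((F (?R (h n) x) - F x) / h n) \<le> \<bar>B\<bar> * 4" for n
    proof (intro AE_I2)
      fix x :: "real ^ 'n" assume "x \<in> space sphere_measure"
      then have x: "norm x = 1" by simp
      have "\<bar>F (?R (h n) x) - F x\<bar> \<le> B * norm (?R (h n) x - x)"
        by (rule B) (auto simp: normR x)
      also have "\<dots> \<le> \<bar>B\<bar> * (4 * \<bar>h n\<bar> * norm x)"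
        by (intro mult_mono dist) auto
      finally show "norm ((F (?R (h n) x) - F x) / h n) \<le> \<bar>B\<bar> * 4"
        using h0[of n] x by (simp add: field_simps)
    qed
  qed
  then show ?thesis
    unfolding zero by (simp add: LIMSEQ_const_iff)
qed simp

text \<open>
  The divergence theorem for homogeneous polynomials on the unit ball, in terms of the sphere only.
  It follows from the vanishing of the angular derivatives of \<open>x\<^sub>k P\<close> in the planes of \<open>i\<close> and \<open>k\<close>,
  summed over \<open>k\<close>: by Euler's identity the sum is \<open>(m + d - 1) x\<^sub>i P - |x|\<^sup>2 \<partial>\<^sub>i P\<close>. All later integrations by
  parts are instances of this identity.
\<close>

lemma sint_coord:
  fixes P :: "real ^ 'n \<Rightarrow> real"
  assumes P: "hpoly m P"
  shows "sint (pd (axis i 1) P) = real (m + CARD('n) - 1) * sint (\<lambda>x. x $ i * P x)"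
proof -
  let ?d = "real CARD('n)"
  let ?L = "\<lambda>k x. x $ i * pd (axis k 1) (\<lambda>x. x $ k * P x) x - x $ k * pd (axis i 1) (\<lambda>x. x $ k * P x) x"
  note [simp] = hpoly_differentiable[OF hpoly_coord] hpoly_differentiable[OF P]
  have int: "integrable sphere_measure (?L k)" for k
    by (intro Bochner_Integration.integrable_diff
        integrable_hpoly[OF hpoly.var[OF pd_hpoly_Suc[OF hpoly.var[OF P]]]])
  have "0 = (\<Sum>k\<in>UNIV. sint (?L k))"
    by (simp only: sint_angular_derivative[OF hpoly.var[OF P]] sum.neutral_const)
  also have "\<dots> = sint (\<lambda>x. \<Sum>k\<in>UNIV. ?L k x)"
    using int by (intro Bochner_Integration.integral_sum[symmetric])
  also have "\<dots> = sint (\<lambda>x. (?d + real m - 1) * (x $ i * P x) - pd (axis i 1) P x)"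
  proof (rule sint_cong)
    fix x :: "real ^ 'n" assume "x \<in> sphere 0 1"
    then have 1: "(\<Sum>k\<in>UNIV. x $ k * x $ k) = 1"
      using dot_square_norm[of x] by (simp add: inner_vec_def)
    have L: "?L k x = x $ i * P x + x $ i * (x $ k * pd (axis k 1) P x) - (if k = i then x $ i * P x else 0)
        - x $ k * x $ k * pd (axis i 1) P x" for k
      unfolding pd_mult[OF hpoly_differentiable[OF hpoly_coord] hpoly_differentiable[OF P]] pd_coord
      by (simp add: axis_def algebra_simps)
    have "(\<Sum>k\<in>UNIV. ?L k x) = ?d * (x $ i * P x) + x $ i * (\<Sum>k\<in>UNIV. x $ k * pd (axis k 1) P x)
         - x $ i * P x - (\<Sum>k\<in>UNIV. x $ k * x $ k) * pd (axis i 1) P x"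
      unfolding L sum.distrib sum_subtractf sum_distrib_left sum_distrib_right by simp
    also have "\<dots> = (?d + real m - 1) * (x $ i * P x) - pd (axis i 1) P x"
      unfolding euler_sum[OF P] 1 by (simp add: algebra_simps)
    finally show "(\<Sum>k\<in>UNIV. ?L k x) = \<dots>" .
  qed
  also have "\<dots> = sint (\<lambda>x. (?d + real m - 1) * (x $ i * P x)) - sint (pd (axis i 1) P)"
    by (intro Bochner_Integration.integral_diff integrable_mult_right integrable_hpoly[OF hpoly.var[OF P]]
        integrable_hpoly[OF pd_hpoly(1)[OF P]])
  also have "\<dots> = (?d + real m - 1) * sint (\<lambda>x. x $ i * P x) - sint (pd (axis i 1) P)"
    by simp
  finally show ?thesis
    by (simp add: of_nat_diff Suc_leI algebra_simps)
qed

lemma sint_pd: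
  fixes P :: "real ^ 'n \<Rightarrow> real"
  assumes P: "hpoly m P"
  shows "sint (pd v P) = real (m + CARD('n) - 1) * sint (\<lambda>x. (x \<bullet> v) * P x)"
proof -
  have "sint (pd v P) = sint (\<lambda>x. \<Sum>i\<in>UNIV. v $ i * pd (axis i 1) P x)"
    by (rule sint_cong, rule trans[OF pd_direction[OF hpoly_differentiable[OF P]]]) simp
  also have "\<dots> = (\<Sum>i\<in>UNIV. sint (\<lambda>x. v $ i * pd (axis i 1) P x))"
    by (intro Bochner_Integration.integral_sum integrable_mult_right integrable_hpoly[OF pd_hpoly(1)[OF P]])
  also have "\<dots> = (\<Sum>i\<in>UNIV. v $ i * sint (pd (axis i 1) P))"
    by simp
  also have "\<dots> = real (m + CARD('n) - 1) * (\<Sum>i\<in>UNIV. v $ i * sint (\<lambda>x. x $ i * P x))"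
    by (simp add: sint_coord[OF P] sum_distrib_left mult.left_commute)
  also have "(\<Sum>i\<in>UNIV. v $ i * sint (\<lambda>x. x $ i * P x)) = (\<Sum>i\<in>UNIV. sint (\<lambda>x. v $ i * (x $ i * P x)))"
    by simp
  also have "\<dots> = sint (\<lambda>x. \<Sum>i\<in>UNIV. v $ i * (x $ i * P x))"
    by (intro Bochner_Integration.integral_sum[symmetric] integrable_mult_right integrable_hpoly[OF hpoly.var[OF P]])
  also have "\<dots> = sint (\<lambda>x. (x \<bullet> v) * P x)"
    unfolding inner_vec_def sum_distrib_right by (intro sint_cong sum.cong) (auto simp: mult_ac)
  finally show ?thesis .
qed

subsection \<open>Full support\<close>

text \<open>
  A nonempty relatively open subset of the sphere spans an open cone, which has positive volume.
\<close>

lemma sphere_continuous_null: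
  fixes F :: "real ^ 'n \<Rightarrow> real"
  assumes cont: "continuous_on (sphere 0 1) F" and null: "AE x in sphere_measure. F x = 0"
    and x: "x \<in> sphere 0 1"
  shows "F x = 0"
proof (rule ccontr)
  assume "F x \<noteq> 0"
  let ?A = "{x \<in> sphere 0 1. F x \<noteq> 0}"
  let ?S = "{x \<in> ball 0 1 - {0}. sgn x \<in> ?A}"
  have "openin (top_of_set (sphere 0 1)) (sphere 0 1 \<inter> F -` (- {0}))"
    using cont by (intro continuous_openin_preimage_gen) auto
  moreover have A: "sphere 0 1 \<inter> F -` (- {0}) = ?A" by auto
  ultimately obtain U where U: "open U" "?A = U \<inter> sphere 0 1"
    by (auto simp: openin_open)
  then have A_borel: "?A \<in> sets borel" "?A \<subseteq> sphere 0 1" by auto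
  have A_sets: "?A \<in> sets sphere_measure"
    unfolding sets_sphere_measure
    by (subst sets_restrict_space_iff) (use A_borel in auto)
  have "{x \<in> space sphere_measure. \<not> F x = 0} = ?A"
    by simp
  from AE_iff_measurable[OF A_sets this] null have "emeasure sphere_measure ?A = 0"
    by (rule iffD1)
  then have "of_nat CARD('n) * emeasure lborel ?S = 0"
    by (simp only: emeasure_sphere_measure(2)[OF A_borel, symmetric])
  moreover have "(of_nat CARD('n) :: ennreal) \<noteq> 0"
    by simp
  ultimately have "emeasure lborel ?S = 0"
    unfolding mult_eq_0_iff by blast
  then have "?S \<in> null_sets lborel"
    using emeasure_sphere_measure(1)[OF A_borel] by (intro null_setsI) (simp_all only: sets_lborel)
  then have "negligible ?S"
    unfolding negligible_iff_null_sets by (rule null_sets_completionI)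
  moreover have "open ?S"
  proof -
    have "sgn x \<in> ?A \<longleftrightarrow> sgn x \<in> U" if "x \<noteq> 0" for x
      unfolding U(2) using that by (simp add: norm_sgn)
    then have "?S = (ball 0 1 - {0}) \<inter> sgn -` U"
      by blast
    moreover have "open ((ball 0 1 - {0 :: real ^ 'n}) \<inter> sgn -` U)"
      by (rule continuous_open_preimage) (auto simp: sgn_div_norm U(1) intro!: continuous_intros)
    ultimately show ?thesis by (simp only:)
  qed
  moreover have "(1/2) *\<^sub>R x \<in> ?S"
    using x \<open>F x \<noteq> 0\<close> by (auto simp: sgn_div_norm)
  ultimately show False
    using open_not_negligible by blast
qed

lemma sint_square_zero:
  fixes F :: "real ^ 'n \<Rightarrow> real"
  assumes "continuous_on (sphere 0 1) F" "sint (\<lambda>x. (F x)\<^sup>2) = 0" "x \<in> sphere 0 1"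
  shows "F x = 0"
proof -
  have "AE x in sphere_measure. (F x)\<^sup>2 = 0"
    using assms by (subst integral_nonneg_eq_0_iff_AE[symmetric])
      (auto intro!: integrable_continuous_sphere continuous_intros)
  then show ?thesis
    using assms by (intro sphere_continuous_null[of F]) auto
qed

section \<open>Spherical harmonics\<close>

lemma harmonic_hpoly: "Y \<in> spherical_harmonics n \<Longrightarrow> hpoly n Y"
  by (simp add: spherical_harmonics_iff)

lemma harmonic_laplacian:
  fixes Y :: "real ^ 'n \<Rightarrow> real"
  shows "Y \<in> spherical_harmonics n \<Longrightarrow> laplacian Y = (\<lambda>x. 0)"
  by (simp add: spherical_harmonics_iff fun_eq_iff)

lemma harmonic_differentiable:
  fixes Y :: "real ^ 'n \<Rightarrow> real"
  shows "Y \<in> spherical_harmonics n \<Longrightarrow> Y differentiable (at x)"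
  by (rule hpoly_differentiable[OF harmonic_hpoly])

lemma harmonic_continuous_on:
  fixes Y :: "real ^ 'n \<Rightarrow> real"
  shows "Y \<in> spherical_harmonics n \<Longrightarrow> continuous_on S Y"
  by (rule hpoly_continuous_on[OF harmonic_hpoly])

lemma harmonic_add:
  fixes Y :: "real ^ 'n \<Rightarrow> real"
  assumes "Y \<in> spherical_harmonics n" "Z \<in> spherical_harmonics n"
  shows "(\<lambda>x. Y x + Z x) \<in> spherical_harmonics n"
  using assms by (auto simp: spherical_harmonics_iff laplacian_add intro: hpoly.add)

lemma harmonic_cmult:
  fixes Y :: "real ^ 'n \<Rightarrow> real"
  assumes "Y \<in> spherical_harmonics n"
  shows "(\<lambda>x. c * Y x) \<in> spherical_harmonics n"
  using assms by (auto simp: spherical_harmonics_iff laplacian_cmult intro: hpoly_cmult)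

lemma harmonic_diff:
  fixes Y :: "real ^ 'n \<Rightarrow> real"
  assumes "Y \<in> spherical_harmonics n" "Z \<in> spherical_harmonics n"
  shows "(\<lambda>x. Y x - Z x) \<in> spherical_harmonics n"
  using harmonic_add[OF assms(1) harmonic_cmult[OF assms(2), of "-1"]] by simp

lemma harmonic_zero: "(\<lambda>x. 0 :: real) \<in> spherical_harmonics n"
  by (simp add: spherical_harmonics_iff hpoly_zero laplacian_eq_sum_pd pd_const[abs_def])

lemma harmonic_const: "(\<lambda>x. c :: real) \<in> spherical_harmonics 0"
  by (simp add: spherical_harmonics_iff hpoly.const laplacian_eq_sum_pd pd_const[abs_def])

lemma pd_harmonic:
  fixes Y :: "real ^ 'n \<Rightarrow> real"
  assumes "Y \<in> spherical_harmonics n"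
  shows "pd v Y \<in> spherical_harmonics (n - 1)"
  using pd_hpoly(1)[OF harmonic_hpoly[OF assms], of v] harmonic_laplacian[OF assms]
  by (simp add: spherical_harmonics_iff laplacian_pd[OF harmonic_hpoly[OF assms]])

subsection \<open>Multiplication by a linear form\<close>

text \<open>
  The part of \<open>\<langle>x, v\<rangle> Y\<close> of degree \<open>n + 1\<close>: on the sphere, \<open>\<langle>x, v\<rangle> Y\<close> is the sum of the harmonic
  \<open>raise v n Y\<close> and of a multiple of the harmonic \<open>\<partial>\<^sub>v Y\<close>. For \<open>n = 0\<close> in the plane the denominator is
  zero, but then the numerator is zero as well.
\<close>

definition raise :: "real ^ 'n \<Rightarrow> nat \<Rightarrow> (real ^ 'n \<Rightarrow> real) \<Rightarrow> real ^ 'n \<Rightarrow> real" where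
  "raise v n Y x = (x \<bullet> v) * Y x - (x \<bullet> x) * pd v Y x / (2 * real n + real CARD('n) - 2)"

lemma raise_harmonic:
  fixes Y :: "real ^ 'n \<Rightarrow> real"
  assumes Y: "Y \<in> spherical_harmonics n"
  shows "raise v n Y \<in> spherical_harmonics (Suc n)"
proof -
  let ?d = "real CARD('n)"
  define c where "c = - 1 / (2 * real n + ?d - 2)"
  have hY: "hpoly n Y" by (rule harmonic_hpoly[OF Y])
  have d1: "?d \<ge> 1" using zero_less_card_finite[where 'a = 'n] by simp
  have eq: "raise v n Y = (\<lambda>x. (x \<bullet> v) * Y x + c * ((x \<bullet> x) * pd v Y x))"
    by (simp add: raise_def c_def fun_eq_iff)
  have 1: "hpoly (Suc n) (\<lambda>x. (x \<bullet> v) * Y x)"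
    using hpoly_mult[OF hpoly_inner hY] by simp
  have grad: "(\<Sum>i\<in>UNIV. pd (axis i 1) (\<lambda>x. x \<bullet> v) x * pd (axis i 1) Y x) = pd v Y x" for x
    using pd_direction[OF hpoly_differentiable[OF hY], of v x] by (simp add: inner_axis' )
  show ?thesis
  proof (cases n)
    case 0
    then have pd0: "pd w Y = (\<lambda>x. 0)" for w using pd_hpoly(2)[OF hY] by blast
    have "laplacian (\<lambda>x. (x \<bullet> v) * Y x) x = 0" for x
      unfolding laplacian_mult[OF hpoly_inner hY] grad by (simp add: pd0 harmonic_laplacian[OF Y])
    then show ?thesis
      using 1 by (simp add: eq pd0 spherical_harmonics_iff)
  next
    case (Suc m)
    let ?W = "pd v Y"
    have W: "?W \<in> spherical_harmonics m"
      using pd_harmonic[OF Y, of v] Suc by simp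
    have hW: "hpoly m ?W" by (rule harmonic_hpoly[OF W])
    have 2: "hpoly (Suc n) (\<lambda>x. (x \<bullet> x) * ?W x)"
      using hpoly_mult[OF hpoly_normsq hW] Suc by (simp add: numeral_2_eq_2)
    have "laplacian (\<lambda>x. (x \<bullet> v) * Y x) x = 2 * ?W x" for x
      unfolding laplacian_mult[OF hpoly_inner hY] grad by (simp add: harmonic_laplacian[OF Y])
    moreover have "laplacian (\<lambda>x. (x \<bullet> x) * ?W x) x = (2 * ?d + 4 * real m) * ?W x" for x
    proof -
      have "(\<Sum>i\<in>UNIV. pd (axis i 1) (\<lambda>x. x \<bullet> x) x * pd (axis i 1) ?W x)
          = 2 * (\<Sum>i\<in>UNIV. x $ i * pd (axis i 1) ?W x)"
        by (simp add: inner_axis sum_distrib_left mult.assoc)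
      then show ?thesis
        unfolding laplacian_mult[OF hpoly_normsq hW] euler_sum[OF hW]
        by (simp add: harmonic_laplacian[OF W] algebra_simps)
    qed
    moreover have "2 * ?W x + c * ((2 * ?d + 4 * real m) * ?W x) = 0" for x
    proof -
      have "2 * real m + ?d > 0" using d1 by linarith
      then have "c * (2 * ?d + 4 * real m) = - 2"
        by (simp add: c_def Suc field_simps)
      then show ?thesis by (simp add: mult.assoc[symmetric])
    qed
    ultimately have "laplacian (raise v n Y) x = 0" for x
      unfolding eq by (simp add: laplacian_add[OF 1 hpoly_cmult[OF 2]] laplacian_cmult[OF 2])
    moreover have "hpoly (Suc n) (raise v n Y)"
      unfolding eq by (intro hpoly.add 1 hpoly_cmult 2)
    ultimately show ?thesis by (simp add: spherical_harmonics_iff)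
  qed
qed

lemma mult_linear_on_sphere:
  fixes Y :: "real ^ 'n \<Rightarrow> real"
  assumes "x \<in> sphere 0 1"
  shows "(x \<bullet> v) * Y x = raise v n Y x + pd v Y x / (2 * real n + real CARD('n) - 2)"
  using assms by (simp add: raise_def dot_square_norm)

subsection \<open>Orthogonality\<close>

text \<open>
  The divergence identity applied to the partial derivatives gives
  \<open>\<integral> \<Delta>Y = n (n + d - 2) \<integral> Y\<close>.
\<close>

lemma sint_harmonic_zero:
  fixes Y :: "real ^ 'n \<Rightarrow> real"
  assumes d: "CARD('n) \<ge> 2" and Y: "Y \<in> spherical_harmonics n" and n: "n \<ge> 1"
  shows "sint Y = 0"
proof -
  have hY: "hpoly n Y" by (rule harmonic_hpoly[OF Y])
  have int: "integrable sphere_measure (\<lambda>x. x $ i * pd (axis i 1) Y x)" for i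
    using integrable_hpoly[OF hpoly.var[OF pd_hpoly(1)[OF hY]]] .
  have "0 = sint (laplacian Y)"
    by (simp add: harmonic_laplacian[OF Y])
  also have "\<dots> = (\<Sum>i\<in>UNIV. sint (pd (axis i 1) (pd (axis i 1) Y)))"
    unfolding laplacian_eq_sum_pd[abs_def]
    by (intro Bochner_Integration.integral_sum integrable_hpoly[OF pd_hpoly(1)[OF pd_hpoly(1)[OF hY]]])
  also have "\<dots> = real (n - 1 + CARD('n) - 1) * (\<Sum>i\<in>UNIV. sint (\<lambda>x. x $ i * pd (axis i 1) Y x))"
    by (simp only: sint_coord[OF pd_hpoly(1)[OF hY]] sum_distrib_left)
  also have "(\<Sum>i\<in>UNIV. sint (\<lambda>x. x $ i * pd (axis i 1) Y x)) = sint (\<lambda>x. \<Sum>i\<in>UNIV. x $ i * pd (axis i 1) Y x)"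
    by (intro Bochner_Integration.integral_sum[symmetric] int)
  also have "\<dots> = real n * sint Y"
    by (simp add: euler_sum[OF hY])
  finally show ?thesis using n d by auto
qed

text \<open>
  Induction on the polynomial: a factor \<open>x\<^sub>i\<close> of \<open>Q\<close> is moved to \<open>Y\<close>, which turns \<open>Y\<close> into harmonics of
  degrees \<open>n + 1\<close> and \<open>n - 1\<close>, both still larger than the degree of the remaining polynomial.
\<close>

lemma sint_hpoly_harmonic:
  fixes Y :: "real ^ 'n \<Rightarrow> real"
  assumes d: "CARD('n) \<ge> 2" and Q: "hpoly m Q"
  shows "Y \<in> spherical_harmonics n \<Longrightarrow> m < n \<Longrightarrow> sint (\<lambda>x. Q x * Y x) = 0"
  using Q
proof (induction arbitrary: n Y rule: hpoly.induct)
  case (const c)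
  then show ?case using sint_harmonic_zero[OF d, of Y n] by simp
next
  case (var m P i)
  note hY = harmonic_hpoly[OF var.prems(1)]
  let ?a = "2 * real n + real CARD('n) - 2"
  note R = raise_harmonic[OF var.prems(1), of "axis i 1"] and D = pd_harmonic[OF var.prems(1), of "axis i 1"]
  have "sint (\<lambda>x. x $ i * P x * Y x) = sint (\<lambda>x. P x * raise (axis i 1) n Y x + P x * pd (axis i 1) Y x / ?a)"
  proof (rule sint_cong)
    fix x :: "real ^ 'n" assume "x \<in> sphere 0 1"
    from mult_linear_on_sphere[OF this, of "axis i 1" Y n]
    have "x $ i * Y x = raise (axis i 1) n Y x + pd (axis i 1) Y x / ?a"
      by (simp add: inner_axis)
    then have "P x * (x $ i * Y x) = P x * raise (axis i 1) n Y x + P x * pd (axis i 1) Y x / ?a"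
      by (simp add: distrib_left)
    then show "x $ i * P x * Y x = P x * raise (axis i 1) n Y x + P x * pd (axis i 1) Y x / ?a"
      by (simp only: mult_ac)
  qed
  also have "\<dots> = sint (\<lambda>x. P x * raise (axis i 1) n Y x) + sint (\<lambda>x. P x * pd (axis i 1) Y x / ?a)"
    by (intro Bochner_Integration.integral_add integrable_divide integrable_hpoly[OF hpoly_mult[OF var.hyps harmonic_hpoly[OF R]]]
       integrable_hpoly[OF hpoly_mult[OF var.hyps harmonic_hpoly[OF D]]])
  also have "\<dots> = 0"
    using var.IH[OF R] var.IH[OF D] var.prems(2) by simp
  finally show ?case .
next
  case (add m P Q)
  note hY = harmonic_hpoly[OF add.prems(1)]
  have "sint (\<lambda>x. (P x + Q x) * Y x) = sint (\<lambda>x. P x * Y x) + sint (\<lambda>x. Q x * Y x)"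
    unfolding distrib_right
    by (intro Bochner_Integration.integral_add integrable_hpoly[OF hpoly_mult[OF add.hyps(1) hY]]
      integrable_hpoly[OF hpoly_mult[OF add.hyps(2) hY]])
  then show ?case using add by simp
qed

lemma sint_harmonics_orthogonal:
  fixes Y :: "real ^ 'n \<Rightarrow> real"
  assumes d: "CARD('n) \<ge> 2" and "Y \<in> spherical_harmonics n" "Z \<in> spherical_harmonics m" "n \<noteq> m"
  shows "sint (\<lambda>x. Y x * Z x) = 0"
proof (cases "n < m")
  case True
  then show ?thesis using sint_hpoly_harmonic[OF d harmonic_hpoly assms(3)] assms by blast
next
  case False
  then have "sint (\<lambda>x. Z x * Y x) = 0"
    using sint_hpoly_harmonic[OF d harmonic_hpoly assms(2)] assms by force
  then show ?thesis by (simp add: mult.commute)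
qed

lemma sint_linear_harmonics:
  fixes Y Z :: "real ^ 'n \<Rightarrow> real"
  assumes Y: "Y \<in> spherical_harmonics n" and Z: "Z \<in> spherical_harmonics m"
  shows "sint (\<lambda>x. (x \<bullet> v) * (Y x * Z x)) = sint (\<lambda>x. Y x * raise v m Z x)
     + sint (\<lambda>x. Y x * pd v Z x) / (2 * real m + real CARD('n) - 2)"
proof -
  note hY = harmonic_hpoly[OF Y]
  let ?a = "2 * real m + real CARD('n) - 2"
  have "sint (\<lambda>x. (x \<bullet> v) * (Y x * Z x)) = sint (\<lambda>x. Y x * raise v m Z x + Y x * pd v Z x / ?a)"
  proof (rule sint_cong)
    fix x :: "real ^ 'n" assume "x \<in> sphere 0 1"
    from mult_linear_on_sphere[OF this, of v Z m]
    have "Y x * ((x \<bullet> v) * Z x) = Y x * raise v m Z x + Y x * pd v Z x / ?a"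
      by (simp add: distrib_left)
    then show "(x \<bullet> v) * (Y x * Z x) = Y x * raise v m Z x + Y x * pd v Z x / ?a"
      by (simp only: mult_ac)
  qed
  also have "\<dots> = sint (\<lambda>x. Y x * raise v m Z x) + sint (\<lambda>x. Y x * pd v Z x / ?a)"
    by (intro Bochner_Integration.integral_add integrable_divide integrable_hpoly[OF hpoly_mult[OF hY harmonic_hpoly[OF raise_harmonic[OF Z]]]]
       integrable_hpoly[OF hpoly_mult[OF hY harmonic_hpoly[OF pd_harmonic[OF Z]]]])
  finally show ?thesis by simp
qed

lemma sint_linear_harmonics_Suc:
  fixes Y Z :: "real ^ 'n \<Rightarrow> real"
  assumes d: "CARD('n) \<ge> 2" and Y: "Y \<in> spherical_harmonics n" and Z: "Z \<in> spherical_harmonics (Suc n)"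
  shows "sint (\<lambda>x. (x \<bullet> v) * (Y x * Z x)) = sint (\<lambda>x. Y x * pd v Z x) / (2 * real n + real CARD('n))"
  using sint_linear_harmonics[OF Y Z, of v]
    sint_harmonics_orthogonal[OF d Y raise_harmonic[OF Z]] by simp

lemma sint_linear_harmonics_zero:
  fixes Y Z :: "real ^ 'n \<Rightarrow> real"
  assumes d: "CARD('n) \<ge> 2" and Y: "Y \<in> spherical_harmonics n" and Z: "Z \<in> spherical_harmonics m"
    and ne: "n \<noteq> Suc m" "m \<noteq> Suc n"
  shows "sint (\<lambda>x. (x \<bullet> v) * (Y x * Z x)) = 0"
proof (cases "m = 0")
  case True
  then show ?thesis
    using sint_linear_harmonics[OF Y Z, of v] pd_hpoly(2)[OF harmonic_hpoly[OF Z]]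
    sint_harmonics_orthogonal[OF d Y raise_harmonic[OF Z] ne(1)] by simp
next
  case False
  with ne have "n \<noteq> m - 1" by auto
  then show ?thesis
    using sint_linear_harmonics[OF Y Z, of v] sint_harmonics_orthogonal[OF d Y pd_harmonic[OF Z]]
    sint_harmonics_orthogonal[OF d Y raise_harmonic[OF Z] ne(1)] by simp
qed

subsection \<open>The sharp bound for a directional derivative\<close>

text \<open>
  The heart of the matter. Let \<open>t = \<langle>x, e\<rangle>\<close> and \<open>D = \<partial>\<^sub>e Y\<close>. Four instances of the divergence identity
  express the integrals of \<open>t Y D\<close>, \<open>t\<^sup>2 Y\<^sup>2\<close>, \<open>|\<nabla>Y|\<^sup>2\<close> and \<open>t\<^sup>2 |\<nabla>Y|\<^sup>2\<close> by those of \<open>Y\<^sup>2\<close> and \<open>D\<^sup>2\<close>. The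
  remaining information is that the part of the angular gradient that comes from rotations fixing \<open>e\<close>
  has nonnegative square,
  \<open>(|\<nabla>Y|\<^sup>2 - D\<^sup>2) (1 - t\<^sup>2) - (n Y - t D)\<^sup>2 \<ge> 0\<close>, which is the Cauchy--Schwarz inequality. Integrating it
  gives the bound, with equality when \<open>Y\<close> is invariant under these rotations, in particular for zonal
  \<open>Y\<close>.
\<close>

lemma sint_pd_harmonic_bound:
  fixes Y :: "real ^ 'n \<Rightarrow> real"
  assumes d: "CARD('n) \<ge> 2" and Y: "Y \<in> spherical_harmonics n" and n: "n \<ge> 1" and e: "norm e = 1"
  shows "(2 * real n + real CARD('n) - 4) * sint (\<lambda>x. (pd e Y x)\<^sup>2)
    \<le> (2 * real n + real CARD('n) - 2) * (real n * (real n + real CARD('n) - 3)) * sint (\<lambda>x. (Y x)\<^sup>2)"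
proof -
  let ?d = "real CARD('n)"
  let ?t = "\<lambda>x :: real ^ 'n. x \<bullet> e"
  let ?D = "pd e Y" and ?P = "\<lambda>i. pd (axis i 1) Y"
  define a where "a = 2 * real n + ?d - 2"
  define N where "N = sint (\<lambda>x. (Y x)\<^sup>2)"
  define E where "E = sint (\<lambda>x. (?D x)\<^sup>2)"
  define X where "X = sint (\<lambda>x. ?t x * (Y x * ?D x))"
  define T where "T = sint (\<lambda>x. (?t x)\<^sup>2 * (Y x)\<^sup>2)"
  define G where "G = sint (\<lambda>x. \<Sum>i\<in>UNIV. (?P i x)\<^sup>2)"
  define H where "H = sint (\<lambda>x. (?t x)\<^sup>2 * (\<Sum>i\<in>UNIV. (?P i x)\<^sup>2))"
  note hY = harmonic_hpoly[OF Y]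
  note hP = pd_hpoly(1)[OF hY]
  note dY = hpoly_differentiable[OF hY] and dP = hpoly_differentiable[OF hP] and
    dt = hpoly_differentiable[OF hpoly_inner]
  have cY: "continuous_on S Y" and cP: "continuous_on S (pd v Y)" and cPP: "continuous_on S (pd w (pd v Y))" for S v w
    using hpoly_continuous_on[OF hY] hpoly_continuous_on[OF hP] hpoly_continuous_on[OF pd_hpoly(1)[OF hP]] by auto
  note int = integrable_continuous_sphere continuous_intros cY cP cPP
  have a1: "a > 0" using n d by (simp add: a_def)
  have deg: "real (n + (n - 1) + CARD('n) - 1) = a"
    using n d by (simp add: a_def of_nat_diff)
  have deg2: "real (1 + (n + n) + CARD('n) - 1) = a + 2" "real (1 + 1 + (n + (n - 1)) + CARD('n) - 1) = a + 2"
    using n d by (simp_all add: a_def of_nat_diff)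
  have ortho: "sint (\<lambda>x. Y x * pd e ?D x) = 0"
    using sint_harmonics_orthogonal[OF d Y pd_harmonic[OF pd_harmonic[OF Y]]] n by simp
  \<comment> \<open>The divergence identity for \<open>Y D\<close>, \<open>t Y\<^sup>2\<close>, \<open>Y \<partial>\<^sub>i Y\<close> and \<open>t\<^sup>2 Y \<partial>\<^sub>i Y\<close>.\<close>
  have F1: "E = a * X"
  proof -
    have "sint (pd e (\<lambda>x. Y x * ?D x)) = E + sint (\<lambda>x. Y x * pd e ?D x)"
      unfolding E_def pd_mult[OF dY dP, abs_def] power2_eq_square
      by (intro Bochner_Integration.integral_add int)
    then show ?thesis
      using sint_pd[OF hpoly_mult[OF hY hP], of e e] unfolding deg by (simp add: ortho X_def)
  qed
  have F2: "N + 2 * X = (a + 2) * T"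
  proof -
    have "sint (pd e (\<lambda>x. ?t x * (Y x * Y x))) = sint (\<lambda>x. (Y x)\<^sup>2 + 2 * (?t x * (Y x * ?D x)))"
    proof (rule sint_cong)
      fix x :: "real ^ 'n"
      have "pd e (\<lambda>x. ?t x * (Y x * Y x)) x = (e \<bullet> e) * (Y x * Y x) + ?t x * (?D x * Y x + Y x * ?D x)"
        by (simp only: pd_mult[OF dt differentiable_mult[OF dY dY]] pd_mult[OF dY dY] pd_inner)
      then show "pd e (\<lambda>x. ?t x * (Y x * Y x)) x = (Y x)\<^sup>2 + 2 * (?t x * (Y x * ?D x))"
        using e by (simp add: dot_square_norm power2_eq_square)
    qed
    also have "\<dots> = N + sint (\<lambda>x. 2 * (?t x * (Y x * ?D x)))"
      unfolding N_def by (intro Bochner_Integration.integral_add int)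
    also have "\<dots> = N + 2 * X" by (simp add: X_def)
    finally show ?thesis
      using sint_pd[OF hpoly_mult[OF hpoly_inner hpoly_mult[OF hY hY]], of e e]
      unfolding deg2 T_def by (simp add: power2_eq_square mult_ac)
  qed
  have lap: "(\<Sum>i\<in>UNIV. pd (axis i 1) (?P i) x) = 0" for x
    using harmonic_laplacian[OF Y] laplacian_eq_sum_pd[of Y x] by simp
  have F3: "G = a * real n * N"
  proof -
    have "(\<Sum>i\<in>UNIV. sint (pd (axis i 1) (\<lambda>x. Y x * ?P i x)))
        = sint (\<lambda>x. \<Sum>i\<in>UNIV. (?P i x)\<^sup>2 + Y x * pd (axis i 1) (?P i) x)"
      unfolding pd_mult[OF dY dP, abs_def] power2_eq_square
      by (intro Bochner_Integration.integral_sum[symmetric] int)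
    also have "\<dots> = G"
      unfolding G_def sum.distrib by (simp add: sum_distrib_left[symmetric] lap)
    finally have "G = (\<Sum>i\<in>UNIV. a * sint (\<lambda>x. x $ i * (Y x * ?P i x)))"
      using sint_coord[OF hpoly_mult[OF hY hP]] unfolding deg by simp
    also have "\<dots> = a * sint (\<lambda>x. \<Sum>i\<in>UNIV. x $ i * (Y x * ?P i x))"
      unfolding sum_distrib_left[symmetric]
      by (intro arg_cong2[of _ _ _ _ "(*)"] refl Bochner_Integration.integral_sum[symmetric] int)
    also have "(\<lambda>x. \<Sum>i\<in>UNIV. x $ i * (Y x * ?P i x)) = (\<lambda>x. real n * (Y x)\<^sup>2)"
    proof
      fix x show "(\<Sum>i\<in>UNIV. x $ i * (Y x * ?P i x)) = real n * (Y x)\<^sup>2"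
        using euler_sum[OF hY, of x]
        by (simp add: mult.left_commute[of _ "Y x"] sum_distrib_left[symmetric] power2_eq_square)
    qed
    finally show ?thesis by (simp add: N_def)
  qed
  have F4: "2 * X + H = (a + 2) * (real n * T)"
  proof -
    have htt: "hpoly (1 + 1) (\<lambda>x. ?t x * ?t x)" by (rule hpoly_mult[OF hpoly_inner hpoly_inner])
    note dtt = hpoly_differentiable[OF htt]
    have *: "pd (axis i 1) (\<lambda>x. (?t x * ?t x) * (Y x * ?P i x)) = (\<lambda>x. 2 * ?t x * Y x * (e $ i * ?P i x)
         + (?t x)\<^sup>2 * (?P i x)\<^sup>2 + (?t x)\<^sup>2 * Y x * pd (axis i 1) (?P i) x)" for i
    proof (rule ext)
      fix x
      have "pd (axis i 1) (\<lambda>x. (?t x * ?t x) * (Y x * ?P i x)) x =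
          ((axis i 1 \<bullet> e) * ?t x + ?t x * (axis i 1 \<bullet> e)) * (Y x * ?P i x)
          + (?t x * ?t x) * (?P i x * ?P i x + Y x * pd (axis i 1) (?P i) x)"
        by (simp only: pd_mult[OF dtt differentiable_mult[OF dY dP]] pd_mult[OF dY dP] pd_mult[OF dt dt] pd_inner)
      then show "pd (axis i 1) (\<lambda>x. (?t x * ?t x) * (Y x * ?P i x)) x = 2 * ?t x * Y x * (e $ i * ?P i x)
         + (?t x)\<^sup>2 * (?P i x)\<^sup>2 + (?t x)\<^sup>2 * Y x * pd (axis i 1) (?P i) x"
        by (simp add: inner_axis' power2_eq_square algebra_simps)
    qed
    have "(\<Sum>i\<in>UNIV. sint (pd (axis i 1) (\<lambda>x. (?t x * ?t x) * (Y x * ?P i x))))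
       = sint (\<lambda>x. \<Sum>i\<in>UNIV. 2 * ?t x * Y x * (e $ i * ?P i x)
         + (?t x)\<^sup>2 * (?P i x)\<^sup>2 + (?t x)\<^sup>2 * Y x * pd (axis i 1) (?P i) x)"
      unfolding * by (intro Bochner_Integration.integral_sum[symmetric] int)
    also have "\<dots> = sint (\<lambda>x. 2 * (?t x * (Y x * ?D x)) + (?t x)\<^sup>2 * (\<Sum>i\<in>UNIV. (?P i x)\<^sup>2))"
    proof (rule sint_cong)
      fix x :: "real ^ 'n"
      show "(\<Sum>i\<in>UNIV. 2 * ?t x * Y x * (e $ i * ?P i x)
         + (?t x)\<^sup>2 * (?P i x)\<^sup>2 + (?t x)\<^sup>2 * Y x * pd (axis i 1) (?P i) x) =
         2 * (?t x * (Y x * ?D x)) + (?t x)\<^sup>2 * (\<Sum>i\<in>UNIV. (?P i x)\<^sup>2)"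
        unfolding sum.distrib sum_distrib_left[symmetric] lap
        using pd_direction[OF dY, of e x] by simp
    qed
    also have "\<dots> = sint (\<lambda>x. 2 * (?t x * (Y x * ?D x))) + H"
      unfolding H_def by (intro Bochner_Integration.integral_add int)
    also have "\<dots> = 2 * X + H" by (simp add: X_def)
    finally have "2 * X + H = (\<Sum>i\<in>UNIV. (a + 2) * sint (\<lambda>x. x $ i * ((?t x * ?t x) * (Y x * ?P i x))))"
      using sint_coord[OF hpoly_mult[OF htt hpoly_mult[OF hY hP]]] unfolding deg2 by simp
    also have "\<dots> = (a + 2) * sint (\<lambda>x. \<Sum>i\<in>UNIV. x $ i * ((?t x * ?t x) * (Y x * ?P i x)))"
      unfolding sum_distrib_left[symmetric]
      by (intro arg_cong2[of _ _ _ _ "(*)"] refl Bochner_Integration.integral_sum[symmetric] int)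
    also have "(\<lambda>x. \<Sum>i\<in>UNIV. x $ i * ((?t x * ?t x) * (Y x * ?P i x))) = (\<lambda>x. real n * ((?t x)\<^sup>2 * (Y x)\<^sup>2))"
    proof
      fix x
      have "(\<Sum>i\<in>UNIV. x $ i * ((?t x * ?t x) * (Y x * ?P i x)))
          = (\<Sum>i\<in>UNIV. (?t x)\<^sup>2 * Y x * (x $ i * ?P i x))"
        by (intro sum.cong) (auto simp: power2_eq_square)
      then show "(\<Sum>i\<in>UNIV. x $ i * ((?t x * ?t x) * (Y x * ?P i x))) = real n * ((?t x)\<^sup>2 * (Y x)\<^sup>2)"
        unfolding sum_distrib_left[symmetric] euler_sum[OF hY] by (simp add: power2_eq_square)
    qed
    finally show ?thesis by (simp add: T_def)
  qed
  \<comment> \<open>Cauchy--Schwarz for the components of the gradient and of the position orthogonal to \<open>e\<close>.\<close>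
  have F5: "0 \<le> G - H - E - (real n)\<^sup>2 * N + 2 * real n * X"
  proof -
    have "0 \<le> sint (\<lambda>x. (\<Sum>i\<in>UNIV. (?P i x)\<^sup>2) - (?t x)\<^sup>2 * (\<Sum>i\<in>UNIV. (?P i x)\<^sup>2) - (?D x)\<^sup>2
        - (real n)\<^sup>2 * (Y x)\<^sup>2 + 2 * real n * (?t x * (Y x * ?D x)))"
    proof (intro integral_nonneg_AE AE_I2)
      fix x :: "real ^ 'n" assume "x \<in> space sphere_measure"
      then have x: "x \<bullet> x = 1" by (simp add: dot_square_norm)
      have ee: "e \<bullet> e = 1" using e by (simp add: dot_square_norm)
      define g :: "real ^ 'n" where "g = (\<chi> i. ?P i x)"
      have gg: "(\<Sum>i\<in>UNIV. (?P i x)\<^sup>2) = g \<bullet> g"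
        by (simp add: g_def inner_vec_def power2_eq_square)
      have ge: "?D x = g \<bullet> e"
        using pd_direction[OF dY, of e x] by (simp add: g_def inner_vec_def mult.commute)
      have xg: "g \<bullet> x = real n * Y x"
        using euler_sum[OF hY, of x] by (simp add: g_def inner_vec_def mult.commute)
      have "((g - (g \<bullet> e) *\<^sub>R e) \<bullet> (x - (x \<bullet> e) *\<^sub>R e))\<^sup>2
        \<le> ((g - (g \<bullet> e) *\<^sub>R e) \<bullet> (g - (g \<bullet> e) *\<^sub>R e)) * ((x - (x \<bullet> e) *\<^sub>R e) \<bullet> (x - (x \<bullet> e) *\<^sub>R e))"
        by (rule Cauchy_Schwarz_ineq)
      also have "(g - (g \<bullet> e) *\<^sub>R e) \<bullet> (x - (x \<bullet> e) *\<^sub>R e) = g \<bullet> x - (g \<bullet> e) * (x \<bullet> e)"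
        by (simp add: inner_diff_left inner_diff_right ee inner_commute algebra_simps)
      also have "(g - (g \<bullet> e) *\<^sub>R e) \<bullet> (g - (g \<bullet> e) *\<^sub>R e) = g \<bullet> g - (g \<bullet> e) * (g \<bullet> e)"
        by (simp add: inner_diff_left inner_diff_right ee inner_commute algebra_simps)
      also have "(x - (x \<bullet> e) *\<^sub>R e) \<bullet> (x - (x \<bullet> e) *\<^sub>R e) = 1 - (x \<bullet> e) * (x \<bullet> e)"
        by (simp add: inner_diff_left inner_diff_right ee x inner_commute algebra_simps)
      finally have CS: "(real n * Y x - (g \<bullet> e) * (x \<bullet> e))\<^sup>2
          \<le> (g \<bullet> g - (g \<bullet> e) * (g \<bullet> e)) * (1 - (x \<bullet> e) * (x \<bullet> e))"
        unfolding xg .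
      have expand: "A - u\<^sup>2 * A - B\<^sup>2 - m\<^sup>2 * y\<^sup>2 + 2 * m * (u * (y * B)) = (A - B * B) * (1 - u * u) - (m * y - B * u)\<^sup>2"
        for A B u m y :: real
        by (simp add: power2_eq_square algebra_simps)
      show "0 \<le> (\<Sum>i\<in>UNIV. (?P i x)\<^sup>2) - (?t x)\<^sup>2 * (\<Sum>i\<in>UNIV. (?P i x)\<^sup>2) - (?D x)\<^sup>2
        - (real n)\<^sup>2 * (Y x)\<^sup>2 + 2 * real n * (?t x * (Y x * ?D x))"
        unfolding gg ge expand using CS by (simp only: diff_ge_0_iff_ge)
    qed
    also have "\<dots> = sint (\<lambda>x. (\<Sum>i\<in>UNIV. (?P i x)\<^sup>2) - (?t x)\<^sup>2 * (\<Sum>i\<in>UNIV. (?P i x)\<^sup>2) - (?D x)\<^sup>2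
        - (real n)\<^sup>2 * (Y x)\<^sup>2) + sint (\<lambda>x. 2 * real n * (?t x * (Y x * ?D x)))"
      by (intro Bochner_Integration.integral_add int)
    also have "sint (\<lambda>x. (\<Sum>i\<in>UNIV. (?P i x)\<^sup>2) - (?t x)\<^sup>2 * (\<Sum>i\<in>UNIV. (?P i x)\<^sup>2) - (?D x)\<^sup>2
        - (real n)\<^sup>2 * (Y x)\<^sup>2) = sint (\<lambda>x. (\<Sum>i\<in>UNIV. (?P i x)\<^sup>2) - (?t x)\<^sup>2 * (\<Sum>i\<in>UNIV. (?P i x)\<^sup>2) - (?D x)\<^sup>2)
        - sint (\<lambda>x. (real n)\<^sup>2 * (Y x)\<^sup>2)"
      by (intro Bochner_Integration.integral_diff int)
    also have "sint (\<lambda>x. (\<Sum>i\<in>UNIV. (?P i x)\<^sup>2) - (?t x)\<^sup>2 * (\<Sum>i\<in>UNIV. (?P i x)\<^sup>2) - (?D x)\<^sup>2)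
      = sint (\<lambda>x. (\<Sum>i\<in>UNIV. (?P i x)\<^sup>2) - (?t x)\<^sup>2 * (\<Sum>i\<in>UNIV. (?P i x)\<^sup>2)) - E"
      unfolding E_def by (intro Bochner_Integration.integral_diff int)
    also have "sint (\<lambda>x. (\<Sum>i\<in>UNIV. (?P i x)\<^sup>2) - (?t x)\<^sup>2 * (\<Sum>i\<in>UNIV. (?P i x)\<^sup>2)) = G - H"
      unfolding G_def H_def by (intro Bochner_Integration.integral_diff int)
    finally show ?thesis by (simp add: N_def X_def)
  qed
  have "H = real n * N + 2 * real n * X - 2 * X"
  proof -
    have "2 * X + H = real n * ((a + 2) * T)" using F4 by simp
    then show ?thesis unfolding F2[symmetric] by (simp add: algebra_simps)
  qed
  with F5 F3 F1 have "(a - 2) * X \<le> real n * (a - 1 - real n) * N"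
    by (simp add: algebra_simps power2_eq_square)
  then have "a * ((a - 2) * X) \<le> a * (real n * (a - 1 - real n) * N)"
    using a1 by (intro mult_left_mono) auto
  then have "(a - 2) * E \<le> a * (real n * (a - 1 - real n)) * N"
    unfolding F1 by (simp add: mult_ac)
  then show ?thesis
    unfolding N_def E_def a_def by (simp add: algebra_simps)
qed

subsection \<open>Polynomials on the sphere are sums of harmonics\<close>

text \<open>
  Finite sums of harmonics of arbitrary degrees, up to equality on the sphere. They are closed under
  multiplication by linear forms, hence contain all polynomials; no decomposition of homogeneous
  polynomials into powers of \<open>|x|\<^sup>2\<close> times harmonics has to be constructed.
\<close>

inductive harmonic_sum :: "(real ^ 'n \<Rightarrow> real) \<Rightarrow> bool" where
  base: "Y \<in> spherical_harmonics n \<Longrightarrow> harmonic_sum Y" for n |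
  add: "harmonic_sum f \<Longrightarrow> harmonic_sum g \<Longrightarrow> harmonic_sum (\<lambda>x. f x + g x)" |
  cong: "harmonic_sum f \<Longrightarrow> (\<And>x. x \<in> sphere 0 1 \<Longrightarrow> g x = f x) \<Longrightarrow> harmonic_sum g"

lemma harmonic_sum_cmult: "harmonic_sum f \<Longrightarrow> harmonic_sum (\<lambda>x. c * f x)"
proof (induction rule: harmonic_sum.induct)
  case (add f g)
  from harmonic_sum.add[OF add.IH] show ?case by (simp add: distrib_left)
next
  case (cong f g)
  show ?case by (rule harmonic_sum.cong[OF cong.IH]) (use cong in auto)
qed (blast intro: harmonic_sum.base harmonic_cmult)

lemma harmonic_sum_linear: "harmonic_sum f \<Longrightarrow> harmonic_sum (\<lambda>x. (x \<bullet> v) * f x)"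
proof (induction rule: harmonic_sum.induct)
  case (base n Y)
  have "harmonic_sum (\<lambda>x. raise v n Y x + inverse (2 * real n + real CARD('a) - 2) * pd v Y x)"
    by (intro harmonic_sum.add harmonic_sum_cmult)
       (blast intro: harmonic_sum.base raise_harmonic pd_harmonic base)+
  then show ?case
  proof (rule harmonic_sum.cong)
    fix x :: "real ^ 'a" assume "x \<in> sphere 0 1"
    from mult_linear_on_sphere[OF this, of v Y n]
    show "(x \<bullet> v) * Y x = raise v n Y x + inverse (2 * real n + real CARD('a) - 2) * pd v Y x"
      by (simp add: divide_inverse mult.commute[of _ "inverse (2 * real n + real CARD('a) - 2)"])
  qed
next
  case (add f g)
  from harmonic_sum.add[OF add.IH] show ?case by (simp add: distrib_left)
next
  case (cong f g)
  show ?case by (rule harmonic_sum.cong[OF cong.IH]) (use cong in auto)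
qed

lemma harmonic_sum_mult_polynomial:
  "real_polynomial_function p \<Longrightarrow> harmonic_sum f \<Longrightarrow> harmonic_sum (\<lambda>x. p x * f x)"
proof (induction arbitrary: f rule: real_polynomial_function.induct)
  case (linear p)
  define v :: "real ^ 'a" where "v = (\<chi> i. p (axis i 1))"
  interpret bounded_linear p by fact
  have "p x = x \<bullet> v" for x
  proof -
    have "p x = p (\<Sum>i\<in>UNIV. x $ i *\<^sub>R axis i 1)"
      using basis_expansion[of x] by (simp add: scalar_mult_eq_scaleR)
    then show ?thesis by (simp add: sum scale inner_vec_def v_def)
  qed
  then show ?case using harmonic_sum_linear[OF linear.prems, of v] by simp
next
  case (add p q)
  from harmonic_sum.add[OF add.IH(1)[OF add.prems] add.IH(2)[OF add.prems]]
  show ?case by (simp add: distrib_right)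
next
  case (mult p q)
  from mult.IH(1)[OF mult.IH(2)[OF mult.prems]] show ?case by (simp add: mult.assoc)
qed (rule harmonic_sum_cmult)

lemma harmonic_sum_polynomial:
  assumes "real_polynomial_function p"
  shows "harmonic_sum p"
  using harmonic_sum_mult_polynomial[OF assms harmonic_sum.base[OF harmonic_const[of 1]]] by simp

lemma harmonic_sum_expansion:
  assumes "harmonic_sum f"
  shows "\<exists>N Y. (\<forall>n. Y n \<in> spherical_harmonics n) \<and> (\<forall>x \<in> sphere 0 1. f x = (\<Sum>n\<le>N. Y n x))"
proof -
  have "\<exists>N Y. (\<forall>n. Y n \<in> spherical_harmonics n) \<and> (\<forall>n>N. Y n = (\<lambda>x. 0))
      \<and> (\<forall>x \<in> sphere 0 1. f x = (\<Sum>n\<le>N. Y n x))"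
    using assms
  proof (induction rule: harmonic_sum.induct)
    case (base n Y)
    then have "(\<lambda>x. if m = n then Y x else 0) \<in> spherical_harmonics m" for m
      by (cases "m = n") (simp_all add: harmonic_zero)
    then show ?case
      by (intro exI[of _ n] exI[of _ "\<lambda>m x. if m = n then Y x else 0"] conjI allI impI ballI) simp_all
  next
    case (add f g)
    from add.IH(1) obtain N Y where Y: "\<And>n. Y n \<in> spherical_harmonics n" "\<And>n. n > N \<Longrightarrow> Y n = (\<lambda>x. 0)"
        "\<And>x. x \<in> sphere 0 1 \<Longrightarrow> f x = (\<Sum>n\<le>N. Y n x)"
      by blast
    from add.IH(2) obtain M Z where Z: "\<And>n. Z n \<in> spherical_harmonics n" "\<And>n. n > M \<Longrightarrow> Z n = (\<lambda>x. 0)"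
        "\<And>x. x \<in> sphere 0 1 \<Longrightarrow> g x = (\<Sum>n\<le>M. Z n x)"
      by blast
    have "f x + g x = (\<Sum>n\<le>max N M. Y n x + Z n x)" if "x \<in> sphere 0 1" for x
    proof -
      have "(\<Sum>n\<le>max N M. Y n x) = (\<Sum>n\<le>N. Y n x)" "(\<Sum>n\<le>max N M. Z n x) = (\<Sum>n\<le>M. Z n x)"
        by (intro sum.mono_neutral_right; auto simp: Y(2) Z(2))+
      then show ?thesis using Y(3) Z(3) that by (simp add: sum.distrib)
    qed
    then show ?case
      using Y(2) Z(2) by (intro exI[of _ "max N M"] exI[of _ "\<lambda>n x. Y n x + Z n x"] conjI allI impI ballI
        harmonic_add[OF Y(1) Z(1)]) simp_all
  next
    case (cong f g)
    from cong.IH obtain N Y where "\<forall>n. Y n \<in> spherical_harmonics n" "\<forall>n>N. Y n = (\<lambda>x. 0)"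
        "\<forall>x\<in>sphere 0 1. f x = (\<Sum>n\<le>N. Y n x)"
      by blast
    then show ?case
      using cong.hyps(2) by (intro exI[of _ N] exI[of _ Y]) simp
  qed
  then show ?thesis by blast
qed

subsection \<open>Zonal harmonics\<close>

text \<open>
  Zonal harmonics with pole \<open>e\<close>, up to normalization the Gegenbauer polynomials of \<open>\<langle>x, e\<rangle>\<close>. With
  this construction their norms and the three-term recurrence are governed by the single coefficient
  in \<open>pd_zonal_Suc\<close>.
\<close>

primrec zonal :: "real ^ 'n \<Rightarrow> nat \<Rightarrow> real ^ 'n \<Rightarrow> real" where
  "zonal e 0 = (\<lambda>x. 1)"
| "zonal e (Suc n) = raise e n (zonal e n)"

lemma zonal_harmonic: "zonal e n \<in> spherical_harmonics n"
  by (induction n) (auto intro: harmonic_const raise_harmonic)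

lemma pd_raise:
  fixes Y :: "real ^ 'n \<Rightarrow> real"
  assumes Y: "Y \<in> spherical_harmonics n" and e: "norm e = 1"
  shows "pd e (raise e n Y) x = Y x + (x \<bullet> e) * pd e Y x
    - (2 * (x \<bullet> e) * pd e Y x + (x \<bullet> x) * pd e (pd e Y) x) / (2 * real n + real CARD('n) - 2)"
proof -
  let ?c = "inverse (2 * real n + real CARD('n) - 2)"
  have "raise e n Y = (\<lambda>x. (x \<bullet> e) * Y x - ?c * ((x \<bullet> x) * pd e Y x))"
    by (simp add: fun_eq_iff raise_def divide_inverse)
  moreover note [simp] = hpoly_differentiable[OF hpoly_inner] hpoly_differentiable[OF hpoly_normsq]
    harmonic_differentiable[OF Y] harmonic_differentiable[OF pd_harmonic[OF Y]]
  have "e \<bullet> e = 1" using e by (simp add: dot_square_norm)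
  ultimately show ?thesis
    by (simp add: pd_diff pd_mult pd_cmult differentiable_mult divide_inverse mult.commute)
qed

text \<open>
  The derivative along the pole lowers the degree by one. If \<open>\<delta>\<^sub>n\<close> is the coefficient for degree \<open>n\<close>
  and \<open>a = 2 n + d - 2\<close>, then the definition of the zonal harmonics gives \<open>\<delta>\<^bsub>n+1\<^esub> = 1 + \<delta>\<^sub>n (a - 2) / a\<close>.
  The case distinction concerns only \<open>n = 0\<close> in the plane, where the general formula reads \<open>0 / 0\<close>.
\<close>

lemma pd_zonal_Suc:
  fixes e :: "real ^ 'n"
  assumes d: "CARD('n) \<ge> 2" and e: "norm e = 1"
  shows "pd e (zonal e (Suc n)) = (\<lambda>x. (if n = 0 then 1 else
     (real n + 1) * (real n + real CARD('n) - 2) / (2 * real n + real CARD('n) - 2)) * zonal e n x)"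
proof (induction n)
  case 0
  show ?case
    using pd_raise[OF harmonic_const[of 1] e] by (simp add: fun_eq_iff pd_const[abs_def])
next
  case (Suc n)
  let ?d = "real CARD('n)"
  define \<delta> where "\<delta> = (if n = 0 then 1 else (real n + 1) * (real n + ?d - 2) / (2 * real n + ?d - 2))"
  define a where "a = 2 * real (Suc n) + ?d - 2"
  have a: "a \<noteq> 0" "a - 2 = 2 * real n + ?d - 2" using d by (simp_all add: a_def)
  have IH: "pd e (zonal e (Suc n)) = (\<lambda>x. \<delta> * zonal e n x)"
    using Suc.IH by (simp add: \<delta>_def)
  have IH2: "pd e (pd e (zonal e (Suc n))) x = \<delta> * pd e (zonal e n) x" for x
    unfolding IH by (simp add: pd_cmult harmonic_differentiable[OF zonal_harmonic])
  show ?case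
  proof (rule ext)
    fix x :: "real ^ 'n"
    let ?u = "(x \<bullet> e) * zonal e n x" and ?w = "(x \<bullet> x) * pd e (zonal e n) x"
    have z: "zonal e (Suc n) x = ?u - ?w / (a - 2)"
      by (simp add: raise_def a)
    have w: "a - 2 = 0 \<Longrightarrow> ?w = 0"
    proof -
      assume "a - 2 = 0"
      then have "n = 0" using a(2) d by linarith
      then show "?w = 0" by (simp add: pd_const[abs_def])
    qed
    have "pd e (zonal e (Suc (Suc n))) x = zonal e (Suc n) x + \<delta> * ((x \<bullet> e) * zonal e n x)
       - \<delta> * (2 * ?u + ?w) / a"
    proof -
      have "(2 * (x \<bullet> e) * (\<delta> * zonal e n x) + (x \<bullet> x) * (\<delta> * pd e (zonal e n) x)) / a = \<delta> * (2 * ?u + ?w) / a"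
        by (simp add: algebra_simps del: zonal.simps)
      moreover have "(x \<bullet> e) * (\<delta> * zonal e n x) = \<delta> * ((x \<bullet> e) * zonal e n x)"
        by (rule mult.left_commute)
      ultimately show ?thesis
        unfolding zonal.simps(2)[of e "Suc n"] pd_raise[OF zonal_harmonic[of e "Suc n"] e, of x] IH2
        unfolding IH a_def[symmetric] by (simp only:)
    qed
    also have "\<dots> = zonal e (Suc n) x + \<delta> * ((a - 2) / a * zonal e (Suc n) x)"
    proof -
      have "?u - (2 * ?u + ?w) / a = ((a - 2) * ?u - ?w) / a"
        using a(1) by (simp add: field_simps del: zonal.simps)
      also have "\<dots> = (a - 2) / a * (?u - ?w / (a - 2))"
      proof -
        have "(b * u - v) / a = b / a * (u - v / b)" if "b = 0 \<Longrightarrow> v = 0" for b u v :: real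
          using that a(1) by (cases "b = 0") (simp_all add: field_simps)
        then show ?thesis using w by blast
      qed
      finally have "?u - (2 * ?u + ?w) / a = (a - 2) / a * zonal e (Suc n) x"
        unfolding z .
      then have "\<delta> * (?u - (2 * ?u + ?w) / a) = \<delta> * ((a - 2) / a * zonal e (Suc n) x)"
        by (simp only:)
      then show ?thesis
        by (simp add: right_diff_distrib del: zonal.simps)
    qed
    also have "\<dots> = (1 + \<delta> * (a - 2) / a) * zonal e (Suc n) x"
      by (simp add: algebra_simps del: zonal.simps)
    also have "1 + \<delta> * (a - 2) / a = (real (Suc n) + 1) * (real (Suc n) + ?d - 2) / a"
    proof (cases "n = 0")
      case True
      then show ?thesis using a(1) by (simp add: \<delta>_def field_simps) (simp add: a_def)
    next
      case False
      then have "a - 2 \<noteq> 0" using a(2) d by simp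
      then have "\<delta> * (a - 2) = (real n + 1) * (real n + ?d - 2)"
        using False by (simp add: \<delta>_def a(2))
      moreover have "a + (real n + 1) * (real n + ?d - 2) = (real (Suc n) + 1) * (real (Suc n) + ?d - 2)"
        by (simp add: a_def algebra_simps)
      ultimately show ?thesis using a(1) by (simp add: field_simps)
    qed
    finally show "pd e (zonal e (Suc (Suc n))) x = (if Suc n = 0 then 1 else
     (real (Suc n) + 1) * (real (Suc n) + ?d - 2) / (2 * real (Suc n) + ?d - 2)) * zonal e (Suc n) x"
      by (simp add: a_def del: zonal.simps)
  qed
qed

lemma sint_zonal_Suc_square:
  fixes e :: "real ^ 'n"
  assumes d: "CARD('n) \<ge> 2"
  shows "sint (\<lambda>x. (zonal e (Suc n) x)\<^sup>2) = sint (\<lambda>x. (x \<bullet> e) * (zonal e n x * zonal e (Suc n) x))"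
proof -
  note Z = zonal_harmonic[of e n] and S = zonal_harmonic[of e "Suc n"]
  have "sint (\<lambda>x. (x \<bullet> e) * (zonal e (Suc n) x * zonal e n x)) = sint (\<lambda>x. zonal e (Suc n) x * zonal e (Suc n) x)"
    using sint_linear_harmonics[OF S Z, of e] sint_harmonics_orthogonal[OF d S pd_harmonic[OF Z]] by simp
  then show ?thesis
    by (simp add: power2_eq_square mult.commute del: zonal.simps)
qed

lemma sint_linear_zonal:
  fixes e :: "real ^ 'n"
  assumes d: "CARD('n) \<ge> 2" and e: "norm e = 1" and n: "n \<ge> 1"
  shows "sint (\<lambda>x. (x \<bullet> e) * (zonal e n x * zonal e (Suc n) x)) =
      (real n + 1) * (real n + real CARD('n) - 2) / ((2 * real n + real CARD('n) - 2) * (2 * real n + real CARD('n)))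
        * sint (\<lambda>x. (zonal e n x)\<^sup>2)"
  unfolding sint_linear_harmonics_Suc[OF d zonal_harmonic zonal_harmonic] pd_zonal_Suc[OF d e]
  using n by (simp add: mult.left_commute[of "zonal e n _"] power2_eq_square del: zonal.simps)

section \<open>Square-integrable functions\<close>

definition ip :: "(real ^ 'n \<Rightarrow> real) \<Rightarrow> (real ^ 'n \<Rightarrow> real) \<Rightarrow> real" where
  "ip f g = sint (\<lambda>x. f x * g x)"

lemma L2_real_iff:
  fixes f :: "real ^ 'n \<Rightarrow> real"
  shows "f \<in> L2 \<longleftrightarrow> f \<in> borel_measurable sphere_measure \<and> integrable sphere_measure (\<lambda>x. (f x)\<^sup>2)"
  by (simp add: L2_def)

lemma L2_measurable:
  fixes f :: "real ^ 'n \<Rightarrow> real"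
  shows "f \<in> L2 \<Longrightarrow> f \<in> borel_measurable sphere_measure"
  by (simp add: L2_def)

lemma L2_integrable_mult:
  fixes f g :: "real ^ 'n \<Rightarrow> real"
  assumes "f \<in> L2" "g \<in> L2"
  shows "integrable sphere_measure (\<lambda>x. f x * g x)"
proof (rule Bochner_Integration.integrable_bound)
  show "integrable sphere_measure (\<lambda>x. (f x)\<^sup>2 + (g x)\<^sup>2)"
    using assms by (simp add: L2_real_iff)
  show "(\<lambda>x. f x * g x) \<in> borel_measurable sphere_measure"
    using assms by (intro borel_measurable_times) (simp_all add: L2_real_iff)
  have "\<bar>a * b\<bar> \<le> a\<^sup>2 + b\<^sup>2" for a b :: real
  proof -
    have "2 * (\<bar>a\<bar> * \<bar>b\<bar>) \<le> a\<^sup>2 + b\<^sup>2" "0 \<le> \<bar>a\<bar> * \<bar>b\<bar>"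
      using sum_squares_bound[of "\<bar>a\<bar>" "\<bar>b\<bar>"] by (simp_all add: mult.assoc)
    then show ?thesis unfolding abs_mult by linarith
  qed
  then show "AE x in sphere_measure. norm (f x * g x) \<le> norm ((f x)\<^sup>2 + (g x)\<^sup>2)"
    by (intro AE_I2) (simp add: abs_mult)
qed

lemma L2_dominated:
  fixes f w :: "real ^ 'n \<Rightarrow> real"
  assumes "f \<in> borel_measurable sphere_measure" "w \<in> L2" "\<And>x. x \<in> sphere 0 1 \<Longrightarrow> \<bar>f x\<bar> \<le> c * \<bar>w x\<bar>"
  shows "f \<in> L2"
proof -
  have "integrable sphere_measure (\<lambda>x. (f x)\<^sup>2)"
  proof (rule Bochner_Integration.integrable_bound)
    show "integrable sphere_measure (\<lambda>x. c\<^sup>2 * (w x)\<^sup>2)"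
      using assms(2) by (simp add: L2_real_iff)
    show "(\<lambda>x. (f x)\<^sup>2) \<in> borel_measurable sphere_measure"
      using assms(1) by simp
    show "AE x in sphere_measure. norm ((f x)\<^sup>2) \<le> norm (c\<^sup>2 * (w x)\<^sup>2)"
      using power_mono[OF assms(3) abs_ge_zero, of _ 2]
      by (intro AE_I2) (simp add: power_mult_distrib abs_mult)
  qed
  with assms(1) show ?thesis by (simp add: L2_real_iff)
qed

lemma L2_continuous:
  fixes f :: "real ^ 'n \<Rightarrow> real"
  assumes "continuous_on (sphere 0 1) f"
  shows "f \<in> L2"
  using assms by (simp add: L2_real_iff continuous_borel_measurable_sphere integrable_continuous_sphere continuous_on_power)

lemma L2_harmonic:
  fixes Y :: "real ^ 'n \<Rightarrow> real"
  shows "Y \<in> spherical_harmonics n \<Longrightarrow> Y \<in> L2"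
  by (intro L2_continuous harmonic_continuous_on)

lemma L2_cmult:
  fixes f :: "real ^ 'n \<Rightarrow> real"
  assumes "f \<in> L2" shows "(\<lambda>x. c * f x) \<in> L2"
  using assms by (auto simp: L2_real_iff power_mult_distrib intro!: borel_measurable_times borel_measurable_const)

lemma L2_add:
  fixes f g :: "real ^ 'n \<Rightarrow> real"
  assumes "f \<in> L2" "g \<in> L2" shows "(\<lambda>x. f x + g x) \<in> L2"
  using assms L2_integrable_mult[OF assms] by (auto simp: L2_real_iff power2_sum mult.assoc intro!: borel_measurable_add)

lemma L2_diff:
  fixes f g :: "real ^ 'n \<Rightarrow> real"
  assumes "f \<in> L2" "g \<in> L2" shows "(\<lambda>x. f x - g x) \<in> L2"
  using L2_add[OF assms(1) L2_cmult[OF assms(2), of "-1"]] by simp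

lemma L2_zero: "(\<lambda>x. 0 :: real) \<in> L2"
  by (simp add: L2_real_iff)

lemma L2_sum:
  fixes f :: "'i \<Rightarrow> real ^ 'n \<Rightarrow> real"
  assumes "\<And>i. i \<in> A \<Longrightarrow> f i \<in> L2" shows "(\<lambda>x. \<Sum>i\<in>A. f i x) \<in> L2"
  using assms by (induction A rule: infinite_finite_induct) (auto simp: L2_zero intro: L2_add)

lemma ip_commute: "ip f g = ip g f"
  by (simp add: ip_def mult.commute)

lemma ip_add_left: "f \<in> L2 \<Longrightarrow> g \<in> L2 \<Longrightarrow> h \<in> L2 \<Longrightarrow> ip (\<lambda>x. f x + g x) h = ip f h + ip g h"
  unfolding ip_def distrib_right by (intro Bochner_Integration.integral_add L2_integrable_mult)

lemma ip_diff_left: "f \<in> L2 \<Longrightarrow> g \<in> L2 \<Longrightarrow> h \<in> L2 \<Longrightarrow> ip (\<lambda>x. f x - g x) h = ip f h - ip g h"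
  unfolding ip_def left_diff_distrib by (intro Bochner_Integration.integral_diff L2_integrable_mult)

lemma ip_add_right: "f \<in> L2 \<Longrightarrow> g \<in> L2 \<Longrightarrow> h \<in> L2 \<Longrightarrow> ip h (\<lambda>x. f x + g x) = ip h f + ip h g"
  using ip_add_left[of f g h] by (simp only: ip_commute[of h "\<lambda>x. f x + g x"] ip_commute[of h f] ip_commute[of h g])

lemma ip_diff_right: "f \<in> L2 \<Longrightarrow> g \<in> L2 \<Longrightarrow> h \<in> L2 \<Longrightarrow> ip h (\<lambda>x. f x - g x) = ip h f - ip h g"
  using ip_diff_left[of f g h] by (simp only: ip_commute[of h "\<lambda>x. f x - g x"] ip_commute[of h f] ip_commute[of h g])

lemma ip_cmult_left: "ip (\<lambda>x. c * f x) h = c * ip f h"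
  by (simp add: ip_def mult.assoc)

lemma ip_cmult_right: "ip h (\<lambda>x. c * f x) = c * ip h f"
  using ip_cmult_left[of c f h] by (simp only: ip_commute[of h "\<lambda>x. c * f x"] ip_commute[of h f])

lemma ip_sum_left:
  assumes "\<And>i. i \<in> A \<Longrightarrow> f i \<in> L2" "h \<in> L2"
  shows "ip (\<lambda>x. \<Sum>i\<in>A. f i x) h = (\<Sum>i\<in>A. ip (f i) h)"
  using assms
proof (induction A rule: infinite_finite_induct)
  case (insert a A)
  then show ?case
    by (simp add: ip_add_left[OF _ L2_sum] del: sum.insert add: sum.insert[OF insert(1,2)])
qed (simp_all add: ip_def)

lemma ip_nonneg: "ip f f \<ge> 0"
  unfolding ip_def by (intro integral_nonneg_AE AE_I2) simp

lemma ip_self: "ip f f = sint (\<lambda>x. (f x)\<^sup>2)"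
  by (simp add: ip_def power2_eq_square)

lemma ip_self_zero:
  assumes "v \<in> L2" "ip v v = 0"
  shows "AE x in sphere_measure. v x = 0" and "ip f v = 0"
proof -
  have "AE x in sphere_measure. (v x)\<^sup>2 = 0"
    using assms by (subst integral_nonneg_eq_0_iff_AE[symmetric]) (auto simp: L2_real_iff ip_self)
  then show *: "AE x in sphere_measure. v x = 0" by simp
  have "AE x in sphere_measure. f x * v x = 0"
    using * by eventually_elim simp
  then have "sint (\<lambda>x. f x * v x) = sint (\<lambda>x::real^'a. 0)"
    by (rule integral_eq_zero_AE[THEN trans]) simp
  then show "ip f v = 0" by (simp add: ip_def)
qed

lemma ip_cong: "(\<And>x. x \<in> sphere 0 1 \<Longrightarrow> f x = f' x) \<Longrightarrow> (\<And>x. x \<in> sphere 0 1 \<Longrightarrow> g x = g' x) \<Longrightarrow> ip f g = ip f' g'"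
  unfolding ip_def by (intro sint_cong) simp

subsection \<open>Orthogonal projection onto the spherical harmonics\<close>

text \<open>
  Orthogonal projection onto a finite-dimensional space of functions, by induction on a spanning set:
  one Gram--Schmidt step removes one spanning function.
\<close>

lemma orthogonal_projection_exists:
  fixes S :: "(real ^ 'n \<Rightarrow> real) set" and u :: "'i \<Rightarrow> real ^ 'n \<Rightarrow> real"
  assumes "finite A" "\<And>h. h \<in> S \<Longrightarrow> \<exists>c. h = (\<lambda>x. \<Sum>a\<in>A. c a * u a x)"
    and "S \<subseteq> L2" "(\<lambda>x. 0) \<in> S" "\<And>g h. g \<in> S \<Longrightarrow> h \<in> S \<Longrightarrow> (\<lambda>x. g x + h x) \<in> S"
    and "\<And>h c. h \<in> S \<Longrightarrow> (\<lambda>x. c * h x) \<in> S" "f \<in> L2"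
  shows "\<exists>h \<in> S. \<forall>Y \<in> S. ip (\<lambda>x. f x - h x) Y = 0"
  using assms
proof (induction A arbitrary: S f rule: finite_induct)
  case empty
  have "ip (\<lambda>x. f x - 0) Y = 0" if "Y \<in> S" for Y
    using empty.prems(1)[OF that] by (auto simp: ip_def)
  then show ?case using empty.prems(3) by (intro bexI[of _ "\<lambda>x. 0"] ballI)
next
  case (insert a A)
  note add = insert.prems(4) and cmult = insert.prems(5)
  define S' where "S' = {h \<in> S. \<exists>c. h = (\<lambda>x. \<Sum>a\<in>A. c a * u a x)}"
  have S'_sub: "S' \<subseteq> S" "S' \<subseteq> L2" using insert.prems(2) by (auto simp: S'_def)
  have S'_I: "h \<in> S \<Longrightarrow> h = (\<lambda>x. \<Sum>b\<in>A. c b * u b x) \<Longrightarrow> h \<in> S'" for h c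
    unfolding S'_def by (rule CollectI, rule conjI, assumption, rule exI)
  have S'_E: "\<exists>c. h = (\<lambda>x. \<Sum>b\<in>A. c b * u b x)" if "h \<in> S'" for h
    using that unfolding S'_def mem_Collect_eq by (rule conjunct2)
  have S'_add: "(\<lambda>x. g x + h x) \<in> S'" if gh: "g \<in> S'" "h \<in> S'" for g h
  proof -
    obtain c where c: "g = (\<lambda>x. \<Sum>b\<in>A. c b * u b x)"
      using S'_E[OF gh(1)] by (rule exE)
    obtain d where d: "h = (\<lambda>x. \<Sum>b\<in>A. d b * u b x)"
      using S'_E[OF gh(2)] by (rule exE)
    have "(\<lambda>x. g x + h x) = (\<lambda>x. \<Sum>b\<in>A. (c b + d b) * u b x)"
      unfolding c d by (simp only: sum.distrib distrib_right)
    with add[OF subsetD[OF S'_sub(1) gh(1)] subsetD[OF S'_sub(1) gh(2)]] show ?thesis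
      by (rule S'_I)
  qed
  have S'_cmult: "(\<lambda>x. k * h x) \<in> S'" if h: "h \<in> S'" for h k
  proof -
    obtain c where c: "h = (\<lambda>x. \<Sum>b\<in>A. c b * u b x)"
      using S'_E[OF h] by (rule exE)
    have "(\<lambda>x. k * h x) = (\<lambda>x. \<Sum>b\<in>A. (k * c b) * u b x)"
      unfolding c by (simp only: sum_distrib_left mult.assoc)
    with cmult[OF subsetD[OF S'_sub(1) h]] show ?thesis
      by (rule S'_I)
  qed
  have S'_zero: "(\<lambda>x. 0) \<in> S'"
    by (rule S'_I[where c = "\<lambda>_. 0", OF insert.prems(3)]) simp
  have IH: "\<exists>h \<in> S'. \<forall>Y \<in> S'. ip (\<lambda>x. f x - h x) Y = 0" if "f \<in> L2" for f
    by (rule insert.IH[OF S'_E S'_sub(2) S'_zero S'_add S'_cmult that])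
  show ?case
  proof (cases "S' = S")
    case True
    then show ?thesis using IH[OF insert.prems(6)] by (simp only:)
  next
    case False
    then obtain v where v: "v \<in> S" "v \<notin> S'" using S'_sub by auto
    obtain c0 where c0: "v = (\<lambda>x. \<Sum>b\<in>insert a A. c0 b * u b x)"
      using insert.prems(1)[OF v(1)] by (rule exE)
    have c0a: "c0 a \<noteq> 0"
    proof
      assume "c0 a = 0"
      then have "v = (\<lambda>x. \<Sum>b\<in>A. c0 b * u b x)"
        unfolding c0 by (simp add: insert.hyps)
      from v(2) S'_I[OF v(1) this] show False by (rule notE)
    qed
    have vL2: "v \<in> L2" using v insert.prems(2) by auto
    obtain p where p: "p \<in> S'" "\<And>Y. Y \<in> S' \<Longrightarrow> ip (\<lambda>x. v x - p x) Y = 0"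
      using IH[OF vL2] by (elim bexE) (blast dest: bspec)
    obtain q where q: "q \<in> S'" "\<And>Y. Y \<in> S' \<Longrightarrow> ip (\<lambda>x. f x - q x) Y = 0"
      using IH[OF insert.prems(6)] by blast
    define v' where "v' = (\<lambda>x. v x - p x)"
    have v'_S: "v' \<in> S"
      using add[OF v(1) cmult[OF subsetD[OF S'_sub(1) p(1)], of "-1"]] by (simp add: v'_def)
    have v'_L2: "v' \<in> L2" and q_L2: "q \<in> L2" and f_L2: "f \<in> L2"
      using v'_S q(1) S'_sub insert.prems by auto
    define t where "t = ip (\<lambda>x. f x - q x) v' / ip v' v'"
    \<comment> \<open>If \<open>v'\<close> is a null function, then \<open>t = 0\<close> because division by zero gives zero, and both sides vanish.\<close>
    have t: "ip (\<lambda>x. f x - q x) v' = t * ip v' v'"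
      using ip_self_zero(2)[OF v'_L2] by (cases "ip v' v' = 0") (auto simp: t_def)
    define h where "h = (\<lambda>x. q x + t * v' x)"
    have h_S: "h \<in> S" unfolding h_def by (rule add[OF subsetD[OF S'_sub(1) q(1)] cmult[OF v'_S]])
    have "ip (\<lambda>x. f x - h x) Y = 0" if Y: "Y \<in> S" for Y
    proof -
      obtain c where c: "Y = (\<lambda>x. \<Sum>b\<in>insert a A. c b * u b x)"
        using insert.prems(1)[OF Y] by (rule exE)
      define l where "l = c a / c0 a"
      define w where "w = (\<lambda>x. Y x + (- l) * v x)"
      have w_S: "w \<in> S" unfolding w_def by (rule add[OF Y cmult[OF v(1)]])
      have "w = (\<lambda>x. \<Sum>b\<in>A. (c b - l * c0 b) * u b x)"
      proof
        fix x
        have "w x = (c a - l * c0 a) * u a x + (\<Sum>b\<in>A. c b * u b x) - l * (\<Sum>b\<in>A. c0 b * u b x)"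
          unfolding w_def c c0 by (simp add: insert.hyps algebra_simps)
        also have "c a - l * c0 a = 0" using c0a by (simp add: l_def)
        finally show "w x = (\<Sum>b\<in>A. (c b - l * c0 b) * u b x)"
          by (simp add: sum_subtractf left_diff_distrib sum_distrib_left mult.assoc)
      qed
      with w_S have w: "w \<in> S'" by (rule S'_I)
      define w' where "w' = (\<lambda>x. l * p x + w x)"
      have w': "w' \<in> S'" unfolding w'_def by (intro S'_add S'_cmult p w)
      then have w'_L2: "w' \<in> L2" using S'_sub by auto
      have Yeq: "Y = (\<lambda>x. l * v' x + w' x)"
        unfolding w'_def w_def v'_def by (simp add: algebra_simps)
      have 1: "(\<lambda>x. f x - q x) \<in> L2" "(\<lambda>x. t * v' x) \<in> L2" "(\<lambda>x. l * v' x) \<in> L2"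
        by (intro L2_diff L2_cmult f_L2 q_L2 v'_L2)+
      have "(\<lambda>x. f x - h x) = (\<lambda>x. (f x - q x) - t * v' x)"
        by (simp add: h_def algebra_simps)
      then have "ip (\<lambda>x. f x - h x) Y = ip (\<lambda>x. f x - q x) Y - t * ip v' Y"
        using ip_diff_left[OF 1(1,2) subsetD[OF insert.prems(2) Y]] by (simp only: ip_cmult_left)
      also have "ip (\<lambda>x. f x - q x) Y = l * ip (\<lambda>x. f x - q x) v' + ip (\<lambda>x. f x - q x) w'"
        by (subst Yeq) (simp only: ip_add_right[OF 1(3) w'_L2 1(1)] ip_cmult_right)
      also have "ip v' Y = l * ip v' v' + ip v' w'"
        by (subst Yeq) (simp only: ip_add_right[OF 1(3) w'_L2 v'_L2] ip_cmult_right)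
      also have "ip v' w' = 0" using p(2)[OF w'] by (simp add: v'_def)
      also have "ip (\<lambda>x. f x - q x) w' = 0" by (rule q(2)[OF w'])
      finally show ?thesis by (simp add: t)
    qed
    with h_S show ?thesis by blast
  qed
qed

text \<open>A homogeneous function is determined by its values on the sphere.\<close>

lemma harmonic_eqI:
  fixes Y Z :: "real ^ 'n \<Rightarrow> real"
  assumes Y: "Y \<in> spherical_harmonics n" and Z: "Z \<in> spherical_harmonics n"
    and eq: "\<And>x. x \<in> sphere 0 1 \<Longrightarrow> Y x = Z x"
  shows "Y = Z"
proof
  fix x :: "real ^ 'n"
  obtain y :: "real ^ 'n" where y: "y \<in> sphere 0 1" "x = norm x *\<^sub>R y"
  proof (cases "x = 0")
    case True
    then show ?thesis using that[of "axis undefined 1"] by simp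
  next
    case False
    then show ?thesis using that[of "sgn x"] by (simp add: norm_sgn sgn_div_norm)
  qed
  have "Y (norm x *\<^sub>R y) = Z (norm x *\<^sub>R y)"
    using eq[OF y(1)] by (simp only: hpoly_scale[OF harmonic_hpoly[OF Y]] hpoly_scale[OF harmonic_hpoly[OF Z]])
  then show "Y x = Z x" using y(2) by simp
qed

lemma proj_eqI:
  fixes f :: "real ^ 'n \<Rightarrow> real"
  assumes f: "f \<in> L2" and h: "h \<in> spherical_harmonics n"
    and orth: "\<And>Y. Y \<in> spherical_harmonics n \<Longrightarrow> ip (\<lambda>x. f x - h x) Y = 0"
  shows "proj n f = h"
  unfolding proj_def
proof (rule the_equality)
  show "h \<in> spherical_harmonics n \<and> (\<forall>Y\<in>spherical_harmonics n. sint (\<lambda>x. (f x - h x) \<bullet> Y x) = 0)"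
    using h orth by (simp add: ip_def)
next
  fix g assume "g \<in> spherical_harmonics n \<and> (\<forall>Y\<in>spherical_harmonics n. sint (\<lambda>x. (f x - g x) \<bullet> Y x) = 0)"
  then have g: "g \<in> spherical_harmonics n" and orth': "\<And>Y. Y \<in> spherical_harmonics n \<Longrightarrow> ip (\<lambda>x. f x - g x) Y = 0"
    by (auto simp: ip_def)
  let ?D = "\<lambda>x. g x - h x"
  have D: "?D \<in> spherical_harmonics n" by (rule harmonic_diff[OF g h])
  note L = L2_harmonic[OF g] L2_harmonic[OF h] L2_harmonic[OF D]
  have "ip ?D ?D = ip (\<lambda>x. f x - h x) ?D - ip (\<lambda>x. f x - g x) ?D"
    by (simp add: ip_diff_left f L)
  then have "ip ?D ?D = 0" by (simp add: orth[OF D] orth'[OF D])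
  then have "?D x = 0" if "x \<in> sphere 0 1" for x
    using sint_square_zero[OF harmonic_continuous_on[OF D] _ that] by (simp add: ip_self)
  then show "g = h" by (intro harmonic_eqI[OF g h]) simp
qed

lemma proj_real:
  fixes f :: "real ^ 'n \<Rightarrow> real"
  assumes f: "f \<in> L2"
  shows "proj n f \<in> spherical_harmonics n"
    and "Y \<in> spherical_harmonics n \<Longrightarrow> ip (\<lambda>x. f x - proj n f x) Y = 0"
proof -
  have "\<exists>h \<in> spherical_harmonics n. \<forall>Y \<in> spherical_harmonics n. ip (\<lambda>x. f x - h x) Y = 0"
  proof (rule orthogonal_projection_exists[OF finite_multi_indices(2)[where k = n]])
    fix h :: "real ^ 'n \<Rightarrow> real" assume "h \<in> spherical_harmonics n"
    then have "h \<in> poly_funs {\<alpha>. (\<Sum>i\<in>UNIV. \<alpha> i) = n}" by (simp add: spherical_harmonics_def)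
    then obtain c where "h = (\<lambda>x. \<Sum>\<alpha> | (\<Sum>i\<in>UNIV. \<alpha> i) = n. (\<Prod>i\<in>UNIV. x $ i ^ \<alpha> i) *\<^sub>R c \<alpha>)"
      unfolding poly_funs_def by auto
    then show "\<exists>c. h = (\<lambda>x. \<Sum>\<alpha> | (\<Sum>i\<in>UNIV. \<alpha> i) = n. c \<alpha> * (\<Prod>i\<in>UNIV. x $ i ^ \<alpha> i))"
      by (intro exI[of _ c]) (simp add: mult.commute)
  qed (use f in \<open>auto intro: L2_harmonic harmonic_zero harmonic_add harmonic_cmult\<close>)
  then obtain h where h: "h \<in> spherical_harmonics n" "\<And>Y. Y \<in> spherical_harmonics n \<Longrightarrow> ip (\<lambda>x. f x - h x) Y = 0"
    by blast
  have "proj n f = h" by (rule proj_eqI[OF f h])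
  with h show "proj n f \<in> spherical_harmonics n"
    and "Y \<in> spherical_harmonics n \<Longrightarrow> ip (\<lambda>x. f x - proj n f x) Y = 0"
    by auto
qed

lemma ip_proj:
  assumes "f \<in> L2" "Y \<in> spherical_harmonics n"
  shows "ip (proj n f) Y = ip f Y"
  using proj_real(2)[OF assms] ip_diff_left[OF assms(1) L2_harmonic[OF proj_real(1)[OF assms(1)]] L2_harmonic[OF assms(2)]]
  by simp

lemma harmonic_sum_orthogonal_expansion:
  fixes Z :: "nat \<Rightarrow> real ^ 'n \<Rightarrow> real"
  assumes d: "CARD('n) \<ge> 2" and Z: "\<And>m. Z m \<in> spherical_harmonics m" and A: "finite A"
    and Y: "Y \<in> spherical_harmonics n"
  shows "ip (\<lambda>x. \<Sum>m\<in>A. Z m x) Y = (if n \<in> A then ip (Z n) Y else 0)"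
proof -
  have "ip (Z m) Y = (if m = n then ip (Z n) Y else 0)" for m
    using sint_harmonics_orthogonal[OF d Z Y] by (auto simp: ip_def)
  then show ?thesis
    using A by (simp add: ip_sum_left L2_harmonic[OF Z] L2_harmonic[OF Y])
qed

lemma proj_harmonic_sum:
  fixes Z :: "nat \<Rightarrow> real ^ 'n \<Rightarrow> real"
  assumes d: "CARD('n) \<ge> 2" and Z: "\<And>m. Z m \<in> spherical_harmonics m" and A: "finite A"
  shows "proj n (\<lambda>x. \<Sum>m\<in>A. Z m x) = (if n \<in> A then Z n else (\<lambda>x. 0))"
proof (rule proj_eqI)
  show L: "(\<lambda>x. \<Sum>m\<in>A. Z m x) \<in> L2" by (intro L2_sum L2_harmonic[OF Z])
  show H: "(if n \<in> A then Z n else (\<lambda>x. 0)) \<in> spherical_harmonics n"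
    by (simp add: Z harmonic_zero)
  fix Y :: "real ^ 'n \<Rightarrow> real" assume Y: "Y \<in> spherical_harmonics n"
  have "ip (if n \<in> A then Z n else (\<lambda>x. 0)) Y = (if n \<in> A then ip (Z n) Y else 0)"
    by (simp add: ip_def)
  then show "ip (\<lambda>x. (\<Sum>m\<in>A. Z m x) - (if n \<in> A then Z n else (\<lambda>x. 0)) x) Y = 0"
    using ip_diff_left[OF L L2_harmonic[OF H] L2_harmonic[OF Y]] harmonic_sum_orthogonal_expansion[OF d Z A Y]
    by simp
qed

subsection \<open>Density of the harmonic sums\<close>

definition approximable :: "(real ^ 'n \<Rightarrow> real) \<Rightarrow> bool" where
  "approximable f \<longleftrightarrow> f \<in> L2 \<and> (\<forall>\<epsilon>>0. \<exists>p. harmonic_sum p \<and> ip (\<lambda>x. f x - p x) (\<lambda>x. f x - p x) < \<epsilon>)"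

lemma harmonic_sum_continuous: "harmonic_sum p \<Longrightarrow> continuous_on (sphere 0 1) p"
proof (induction rule: harmonic_sum.induct)
  case (cong f g)
  then show ?case by (subst continuous_on_cong[OF refl cong.hyps(2)])
qed (auto intro: harmonic_continuous_on continuous_on_add)

lemma ip_add_le:
  assumes "f \<in> L2" "g \<in> L2"
  shows "ip (\<lambda>x. f x + g x) (\<lambda>x. f x + g x) \<le> 2 * ip f f + 2 * ip g g"
proof -
  have "0 \<le> ip (\<lambda>x. f x - g x) (\<lambda>x. f x - g x)" by (rule ip_nonneg)
  also have "\<dots> = 2 * ip f f + 2 * ip g g - ip (\<lambda>x. f x + g x) (\<lambda>x. f x + g x)"
    using assms by (simp add: ip_diff_left ip_diff_right ip_add_left ip_add_right L2_add L2_diff ip_commute[of g f])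
  finally show ?thesis by simp
qed

lemma approximable_add:
  assumes f: "approximable f" and g: "approximable g"
  shows "approximable (\<lambda>x. f x + g x)"
  unfolding approximable_def
proof (intro conjI allI impI)
  show "(\<lambda>x. f x + g x) \<in> L2" using f g by (auto simp: approximable_def intro: L2_add)
  fix \<epsilon> :: real assume "\<epsilon> > 0"
  then have "\<epsilon> / 4 > 0" by simp
  then obtain p q where p: "harmonic_sum p" "ip (\<lambda>x. f x - p x) (\<lambda>x. f x - p x) < \<epsilon> / 4"
    and q: "harmonic_sum q" "ip (\<lambda>x. g x - q x) (\<lambda>x. g x - q x) < \<epsilon> / 4"
    using f g unfolding approximable_def by meson
  have L: "(\<lambda>x. f x - p x) \<in> L2" "(\<lambda>x. g x - q x) \<in> L2"
    using f g L2_continuous[OF harmonic_sum_continuous[OF p(1)]] L2_continuous[OF harmonic_sum_continuous[OF q(1)]]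
    by (simp_all add: approximable_def L2_diff)
  have "(\<lambda>x. f x + g x - (p x + q x)) = (\<lambda>x. (f x - p x) + (g x - q x))"
    by (simp add: algebra_simps)
  then show "\<exists>p. harmonic_sum p \<and> ip (\<lambda>x. f x + g x - p x) (\<lambda>x. f x + g x - p x) < \<epsilon>"
    using ip_add_le[OF L] p q harmonic_sum.add[OF p(1) q(1)]
    by (intro exI[of _ "\<lambda>x. p x + q x"]) auto
qed

lemma approximable_cmult:
  assumes f: "approximable f"
  shows "approximable (\<lambda>x. c * f x)"
  unfolding approximable_def
proof (intro conjI allI impI)
  show "(\<lambda>x. c * f x) \<in> L2" using f by (auto simp: approximable_def intro: L2_cmult)
  fix \<epsilon> :: real assume "\<epsilon> > 0"
  then have "\<epsilon> / (1 + c\<^sup>2) > 0" by (simp add: add_pos_nonneg)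
  then obtain p where p: "harmonic_sum p" "ip (\<lambda>x. f x - p x) (\<lambda>x. f x - p x) < \<epsilon> / (1 + c\<^sup>2)"
    using f unfolding approximable_def by meson
  let ?N = "ip (\<lambda>x. f x - p x) (\<lambda>x. f x - p x)"
  have "c * f x - c * p x = c * (f x - p x)" for x by (simp add: algebra_simps)
  then have "ip (\<lambda>x. c * f x - c * p x) (\<lambda>x. c * f x - c * p x) = c\<^sup>2 * ?N"
    by (simp add: ip_cmult_left ip_cmult_right power2_eq_square)
  also have "\<dots> \<le> (1 + c\<^sup>2) * ?N"
    by (intro mult_right_mono) (auto simp: ip_nonneg)
  also have "\<dots> < \<epsilon>"
    using p(2) by (simp add: field_simps add_pos_nonneg)
  finally show "\<exists>p. harmonic_sum p \<and> ip (\<lambda>x. c * f x - p x) (\<lambda>x. c * f x - p x) < \<epsilon>"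
    using harmonic_sum_cmult[OF p(1), of c] by (intro exI[of _ "\<lambda>x. c * p x"]) auto
qed

lemma approximable_continuous:
  fixes f :: "real ^ 'n \<Rightarrow> real"
  assumes f: "continuous_on (sphere 0 1) f"
  shows "approximable f"
  unfolding approximable_def
proof (intro conjI allI impI)
  show "f \<in> L2" by (rule L2_continuous[OF f])
  fix \<epsilon> :: real assume \<epsilon>: "\<epsilon> > 0"
  define M where "M = sint (\<lambda>x :: real ^ 'n. 1 :: real)"
  have M: "M \<ge> 0" unfolding M_def by (intro integral_nonneg_AE AE_I2) simp
  define \<delta> where "\<delta> = sqrt (\<epsilon> / (M + 1))"
  have \<delta>: "\<delta> > 0" "\<delta>\<^sup>2 = \<epsilon> / (M + 1)" using \<epsilon> M by (auto simp: \<delta>_def)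
  obtain p where p: "real_polynomial_function p" "\<And>x. x \<in> sphere 0 1 \<Longrightarrow> \<bar>f x - p x\<bar> < \<delta>"
    using Stone_Weierstrass_real_polynomial_function[OF compact_sphere f \<delta>(1)] by blast
  have p': "harmonic_sum p" by (rule harmonic_sum_polynomial[OF p(1)])
  have c: "continuous_on (sphere 0 1) (\<lambda>x. f x - p x)"
    by (intro continuous_on_diff f harmonic_sum_continuous p')
  have "ip (\<lambda>x. f x - p x) (\<lambda>x. f x - p x) \<le> sint (\<lambda>x :: real ^ 'n. \<delta>\<^sup>2 * 1)"
    unfolding ip_self
  proof (rule integral_mono)
    show "integrable sphere_measure (\<lambda>x. (f x - p x)\<^sup>2)"
      by (intro integrable_continuous_sphere continuous_on_power c)
    show "integrable sphere_measure (\<lambda>x :: real ^ 'n. \<delta>\<^sup>2 * 1)"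
      by (intro integrable_continuous_sphere continuous_intros)
    fix x :: "real ^ 'n" assume "x \<in> space sphere_measure"
    then have "\<bar>f x - p x\<bar> \<le> \<bar>\<delta>\<bar>" using p(2)[of x] by simp
    then show "(f x - p x)\<^sup>2 \<le> \<delta>\<^sup>2 * 1" by (simp add: abs_le_square_iff)
  qed
  also have "\<dots> = \<epsilon> / (M + 1) * M"
    unfolding integral_mult_right_zero M_def[symmetric] \<delta>(2) ..
  also have "\<dots> < \<epsilon>" using \<epsilon> M by (simp add: field_simps)
  finally show "\<exists>p. harmonic_sum p \<and> ip (\<lambda>x. f x - p x) (\<lambda>x. f x - p x) < \<epsilon>"
    using p' by blast
qed

lemma approximable_limit:
  fixes f w :: "real ^ 'n \<Rightarrow> real"
  assumes g: "\<And>i :: nat. approximable (g i)" and f: "f \<in> borel_measurable sphere_measure" and w: "w \<in> L2"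
    and lim: "\<And>x. x \<in> sphere 0 1 \<Longrightarrow> (\<lambda>i. g i x) \<longlonglongrightarrow> f x"
    and bound: "\<And>i x. x \<in> sphere 0 1 \<Longrightarrow> \<bar>g i x\<bar> \<le> \<bar>w x\<bar>"
  shows "approximable f"
  unfolding approximable_def
proof (intro conjI allI impI)
  have "\<bar>f x\<bar> \<le> \<bar>w x\<bar>" if "x \<in> sphere 0 1" for x
    using tendsto_rabs[OF lim[OF that]] bound[OF that] by (intro LIMSEQ_le_const2) auto
  then show fL2: "f \<in> L2" using L2_dominated[OF f w, of 1] by simp
  have gL2: "g i \<in> L2" for i using g by (simp add: approximable_def)
  fix \<epsilon> :: real assume \<epsilon>: "\<epsilon> > 0"
  have "(\<lambda>i. sint (\<lambda>x. (f x - g i x)\<^sup>2)) \<longlonglongrightarrow> sint (\<lambda>x :: real ^ 'n. 0)"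
  proof (rule integral_dominated_convergence[where w = "\<lambda>x. 4 * (w x)\<^sup>2"])
    show "(\<lambda>x. (f x - g i x)\<^sup>2) \<in> borel_measurable sphere_measure" for i
      using f L2_measurable[OF gL2] by simp
    show "integrable sphere_measure (\<lambda>x. 4 * (w x)\<^sup>2)" using w by (simp add: L2_real_iff)
    show "AE x in sphere_measure. (\<lambda>i. (f x - g i x)\<^sup>2) \<longlonglongrightarrow> 0"
      by (intro AE_I2) (auto intro!: tendsto_eq_intros lim)
    show "AE x in sphere_measure. norm ((f x - g i x)\<^sup>2) \<le> 4 * (w x)\<^sup>2" for i
    proof (intro AE_I2)
      fix x :: "real ^ 'n" assume "x \<in> space sphere_measure"
      then have x: "x \<in> sphere 0 1" by simp
      have "\<bar>f x - g i x\<bar> \<le> \<bar>2 * w x\<bar>"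
        using \<open>\<And>x. x \<in> sphere 0 1 \<Longrightarrow> \<bar>f x\<bar> \<le> \<bar>w x\<bar>\<close>[OF x] bound[OF x, of i] by linarith
      then have "(f x - g i x)\<^sup>2 \<le> (2 * w x)\<^sup>2" by (simp only: abs_le_square_iff)
      then show "norm ((f x - g i x)\<^sup>2) \<le> 4 * (w x)\<^sup>2" by (simp add: power_mult_distrib)
    qed
  qed simp
  then have "(\<lambda>i. ip (\<lambda>x. f x - g i x) (\<lambda>x. f x - g i x)) \<longlonglongrightarrow> 0"
    by (simp add: ip_self)
  then obtain i where i: "ip (\<lambda>x. f x - g i x) (\<lambda>x. f x - g i x) < \<epsilon> / 4"
    using order_tendstoD(2)[of _ 0 sequentially "\<epsilon> / 4"] \<epsilon> by (auto simp: eventually_sequentially)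
  have "\<epsilon> / 4 > 0" using \<epsilon> by simp
  then obtain p where p: "harmonic_sum p" "ip (\<lambda>x. g i x - p x) (\<lambda>x. g i x - p x) < \<epsilon> / 4"
    using g[of i] unfolding approximable_def by meson
  have L: "(\<lambda>x. f x - g i x) \<in> L2" "(\<lambda>x. g i x - p x) \<in> L2"
    using fL2 gL2 L2_continuous[OF harmonic_sum_continuous[OF p(1)]]
    by (simp_all add: L2_diff)
  have "(\<lambda>x. f x - p x) = (\<lambda>x. (f x - g i x) + (g i x - p x))" by simp
  then show "\<exists>p. harmonic_sum p \<and> ip (\<lambda>x. f x - p x) (\<lambda>x. f x - p x) < \<epsilon>"
    using ip_add_le[OF L] p i by (intro exI[of _ p]) auto
qed

text \<open>
  Open sets come first, as limits of continuous functions of the distance to the complement; the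
  general case is a Dynkin system argument.
\<close>

lemma approximable_indicator:
  assumes A: "A \<in> sets borel"
  shows "approximable (indicat_real A :: real ^ 'n \<Rightarrow> real)"
proof -
  have meas: "indicat_real B \<in> borel_measurable sphere_measure" if "B \<in> sets borel" for B :: "(real ^ 'n) set"
    unfolding measurable_cong_sets[OF sets_sphere_measure refl]
    using that by (intro measurable_restrict_space1) simp
  have one: "(\<lambda>x :: real ^ 'n. 1 :: real) \<in> L2" by (intro L2_continuous continuous_intros)
  have "A \<in> sigma_sets UNIV {S. open S}" using A by (simp add: sets_borel)
  show ?thesis
  proof (rule sigma_sets_induct_disjoint[where G = "{S. open S}" and \<Omega> = UNIV and A = A
        and P = "\<lambda>A. approximable (indicat_real A)"])
    show "A \<in> sigma_sets UNIV {S. open S}" by fact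
    show "Int_stable {S :: (real ^ 'n) set. open S}" by (auto simp: Int_stable_def)
    show "{S :: (real ^ 'n) set. open S} \<subseteq> Pow UNIV" by simp
  next
    fix U :: "(real ^ 'n) set" assume "U \<in> {S. open S}"
    then have U: "open U" by simp
    show "approximable (indicat_real U)"
    proof (cases "U = UNIV")
      case True
      then show ?thesis by (intro approximable_continuous) simp
    next
      case False
      define g where "g i x = min 1 (real i * infdist x (- U))" for i and x :: "real ^ 'n"
      show ?thesis
      proof (rule approximable_limit[of g])
        show "approximable (g i)" for i
          unfolding g_def by (intro approximable_continuous continuous_intros)
        show "indicat_real U \<in> borel_measurable sphere_measure" using U by (intro meas) auto
        show "(\<lambda>x :: real ^ 'n. 1 :: real) \<in> L2" by (rule one)
        show "\<bar>g i x\<bar> \<le> \<bar>1\<bar>" for i x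
          by (auto simp: g_def min_def infdist_nonneg)
        show "(\<lambda>i. g i x) \<longlonglongrightarrow> indicat_real U x" for x
        proof (cases "x \<in> U")
          case True
          then have pos: "infdist x (- U) > 0"
            using U False in_closed_iff_infdist_zero[of "- U" x] infdist_nonneg[of x "- U"]
            by (auto simp: closed_def less_le)
          obtain N :: nat where N: "1 / infdist x (- U) < real N" using reals_Archimedean2 by blast
          have "g i x = 1" if "i \<ge> N" for i
          proof -
            have "1 / infdist x (- U) \<le> real i" using N that by (meson less_le_trans less_imp_le of_nat_mono)
            then have "1 \<le> real i * infdist x (- U)" using pos by (simp add: field_simps)
            then show ?thesis by (simp add: g_def)
          qed
          then show ?thesis using True by (intro tendsto_eventually) (auto simp: eventually_sequentially)
        next
          case False
          then show ?thesis by (simp add: g_def)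
        qed
      qed
    qed
  next
    show "approximable (indicat_real ({} :: (real ^ 'n) set))"
      by (intro approximable_continuous) simp
  next
    fix B :: "(real ^ 'n) set" assume "approximable (indicat_real B)"
    from approximable_add[OF approximable_continuous[of "\<lambda>_. 1"] approximable_cmult[OF this, of "-1"]]
    have "approximable (\<lambda>x. 1 + (-1) * indicat_real B x)" by simp
    also have "(\<lambda>x. 1 + (-1) * indicat_real B x) = indicat_real (UNIV - B)"
      by (auto simp: indicator_def)
    finally show "approximable (indicat_real (UNIV - B))" .
  next
    fix B :: "nat \<Rightarrow> (real ^ 'n) set"
    assume disj: "disjoint_family B" and sets: "range B \<subseteq> sigma_sets UNIV {S. open S}"
      and IH: "\<And>i. approximable (indicat_real (B i))"
    have B: "B i \<in> sets borel" for i using sets by (auto simp: sets_borel)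
    have fin: "approximable (indicat_real (\<Union>i<n. B i))" for n
    proof (induction n)
      case 0
      show ?case by (intro approximable_continuous) simp
    next
      case (Suc n)
      have "indicat_real (\<Union>i<Suc n. B i) = (\<lambda>x. indicat_real (\<Union>i<n. B i) x + indicat_real (B n) x)"
      proof -
        have "B n \<inter> B i = {}" if "i < n" for i
          using disj that unfolding disjoint_family_on_def by (metis UNIV_I less_irrefl)
        then have "B n \<inter> (\<Union>i<n. B i) = {}" by blast
        then show ?thesis by (auto simp: lessThan_Suc indicator_def fun_eq_iff)
      qed
      then show ?case using approximable_add[OF Suc IH[of n]] by simp
    qed
    show "approximable (indicat_real (\<Union>i. B i))"
    proof (rule approximable_limit[OF fin])
      show "indicat_real (\<Union>i. B i) \<in> borel_measurable sphere_measure" using B by (intro meas) auto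
      show "(\<lambda>x :: real ^ 'n. 1 :: real) \<in> L2" by (rule one)
      show "\<bar>indicat_real (\<Union>i<n. B i) x\<bar> \<le> \<bar>1\<bar>" for n x by (simp add: indicator_def)
      show "(\<lambda>n. indicat_real (\<Union>i<n. B i) x) \<longlonglongrightarrow> indicat_real (\<Union>i. B i) x" for x
        by (rule LIMSEQ_indicator_UN)
    qed
  qed
qed

lemma approximable_sum:
  assumes "\<And>i. i \<in> I \<Longrightarrow> approximable (f i)"
  shows "approximable (\<lambda>x. \<Sum>i\<in>I. f i x)"
  using assms
  by (induction I rule: infinite_finite_induct) (auto intro: approximable_add approximable_continuous)

lemma approximable_cong:
  assumes "approximable f" "\<And>x. x \<in> sphere 0 1 \<Longrightarrow> g x = f x"
  shows "approximable g"
proof -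
  have "g \<in> L2"
    using assms(1) measurable_cong[of sphere_measure g f borel]
      Bochner_Integration.integrable_cong[of sphere_measure sphere_measure "\<lambda>x. (g x)\<^sup>2" "\<lambda>x. (f x)\<^sup>2"] assms(2)
    by (simp add: approximable_def L2_real_iff)
  moreover have "ip (\<lambda>x. g x - p x) (\<lambda>x. g x - p x) = ip (\<lambda>x. f x - p x) (\<lambda>x. f x - p x)" for p
    using assms(2) by (intro ip_cong) auto
  ultimately show ?thesis using assms(1) by (simp add: approximable_def)
qed

lemma approximable_L2:
  fixes f :: "real ^ 'n \<Rightarrow> real"
  assumes f: "f \<in> L2"
  shows "approximable f"
proof -
  obtain F where F: "\<And>i. simple_function sphere_measure (F i)"
    "\<And>x. x \<in> space sphere_measure \<Longrightarrow> (\<lambda>i. F i x) \<longlonglongrightarrow> f x"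
    "\<And>i x. x \<in> space sphere_measure \<Longrightarrow> dist (F i x) 0 \<le> 2 * dist (f x) 0"
    using borel_measurable_implies_sequence_metric[OF L2_measurable[OF f], of 0] by metis
  have simple: "approximable g" if g: "simple_function sphere_measure g" for g :: "real ^ 'n \<Rightarrow> real"
  proof (rule approximable_cong)
    have fin: "finite (g ` sphere 0 1)" using simple_functionD(1)[OF g] by simp
    have "g -` {y} \<inter> sphere 0 1 \<in> sets borel" for y
    proof -
      have "g -` {y} \<inter> space sphere_measure \<in> sets sphere_measure"
        by (rule simple_functionD(2)[OF g])
      then have "g -` {y} \<inter> sphere 0 1 \<in> sets (restrict_space borel (sphere 0 1))"
        by (simp add: sets_sphere_measure)
      then show ?thesis by (subst (asm) sets_restrict_space_iff) auto
    qed
    then show "approximable (\<lambda>x. \<Sum>y \<in> g ` sphere 0 1. y * indicat_real (g -` {y} \<inter> sphere 0 1) x)"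
      by (intro approximable_sum approximable_cmult approximable_indicator)
    fix x :: "real ^ 'n" assume x: "x \<in> sphere 0 1"
    have "(\<Sum>y \<in> g ` sphere 0 1. y * indicat_real (g -` {y} \<inter> sphere 0 1) x) = (\<Sum>y \<in> g ` sphere 0 1. if y = g x then y else 0)"
      using x by (intro sum.cong) (auto simp: indicator_def)
    also have "\<dots> = g x" using x fin by simp
    finally show "g x = (\<Sum>y \<in> g ` sphere 0 1. y * indicat_real (g -` {y} \<inter> sphere 0 1) x)" ..
  qed
  show ?thesis
  proof (rule approximable_limit[OF simple[OF F(1)] L2_measurable[OF f] L2_cmult[OF f, of 2]])
    show "(\<lambda>i. F i x) \<longlonglongrightarrow> f x" if "x \<in> sphere 0 1" for x using F(2) that by simp
    show "\<bar>F i x\<bar> \<le> \<bar>2 * f x\<bar>" if "x \<in> sphere 0 1" for i x using F(3)[of x i] that by (simp add: abs_mult)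
  qed
qed

text \<open>
  The partial sums of the projections are best approximations in mean square, so they are at least as
  good as any approximating harmonic sum of the same degree.
\<close>

lemma proj_sum_tendsto:
  fixes f :: "real ^ 'n \<Rightarrow> real"
  assumes d: "CARD('n) \<ge> 2" and f: "f \<in> L2"
  shows "(\<lambda>N. ip (\<lambda>x. f x - (\<Sum>n\<le>N. proj n f x)) (\<lambda>x. f x - (\<Sum>n\<le>N. proj n f x))) \<longlonglongrightarrow> 0"
proof (rule LIMSEQ_I)
  fix \<epsilon> :: real assume "\<epsilon> > 0"
  then obtain p where p: "harmonic_sum p" "ip (\<lambda>x. f x - p x) (\<lambda>x. f x - p x) < \<epsilon>"
    using approximable_L2[OF f] unfolding approximable_def by meson
  obtain N0 Y where Y: "\<And>n. Y n \<in> spherical_harmonics n" "\<And>x. x \<in> sphere 0 1 \<Longrightarrow> p x = (\<Sum>n\<le>N0. Y n x)"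
    using harmonic_sum_expansion[OF p(1)] by blast
  note PH = proj_real(1)[OF f]
  have "ip (\<lambda>x. f x - (\<Sum>n\<le>N. proj n f x)) (\<lambda>x. f x - (\<Sum>n\<le>N. proj n f x)) < \<epsilon>" if N: "N \<ge> N0" for N
  proof -
    define S where "S = (\<lambda>x. \<Sum>n\<le>N. proj n f x)"
    define P where "P = (\<lambda>x. \<Sum>n\<le>N0. Y n x)"
    have S: "S \<in> L2" unfolding S_def by (intro L2_sum L2_harmonic[OF PH])
    have P: "P \<in> L2" unfolding P_def by (intro L2_sum L2_harmonic[OF Y(1)])
    let ?R = "\<lambda>x. f x - S x" and ?T = "\<lambda>x. S x - P x"
    have R: "?R \<in> L2" and T: "?T \<in> L2" by (intro L2_diff f S P)+
    have orth: "ip Z ?R = 0" if Z: "Z \<in> spherical_harmonics m" and m: "m \<le> N" for Z m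
    proof -
      have "ip ?R Z = ip f Z - ip S Z" by (rule ip_diff_left[OF f S L2_harmonic[OF Z]])
      also have "ip S Z = ip (proj m f) Z"
        unfolding S_def using m by (simp add: harmonic_sum_orthogonal_expansion[OF d PH _ Z])
      finally show ?thesis using ip_proj[OF f Z] by (simp add: ip_commute)
    qed
    have "ip S ?R = (\<Sum>n\<le>N. ip (proj n f) ?R)"
      by (subst (1) S_def) (rule ip_sum_left[OF L2_harmonic[OF PH] R])
    also have "\<dots> = 0" by (intro sum.neutral ballI orth[OF PH]) simp
    finally have "ip S ?R = 0" .
    moreover have "ip P ?R = (\<Sum>n\<le>N0. ip (Y n) ?R)"
      unfolding P_def by (rule ip_sum_left[OF L2_harmonic[OF Y(1)] R])
    moreover have "\<dots> = 0" using N by (intro sum.neutral ballI orth[OF Y(1)]) simp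
    ultimately have TR: "ip ?T ?R = 0" by (simp only: ip_diff_left[OF S P R] diff_self)
    have "ip (\<lambda>x. f x - p x) (\<lambda>x. f x - p x) = ip (\<lambda>x. ?R x + ?T x) (\<lambda>x. ?R x + ?T x)"
      by (intro ip_cong) (auto simp: Y(2) P_def)
    also have "\<dots> = ip ?R ?R + ip ?T ?T"
      using TR ip_commute[of ?T ?R]
      by (simp only: ip_add_left[OF R T L2_add[OF R T]] ip_add_right[OF R T R] ip_add_right[OF R T T])
    finally have "ip ?R ?R \<le> ip (\<lambda>x. f x - p x) (\<lambda>x. f x - p x)"
      using ip_nonneg[of ?T] by linarith
    with p(2) show ?thesis by (simp add: S_def)
  qed
  then show "\<exists>no. \<forall>n\<ge>no. norm (ip (\<lambda>x. f x - (\<Sum>n\<le>n. proj n f x)) (\<lambda>x. f x - (\<Sum>n\<le>n. proj n f x)) - 0) < \<epsilon>"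
    by (intro exI[of _ N0]) (auto simp: abs_of_nonneg[OF ip_nonneg])
qed

lemma ip_harmonic_sum:
  fixes Z :: "nat \<Rightarrow> real ^ 'n \<Rightarrow> real"
  assumes d: "CARD('n) \<ge> 2" and Z: "\<And>m. Z m \<in> spherical_harmonics m" and A: "finite A"
  shows "ip (\<lambda>x. \<Sum>n\<in>A. Z n x) (\<lambda>x. \<Sum>n\<in>A. Z n x) = (\<Sum>n\<in>A. ip (Z n) (Z n))"
proof -
  have L: "(\<lambda>x. \<Sum>n\<in>A. Z n x) \<in> L2" by (intro L2_sum L2_harmonic[OF Z])
  have "ip (\<lambda>x. \<Sum>n\<in>A. Z n x) (\<lambda>x. \<Sum>n\<in>A. Z n x) = (\<Sum>n\<in>A. ip (Z n) (\<lambda>x. \<Sum>n\<in>A. Z n x))"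
    by (rule ip_sum_left[OF L2_harmonic[OF Z] L])
  also have "\<dots> = (\<Sum>n\<in>A. ip (Z n) (Z n))"
    by (intro sum.cong refl)
      (subst ip_commute, simp add: harmonic_sum_orthogonal_expansion[OF d Z A Z])
  finally show ?thesis .
qed

lemma parseval:
  fixes f :: "real ^ 'n \<Rightarrow> real"
  assumes d: "CARD('n) \<ge> 2" and f: "f \<in> L2"
  shows "(\<lambda>N. \<Sum>n\<le>N. ip (proj n f) (proj n f)) \<longlonglongrightarrow> ip f f"
proof -
  note PH = proj_real(1)[OF f]
  have "(\<Sum>n\<le>N. ip (proj n f) (proj n f)) =
      ip f f - ip (\<lambda>x. f x - (\<Sum>n\<le>N. proj n f x)) (\<lambda>x. f x - (\<Sum>n\<le>N. proj n f x))" for N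
  proof -
    define S where "S = (\<lambda>x. \<Sum>n\<le>N. proj n f x)"
    have S: "S \<in> L2" unfolding S_def by (intro L2_sum L2_harmonic[OF PH])
    have R: "(\<lambda>x. f x - S x) \<in> L2" by (intro L2_diff f S)
    have SS: "ip S S = (\<Sum>n\<le>N. ip (proj n f) (proj n f))"
      unfolding S_def by (rule ip_harmonic_sum[OF d PH]) simp
    have "ip S f = (\<Sum>n\<le>N. ip (proj n f) f)"
      unfolding S_def by (rule ip_sum_left[OF L2_harmonic[OF PH] f])
    also have "\<dots> = ip S S" unfolding SS
      using ip_proj[OF f PH] by (simp add: ip_commute)
    finally have "ip (\<lambda>x. f x - S x) (\<lambda>x. f x - S x) = ip f f - ip S S"
      using ip_commute[of f S]
      by (simp add: ip_diff_left[OF f S R] ip_diff_right[OF f S f] ip_diff_right[OF f S S])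
    then show ?thesis unfolding SS by (simp add: S_def)
  qed
  then show ?thesis
    using tendsto_diff[OF tendsto_const[of "ip f f"] proj_sum_tendsto[OF d f]] by simp
qed

section \<open>The inequality for real functions\<close>

definition tip :: "real ^ 'n \<Rightarrow> (real ^ 'n \<Rightarrow> real) \<Rightarrow> (real ^ 'n \<Rightarrow> real) \<Rightarrow> real" where
  "tip e f g = ip (\<lambda>x. (x \<bullet> e) * f x) g"

lemma L2_linear_mult:
  fixes f :: "real ^ 'n \<Rightarrow> real"
  assumes f: "f \<in> L2"
  shows "(\<lambda>x. (x \<bullet> e) * f x) \<in> L2"
proof (rule L2_dominated[OF _ f])
  have "(\<lambda>x :: real ^ 'n. x \<bullet> e) \<in> borel_measurable sphere_measure"
    by (intro continuous_borel_measurable_sphere continuous_intros)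
  then show "(\<lambda>x. (x \<bullet> e) * f x) \<in> borel_measurable sphere_measure"
    by (intro borel_measurable_times L2_measurable[OF f])
  fix x :: "real ^ 'n" assume "x \<in> sphere 0 1"
  then have "\<bar>x \<bullet> e\<bar> \<le> norm e" using Cauchy_Schwarz_ineq2[of x e] by simp
  then show "\<bar>(x \<bullet> e) * f x\<bar> \<le> norm e * \<bar>f x\<bar>"
    unfolding abs_mult by (intro mult_right_mono) auto
qed

lemma tip_eq: "tip e f g = sint (\<lambda>x. (x \<bullet> e) * (f x * g x))"
  by (simp add: tip_def ip_def mult.assoc)

lemma tip_commute: "tip e f g = tip e g f"
  by (simp add: tip_eq mult.commute)

lemma tip_add_left:
  assumes "f \<in> L2" "g \<in> L2" "h \<in> L2"
  shows "tip e (\<lambda>x. f x + g x) h = tip e f h + tip e g h"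
  unfolding tip_def distrib_left by (intro ip_add_left L2_linear_mult assms)

lemma tip_add_right:
  assumes "f \<in> L2" "g \<in> L2" "h \<in> L2"
  shows "tip e h (\<lambda>x. f x + g x) = tip e h f + tip e h g"
  unfolding tip_def by (intro ip_add_right L2_linear_mult assms)

lemma tip_sum_left:
  assumes "\<And>i. i \<in> A \<Longrightarrow> f i \<in> L2" "h \<in> L2"
  shows "tip e (\<lambda>x. \<Sum>i\<in>A. f i x) h = (\<Sum>i\<in>A. tip e (f i) h)"
  unfolding tip_def sum_distrib_left using assms by (intro ip_sum_left L2_linear_mult)

lemma tip_cmult_left: "tip e (\<lambda>x. c * f x) h = c * tip e f h"
  unfolding tip_def mult.left_commute[of _ c] by (rule ip_cmult_left)

lemma tip_cmult_right: "tip e h (\<lambda>x. c * f x) = c * tip e h f"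
  unfolding tip_def by (rule ip_cmult_right)

lemma weighted_integral_real:
  fixes g :: "real ^ 'n \<Rightarrow> real"
  assumes g: "g \<in> L2"
  shows "weighted_integral g e = ip g g - tip e g g"
proof -
  have "weighted_integral g e = sint (\<lambda>x. g x * g x - ((x \<bullet> e) * g x) * g x)"
    unfolding weighted_integral_def by (intro sint_cong) (simp add: power2_eq_square algebra_simps)
  also have "\<dots> = ip g g - tip e g g"
    unfolding ip_def tip_def by (intro Bochner_Integration.integral_diff L2_integrable_mult g L2_linear_mult)
  finally show ?thesis .
qed

text \<open>Only neighbouring degrees interact under multiplication by a linear form.\<close>

lemma tip_harmonic_sum:
  fixes Y :: "nat \<Rightarrow> real ^ 'n \<Rightarrow> real"
  assumes d: "CARD('n) \<ge> 2" and Y: "\<And>n. Y n \<in> spherical_harmonics n"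
  shows "tip e (\<lambda>x. \<Sum>n\<le>N. Y n x) (\<lambda>x. \<Sum>n\<le>N. Y n x) = 2 * (\<Sum>n<N. tip e (Y n) (Y (Suc n)))"
proof (induction N)
  case 0
  show ?case
    using sint_linear_harmonics_zero[OF d Y[of 0] Y[of 0]] by (simp add: tip_eq)
next
  case (Suc N)
  let ?S = "\<lambda>x. \<Sum>n\<le>N. Y n x"
  have S: "?S \<in> L2" by (intro L2_sum L2_harmonic[OF Y])
  have YL: "Y n \<in> L2" for n by (rule L2_harmonic[OF Y])
  define T where "T = tip e (Y N) (Y (Suc N))"
  have "tip e ?S (Y (Suc N)) = (\<Sum>n\<le>N. tip e (Y n) (Y (Suc N)))"
    by (rule tip_sum_left[OF YL YL])
  also have "\<dots> = (\<Sum>n\<le>N. if n = N then T else 0)"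
  proof (intro sum.cong refl)
    fix n assume "n \<in> {..N}"
    then show "tip e (Y n) (Y (Suc N)) = (if n = N then T else 0)"
      using sint_linear_harmonics_zero[OF d Y[of n] Y[of "Suc N"], of e] by (auto simp: tip_eq T_def)
  qed
  finally have cross: "tip e ?S (Y (Suc N)) = tip e (Y N) (Y (Suc N))"
    by (simp add: T_def)
  have self: "tip e (Y (Suc N)) (Y (Suc N)) = 0"
    using sint_linear_harmonics_zero[OF d Y[of "Suc N"] Y[of "Suc N"]] by (simp add: tip_eq)
  have "tip e (\<lambda>x. ?S x + Y (Suc N) x) (\<lambda>x. ?S x + Y (Suc N) x) =
      tip e ?S ?S + tip e ?S (Y (Suc N)) + (tip e (Y (Suc N)) ?S + tip e (Y (Suc N)) (Y (Suc N)))"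
    by (simp only: tip_add_left[OF S YL L2_add[OF S YL]] tip_add_right[OF S YL S] tip_add_right[OF S YL YL])
  also have "\<dots> = tip e ?S ?S + 2 * tip e (Y N) (Y (Suc N))"
    using tip_commute[of e "Y (Suc N)" ?S] by (simp only: self cross)
  finally show ?case by (simp add: Suc.IH)
qed

subsection \<open>A weighted Hardy inequality for the expansion coefficients\<close>

text \<open>
  \<open>jacobi_sq c n\<close> is the square of the entry linking the degrees \<open>n\<close> and \<open>n + 1\<close> in the Jacobi
  matrix of the Gegenbauer polynomials in dimension \<open>c + 2\<close>.
\<close>

definition jacobi_sq :: "real \<Rightarrow> nat \<Rightarrow> real" where
  "jacobi_sq c n = (real n + 1) * (real n + c) / ((2 * real n + c) * (2 * real n + c + 2))"

text \<open>
  Half the ratio \<open>1 + 1 / (2 n)\<close>, which to first order is the ratio \<open>\<surd>(n + 1) / \<surd>n\<close> of consecutive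
  values of the ground state \<open>\<surd>n\<close> of the discrete Hardy inequality. These rational weights take the place
  of the ground state in the estimate as well as in the trial functions.
\<close>

definition hweight :: "nat \<Rightarrow> real" where
  "hweight n = (2 * real n + 1) / (4 * real n)"

text \<open>
  The weight on \<open>\<parallel>Y\<^sub>n\<parallel>\<^sup>2\<close> left by the coupling of degrees \<open>n - 1\<close> and \<open>n\<close> when the weight
  \<open>hweight (n - 1)\<close> is put on \<open>\<parallel>Y\<^bsub>n-1\<^esub>\<parallel>\<^sup>2\<close>. Constants are excluded, so degree \<open>1\<close> has no lower neighbour.
\<close>

definition hdual :: "real \<Rightarrow> nat \<Rightarrow> real" where
  "hdual c n = (if n \<le> 1 then 0 else jacobi_sq c (n - 1) / hweight (n - 1))"

text \<open>
  The arithmetic-geometric mean inequality for \<open>2 \<langle>Y\<^sub>n, \<partial>\<^sub>e Y\<^bsub>n+1\<^esub>\<rangle> / (2 n + d)\<close>, followed by the sharp bound for the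
  directional derivative.
\<close>

lemma two_tip_le:
  fixes Y :: "nat \<Rightarrow> real ^ 'n \<Rightarrow> real"
  assumes d: "CARD('n) \<ge> 2" and Y: "\<And>n. Y n \<in> spherical_harmonics n" and e: "norm e = 1" and n: "n \<ge> 1"
  shows "2 * tip e (Y n) (Y (Suc n)) \<le> hweight n * ip (Y n) (Y n)
     + hdual (real CARD('n) - 2) (Suc n) * ip (Y (Suc n)) (Y (Suc n))"
proof -
  let ?d = "real CARD('n)"
  define p where "p = hweight n"
  define k where "k = 1 / (2 * real n + ?d)"
  have d2: "?d \<ge> 2" using d by simp
  have p: "p > 0" using n by (simp add: p_def hweight_def)
  let ?y = "Y n" and ?D = "pd e (Y (Suc n))"
  have D: "?D \<in> spherical_harmonics n" using pd_harmonic[OF Y[of "Suc n"], of e] by simp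
  have L: "?y \<in> L2" "?D \<in> L2" by (intro L2_harmonic[OF Y] L2_harmonic[OF D])+
  have tip: "tip e ?y (Y (Suc n)) = k * ip ?y ?D"
    unfolding tip_eq sint_linear_harmonics_Suc[OF d Y Y] by (simp add: ip_def k_def)
  have "0 \<le> ip (\<lambda>x. p * ?y x - k * ?D x) (\<lambda>x. p * ?y x - k * ?D x)" by (rule ip_nonneg)
  also have "\<dots> = p\<^sup>2 * ip ?y ?y - 2 * p * k * ip ?y ?D + k\<^sup>2 * ip ?D ?D"
    using ip_commute[of ?D ?y] L
    by (simp add: ip_diff_left ip_diff_right L2_diff L2_cmult ip_cmult_left ip_cmult_right power2_eq_square algebra_simps)
  finally have "p * (2 * (k * ip ?y ?D)) \<le> p * (p * ip ?y ?y + k\<^sup>2 * ip ?D ?D / p)"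
    using p by (simp add: power2_eq_square algebra_simps)
  then have 1: "2 * (k * ip ?y ?D) \<le> p * ip ?y ?y + k\<^sup>2 * ip ?D ?D / p"
    using p by (simp only: mult_le_cancel_left_pos)
  have "(2 * real n + ?d - 2) * ip ?D ?D
      \<le> (2 * real n + ?d) * ((real n + 1) * (real n + ?d - 2)) * ip (Y (Suc n)) (Y (Suc n))"
    using sint_pd_harmonic_bound[OF d Y[of "Suc n"] _ e] by (simp add: ip_self algebra_simps)
  then have "ip ?D ?D \<le> (2 * real n + ?d) * ((real n + 1) * (real n + ?d - 2)) / (2 * real n + ?d - 2) * ip (Y (Suc n)) (Y (Suc n))"
    using n d2 by (simp add: field_simps)
  then have "k\<^sup>2 * ip ?D ?D \<le> k\<^sup>2 * ((2 * real n + ?d) * ((real n + 1) * (real n + ?d - 2)) / (2 * real n + ?d - 2) * ip (Y (Suc n)) (Y (Suc n)))"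
    by (intro mult_left_mono) auto
  also have "\<dots> = jacobi_sq (?d - 2) n * ip (Y (Suc n)) (Y (Suc n))"
  proof -
    have "2 * real n + ?d \<noteq> 0" using n d2 by linarith
    moreover have "(1 / a)\<^sup>2 * (a * u / w * v) = u / (w * a) * v" if "a \<noteq> 0" for a u v w :: real
      using that by (simp add: power2_eq_square)
    ultimately have "k\<^sup>2 * ((2 * real n + ?d) * u / w * v) = u / (w * (2 * real n + ?d)) * v" for u v w
      unfolding k_def by blast
    moreover have "jacobi_sq (?d - 2) n = (real n + 1) * (real n + ?d - 2) / ((2 * real n + ?d - 2) * (2 * real n + ?d))"
      by (simp add: jacobi_sq_def add_diff_eq)
    ultimately show ?thesis by (simp only:)
  qed
  finally have "k\<^sup>2 * ip ?D ?D / p \<le> jacobi_sq (?d - 2) n * ip (Y (Suc n)) (Y (Suc n)) / p"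
    using p by (intro divide_right_mono) auto
  with 1 show ?thesis
    using n by (simp add: tip hdual_def p_def)
qed

text \<open>
  Summation of the estimates for neighbouring degrees. The term \<open>hweight N\<close> on the left is the part of
  degree \<open>N\<close> that is still available for the coupling with degree \<open>N + 1\<close>.
\<close>

lemma harmonic_sum_weighted_bound:
  fixes Y :: "nat \<Rightarrow> real ^ 'n \<Rightarrow> real"
  assumes d: "CARD('n) \<ge> 2" and Y: "\<And>n. Y n \<in> spherical_harmonics n" and e: "norm e = 1"
    and Y0: "Y 0 = (\<lambda>x. 0)"
  shows "(\<Sum>n\<le>N. (1 - hweight n - hdual (real CARD('n) - 2) n) * ip (Y n) (Y n)) + hweight N * ip (Y N) (Y N)
     \<le> (\<Sum>n\<le>N. ip (Y n) (Y n)) - 2 * (\<Sum>n<N. tip e (Y n) (Y (Suc n)))"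
proof (induction N)
  case 0
  show ?case by (simp add: Y0 ip_def)
next
  case (Suc N)
  have "2 * tip e (Y N) (Y (Suc N)) \<le> hweight N * ip (Y N) (Y N)
     + hdual (real CARD('n) - 2) (Suc N) * ip (Y (Suc N)) (Y (Suc N))"
  proof (cases "N = 0")
    case True
    then show ?thesis by (simp add: Y0 tip_def ip_def hdual_def)
  next
    case False
    then show ?thesis by (intro two_tip_le[OF d Y e]) simp
  qed
  with Suc.IH show ?case by (simp add: algebra_simps)
qed

subsection \<open>Passage to square-integrable functions\<close>

lemma harmonic_spherical_poly:
  fixes Y :: "real ^ 'n \<Rightarrow> real"
  assumes Y: "Y \<in> spherical_harmonics n" and nk: "n \<le> k"
  shows "Y \<in> spherical_polys k"
proof -
  have "Y \<in> poly_funs {\<alpha>. (\<Sum>i\<in>UNIV. \<alpha> i) = n}"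
    using Y by (simp add: spherical_harmonics_def)
  then obtain c where c: "Y = (\<lambda>x. \<Sum>\<alpha>\<in>{\<alpha>. (\<Sum>i\<in>UNIV. \<alpha> i) = n}. (\<Prod>i\<in>UNIV. x $ i ^ \<alpha> i) *\<^sub>R c \<alpha>)"
    unfolding poly_funs_def by auto
  show ?thesis
    unfolding c spherical_polys_def using nk
    by (intro poly_funs_sum poly_funs_monomial finite_multi_indices) auto
qed

lemma L2_orth_iff:
  fixes f :: "real ^ 'n \<Rightarrow> real"
  shows "f \<in> L2_orth k \<longleftrightarrow> f \<in> L2 \<and> (\<forall>P \<in> spherical_polys k. ip f P = 0)"
  by (auto simp: L2_orth_def ip_def mult.commute)

lemma proj_L2_orth:
  fixes f :: "real ^ 'n \<Rightarrow> real"
  assumes "f \<in> L2_orth k" "n \<le> k"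
  shows "proj n f = (\<lambda>x. 0)"
  using assms harmonic_spherical_poly[OF _ assms(2)]
  by (intro proj_eqI harmonic_zero) (auto simp: L2_orth_iff)

lemma integrable_weighted:
  fixes g :: "real ^ 'n \<Rightarrow> real"
  assumes g: "g \<in> L2"
  shows "integrable sphere_measure (\<lambda>x. (1 - x \<bullet> e) * (g x)\<^sup>2)"
proof -
  have "integrable sphere_measure (\<lambda>x. g x * g x - ((x \<bullet> e) * g x) * g x)"
    by (intro Bochner_Integration.integrable_diff L2_integrable_mult g L2_linear_mult)
  then show ?thesis by (simp add: power2_eq_square algebra_simps)
qed

lemma weighted_integral_le_approx:
  fixes f g :: "real ^ 'n \<Rightarrow> real"
  assumes f: "f \<in> L2" and g: "g \<in> L2" and e: "norm e = 1" and \<delta>: "\<delta> > 0"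
  shows "weighted_integral f e \<le> (1 + \<delta>) * weighted_integral g e
     + 2 * (1 + 1 / \<delta>) * ip (\<lambda>x. g x - f x) (\<lambda>x. g x - f x)"
proof -
  let ?r = "\<lambda>x. g x - f x"
  have r: "?r \<in> L2" by (intro L2_diff f g)
  note int = integrable_weighted
  have int2: "integrable sphere_measure (\<lambda>x. (?r x)\<^sup>2)" using r by (simp add: L2_real_iff)
  have "weighted_integral f e \<le> sint (\<lambda>x. (1 + \<delta>) * ((1 - x \<bullet> e) * (g x)\<^sup>2) + 2 * (1 + 1 / \<delta>) * (?r x)\<^sup>2)"
    unfolding weighted_integral_def real_norm_def power2_abs
  proof (rule integral_mono)
    show "integrable sphere_measure (\<lambda>x. (1 - x \<bullet> e) * (f x)\<^sup>2)" by (rule int[OF f])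
    show "integrable sphere_measure (\<lambda>x. (1 + \<delta>) * ((1 - x \<bullet> e) * (g x)\<^sup>2) + 2 * (1 + 1 / \<delta>) * (?r x)\<^sup>2)"
      by (intro Bochner_Integration.integrable_add integrable_mult_right int g int2)
    fix x :: "real ^ 'n" assume "x \<in> space sphere_measure"
    then have "\<bar>x \<bullet> e\<bar> \<le> 1" using Cauchy_Schwarz_ineq2[of x e] e by simp
    then have t: "0 \<le> 1 - x \<bullet> e" "1 - x \<bullet> e \<le> 2" by auto
    have quad: "(a - b)\<^sup>2 \<le> (1 + \<delta>) * a\<^sup>2 + (1 + 1 / \<delta>) * b\<^sup>2" for a b :: real
    proof -
      have "0 \<le> (\<delta> * a + b)\<^sup>2 / \<delta>" using \<delta> by simp
      also have "\<dots> = \<delta> * a\<^sup>2 + 2 * a * b + b\<^sup>2 / \<delta>"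
        using \<delta> by (simp add: power2_eq_square field_simps)
      finally show ?thesis by (simp add: power2_eq_square algebra_simps)
    qed
    have "(f x)\<^sup>2 \<le> (1 + \<delta>) * (g x)\<^sup>2 + (1 + 1 / \<delta>) * (?r x)\<^sup>2"
      using quad[of "g x" "?r x"] by simp
    then have "(1 - x \<bullet> e) * (f x)\<^sup>2 \<le> (1 - x \<bullet> e) * ((1 + \<delta>) * (g x)\<^sup>2 + (1 + 1 / \<delta>) * (?r x)\<^sup>2)"
      by (rule mult_left_mono[OF _ t(1)])
    also have "\<dots> = (1 + \<delta>) * ((1 - x \<bullet> e) * (g x)\<^sup>2) + (1 - x \<bullet> e) * ((1 + 1 / \<delta>) * (?r x)\<^sup>2)"
      by (simp add: distrib_left mult.left_commute)
    also have "(1 - x \<bullet> e) * ((1 + 1 / \<delta>) * (?r x)\<^sup>2) \<le> 2 * ((1 + 1 / \<delta>) * (?r x)\<^sup>2)"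
      using \<delta> by (intro mult_right_mono[OF t(2)]) simp
    finally show "(1 - x \<bullet> e) * (f x)\<^sup>2 \<le> (1 + \<delta>) * ((1 - x \<bullet> e) * (g x)\<^sup>2) + 2 * (1 + 1 / \<delta>) * (?r x)\<^sup>2"
      by (simp only: mult.assoc)
  qed
  also have "\<dots> = sint (\<lambda>x. (1 + \<delta>) * ((1 - x \<bullet> e) * (g x)\<^sup>2)) + sint (\<lambda>x. 2 * (1 + 1 / \<delta>) * (?r x)\<^sup>2)"
    by (intro Bochner_Integration.integral_add integrable_mult_right int g int2)
  also have "\<dots> = (1 + \<delta>) * weighted_integral g e + 2 * (1 + 1 / \<delta>) * ip ?r ?r"
    by (simp add: weighted_integral_def ip_self)
  finally show ?thesis .
qed

lemma weighted_integral_nonneg: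
  assumes "norm e = 1"
  shows "weighted_integral g e \<ge> 0"
  unfolding weighted_integral_def
proof (intro integral_nonneg_AE AE_I2)
  fix x :: "real ^ 'a" assume "x \<in> space sphere_measure"
  then have "x \<bullet> e \<le> 1" using Cauchy_Schwarz_ineq2[of x e] assms by simp
  then show "0 \<le> (1 - x \<bullet> e) * (norm (g x))\<^sup>2" by simp
qed

text \<open>
  What the inequality needs in degree \<open>n\<close>, where \<open>c = d - 2\<close> and \<open>c - 1 = d - 3\<close>.
\<close>

definition hardy_condition :: "real \<Rightarrow> nat \<Rightarrow> bool" where
  "hardy_condition c n \<longleftrightarrow> (c - 1)\<^sup>2 / (8 * (real n * (real n + c))) \<le> 1 - hweight n - hdual c n"

text \<open>
  By Parseval it suffices to treat the partial sums of the expansion of \<open>g\<close>. The weight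
  \<open>1 - \<langle>x, e\<rangle>\<close> is bounded, so both sides converge.
\<close>

lemma hardy_inequality_real:
  fixes f g :: "real ^ 'n \<Rightarrow> real"
  assumes d: "CARD('n) \<ge> 2" and f: "f \<in> L2_orth k" and fg: "is_frac_LB (1/2) f g" and e: "norm e = 1"
    and cond: "\<And>n. n > k \<Longrightarrow> hardy_condition (real CARD('n) - 2) n"
  shows "(real CARD('n) - 3)\<^sup>2 / 8 * ip f f \<le> weighted_integral g e"
proof -
  let ?d = "real CARD('n)"
  define B where "B = (?d - 3)\<^sup>2 / 8"
  have d2: "?d \<ge> 2" using d by simp
  have fL: "f \<in> L2" using f by (simp add: L2_orth_iff)
  have gL: "g \<in> L2" using fg by (simp add: is_frac_LB_def)
  define Y where "Y n = proj n g" for n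
  have Y: "Y n \<in> spherical_harmonics n" for n unfolding Y_def by (rule proj_real(1)[OF gL])
  have Y0: "Y 0 = (\<lambda>x. 0)"
    by (rule harmonic_eqI[OF Y harmonic_zero]) (use fg in \<open>simp add: is_frac_LB_def Y_def\<close>)
  let ?lam = "\<lambda>n. real n * (real n + (?d - 2))"
  have lam: "?lam n > 0" if "n \<ge> 1" for n using that d2 by simp
  have ipY: "ip (Y n) (Y n) = ?lam n * ip (proj n f) (proj n f)" if n: "n \<ge> 1" for n
  proof -
    have "ip (Y n) (Y n) = ip (\<lambda>x. (?lam n powr (1/2)) * proj n f x) (\<lambda>x. (?lam n powr (1/2)) * proj n f x)"
      by (rule ip_cong) (use fg n in \<open>simp_all add: is_frac_LB_def Y_def add_diff_eq\<close>)
    also have "\<dots> = (?lam n powr (1/2) * ?lam n powr (1/2)) * ip (proj n f) (proj n f)"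
      by (simp add: ip_cmult_left ip_cmult_right)
    also have "?lam n powr (1/2) * ?lam n powr (1/2) = ?lam n"
      using lam[OF n] by (simp add: powr_half_sqrt)
    finally show ?thesis .
  qed
  have summand: "B * ip (proj n f) (proj n f) \<le> (1 - hweight n - hdual (?d - 2) n) * ip (Y n) (Y n)" for n
  proof (cases "n \<le> k")
    case True
    then have 0: "proj n f = (\<lambda>x. 0)" by (rule proj_L2_orth[OF f])
    then have "ip (Y n) (Y n) = 0"
      using ipY[of n] Y0 by (cases "n = 0") (simp_all add: ip_def)
    then show ?thesis using 0 by (simp add: ip_def)
  next
    case False
    then have n: "n \<ge> 1" "n > k" by auto
    have "B * ip (proj n f) (proj n f) = B / ?lam n * ip (Y n) (Y n)"
    proof -
      have "B * v = B / l * (l * v)" if "l > 0" for l v :: real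
        using that by simp
      then show ?thesis unfolding ipY[OF n(1)] using lam[OF n(1)] by blast
    qed
    also have "B / ?lam n = (?d - 2 - 1)\<^sup>2 / (8 * ?lam n)"
      by (simp add: B_def)
    also have "\<dots> * ip (Y n) (Y n) \<le> (1 - hweight n - hdual (?d - 2) n) * ip (Y n) (Y n)"
      using cond[OF n(2)] unfolding hardy_condition_def by (intro mult_right_mono ip_nonneg)
    finally show ?thesis .
  qed
  have fin: "B * (\<Sum>n\<le>N. ip (proj n f) (proj n f)) \<le> weighted_integral (\<lambda>x. \<Sum>n\<le>N. Y n x) e" for N
  proof -
    have S: "(\<lambda>x. \<Sum>n\<le>N. Y n x) \<in> L2" by (intro L2_sum L2_harmonic[OF Y])
    have "B * (\<Sum>n\<le>N. ip (proj n f) (proj n f)) \<le> (\<Sum>n\<le>N. (1 - hweight n - hdual (?d - 2) n) * ip (Y n) (Y n))"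
      unfolding sum_distrib_left by (intro sum_mono summand)
    also have "\<dots> \<le> (\<Sum>n\<le>N. (1 - hweight n - hdual (?d - 2) n) * ip (Y n) (Y n)) + hweight N * ip (Y N) (Y N)"
      using ip_nonneg[of "Y N"] by (simp add: hweight_def)
    also have "\<dots> \<le> (\<Sum>n\<le>N. ip (Y n) (Y n)) - 2 * (\<Sum>n<N. tip e (Y n) (Y (Suc n)))"
      by (rule harmonic_sum_weighted_bound[OF d Y e Y0])
    also have "\<dots> = weighted_integral (\<lambda>x. \<Sum>n\<le>N. Y n x) e"
      unfolding weighted_integral_real[OF S] tip_harmonic_sum[OF d Y]
      by (subst ip_harmonic_sum[OF d Y]) simp_all
    finally show ?thesis .
  qed
  define W where "W = weighted_integral g e"
  have W: "W \<ge> 0" unfolding W_def by (rule weighted_integral_nonneg[OF e])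
  have le: "B * ip f f \<le> (1 + \<delta>) * W" if \<delta>: "\<delta> > 0" for \<delta>
  proof (rule LIMSEQ_le)
    show "(\<lambda>N. B * (\<Sum>n\<le>N. ip (proj n f) (proj n f))) \<longlonglongrightarrow> B * ip f f"
      by (intro tendsto_mult_left parseval[OF d fL])
    have "(\<lambda>N. (1 + \<delta>) * W + 2 * (1 + 1 / \<delta>) * ip (\<lambda>x. g x - (\<Sum>n\<le>N. Y n x)) (\<lambda>x. g x - (\<Sum>n\<le>N. Y n x)))
        \<longlonglongrightarrow> (1 + \<delta>) * W + 2 * (1 + 1 / \<delta>) * 0"
      unfolding Y_def by (intro tendsto_intros proj_sum_tendsto[OF d gL])
    then show "(\<lambda>N. (1 + \<delta>) * W + 2 * (1 + 1 / \<delta>) * ip (\<lambda>x. g x - (\<Sum>n\<le>N. Y n x)) (\<lambda>x. g x - (\<Sum>n\<le>N. Y n x)))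
        \<longlonglongrightarrow> (1 + \<delta>) * W"
      by simp
    have "weighted_integral (\<lambda>x. \<Sum>n\<le>N. Y n x) e
       \<le> (1 + \<delta>) * W + 2 * (1 + 1 / \<delta>) * ip (\<lambda>x. g x - (\<Sum>n\<le>N. Y n x)) (\<lambda>x. g x - (\<Sum>n\<le>N. Y n x))" for N
      unfolding W_def by (intro weighted_integral_le_approx gL e \<delta> L2_sum L2_harmonic[OF Y])
    with fin show "\<exists>N0. \<forall>N\<ge>N0. B * (\<Sum>n\<le>N. ip (proj n f) (proj n f))
       \<le> (1 + \<delta>) * W + 2 * (1 + 1 / \<delta>) * ip (\<lambda>x. g x - (\<Sum>n\<le>N. Y n x)) (\<lambda>x. g x - (\<Sum>n\<le>N. Y n x))"
      by (intro exI[of _ 0] allI impI) (rule order_trans)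
  qed
  have "B * ip f f \<le> W"
  proof (rule field_le_epsilon)
    fix \<epsilon> :: real assume \<epsilon>: "\<epsilon> > 0"
    define \<delta> where "\<delta> = \<epsilon> / (W + 1)"
    have "\<delta> > 0" using \<epsilon> W by (simp add: \<delta>_def)
    from le[OF this] have "B * ip f f \<le> W + \<delta> * W" by (simp add: algebra_simps)
    also have "\<delta> * W \<le> \<epsilon>" using \<epsilon> W by (simp add: \<delta>_def field_simps)
    finally show "B * ip f f \<le> W + \<epsilon>" by simp
  qed
  then show ?thesis by (simp add: B_def W_def)
qed

subsection \<open>The range of degrees\<close>

lemma one_minus_hweight_hdual:
  assumes c: "c \<ge> 0" and n: "n \<ge> 1"
  shows "1 - hweight n - hdual c n = 1 / 2 - 1 / (4 * real n)
     - 4 * (real n * (real n - 1 + c) * (real n - 1)) / ((2 * real n - 2 + c) * (2 * real n + c) * (2 * real n - 1))"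
proof (cases "n = 1")
  case True
  then show ?thesis by (simp add: hdual_def hweight_def)
next
  case False
  define x where "x = real n"
  have x: "x \<ge> 2" using n False by (simp add: x_def)
  have n1: "real (n - 1) = x - 1" using n by (simp add: x_def of_nat_diff)
  have nz: "x \<noteq> 0" "x - 1 \<noteq> 0" "2 * x - 1 \<noteq> 0" "2 * x - 2 + c \<noteq> 0" "2 * x + c \<noteq> 0" using x c by auto
  have w: "hweight (n - 1) = (2 * x - 1) / (4 * (x - 1))" "hweight n = 1 / 2 + 1 / (4 * x)"
    unfolding hweight_def n1 x_def[symmetric] using nz(1) by (simp_all add: add_divide_distrib algebra_simps)
  have a: "jacobi_sq c (n - 1) = x * (x - 1 + c) / ((2 * x - 2 + c) * (2 * x + c))"
    unfolding jacobi_sq_def n1 by (simp add: algebra_simps)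
  have "hdual c n = 4 * (x * (x - 1 + c) * (x - 1)) / ((2 * x - 2 + c) * (2 * x + c) * (2 * x - 1))"
    using False n unfolding hdual_def a w(1) by (simp add: algebra_simps)
  then show ?thesis
    unfolding w(2) x_def[symmetric] by simp
qed

text \<open>
  The difference of the two sides of the condition is a quadratic over a quintic polynomial in \<open>n\<close>, hence
  of order \<open>n\<^bsup>-3\<^esup>\<close>, while each side is of order \<open>n\<^bsup>-2\<^esup>\<close>. Nonnegativity of the quadratic gives the inequality,
  and the smaller order of the difference gives the sharpness of the constant.
\<close>

lemma hardy_gap:
  assumes c: "c \<ge> 0" and n: "n \<ge> 1" and nc: "n \<noteq> 1 \<or> c \<noteq> 0"
  defines "x \<equiv> real n"
  defines "q \<equiv> (2 * x - 2 + c) * (2 * x + c) * (2 * x - 1)"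
  shows "1 - hweight n - hdual c n - (c - 1)\<^sup>2 / (8 * (x * (x + c))) =
    ((4 * c\<^sup>2 + 4) * x\<^sup>2 - (2 * c ^ 4 - 4 * c ^ 3 - 4 * c\<^sup>2 - 4 * c + 4) * x + (c ^ 4 - 2 * c ^ 3 + c\<^sup>2 - 2 * c))
      / (8 * (x * (x + c)) * q)"
    and "q > 0"
proof -
  have x: "x \<ge> 1" using n by (simp add: x_def)
  have "2 * x - 2 + c > 0" using nc n c x by (cases "n = 1") (auto simp: x_def)
  then show q: "q > 0" unfolding q_def using x c by (intro mult_pos_pos) auto
  have l: "8 * (x * (x + c)) > 0" using x c by simp
  have gen: "1 / 2 - 1 / (4 * x) - z - u / (8 * (x * m)) = (4 * x * m - 2 * m - u) / (8 * (x * m)) - z"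
    if "m \<noteq> 0" for m u z :: real
    using x that by (simp add: field_simps)
  have "1 - hweight n - hdual c n - (c - 1)\<^sup>2 / (8 * (x * (x + c))) =
      (4 * x * (x + c) - 2 * (x + c) - (c - 1)\<^sup>2) / (8 * (x * (x + c))) - 4 * (x * (x - 1 + c) * (x - 1)) / q"
    unfolding one_minus_hweight_hdual[OF c n] x_def[symmetric] q_def by (rule gen) (use x c in simp)
  also have "\<dots> = ((4 * x * (x + c) - 2 * (x + c) - (c - 1)\<^sup>2) * q - 4 * (x * (x - 1 + c) * (x - 1)) * (8 * (x * (x + c))))
      / (8 * (x * (x + c)) * q)"
    using q l by (intro diff_frac_eq) auto
  also have "(4 * x * (x + c) - 2 * (x + c) - (c - 1)\<^sup>2) * q - 4 * (x * (x - 1 + c) * (x - 1)) * (8 * (x * (x + c))) =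
    (4 * c\<^sup>2 + 4) * x\<^sup>2 - (2 * c ^ 4 - 4 * c ^ 3 - 4 * c\<^sup>2 - 4 * c + 4) * x + (c ^ 4 - 2 * c ^ 3 + c\<^sup>2 - 2 * c)"
    unfolding q_def by algebra
  finally show "1 - hweight n - hdual c n - (c - 1)\<^sup>2 / (8 * (x * (x + c))) =
    ((4 * c\<^sup>2 + 4) * x\<^sup>2 - (2 * c ^ 4 - 4 * c ^ 3 - 4 * c\<^sup>2 - 4 * c + 4) * x + (c ^ 4 - 2 * c ^ 3 + c\<^sup>2 - 2 * c))
      / (8 * (x * (x + c)) * q)" .
qed

lemma hardy_condition_polynomial:
  assumes c: "c \<ge> 0" and n: "n \<ge> 1"
  defines "x \<equiv> real n"
  shows "hardy_condition c n \<longleftrightarrow>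
    0 \<le> (4 * c\<^sup>2 + 4) * x\<^sup>2 - (2 * c ^ 4 - 4 * c ^ 3 - 4 * c\<^sup>2 - 4 * c + 4) * x + (c ^ 4 - 2 * c ^ 3 + c\<^sup>2 - 2 * c)"
    (is "_ \<longleftrightarrow> 0 \<le> ?P")
proof (cases "n = 1 \<and> c = 0")
  case True
  then show ?thesis by (simp add: hardy_condition_def hdual_def hweight_def x_def)
next
  case False
  define q where "q = (2 * x - 2 + c) * (2 * x + c) * (2 * x - 1)"
  have gap: "1 - hweight n - hdual c n - (c - 1)\<^sup>2 / (8 * (x * (x + c))) = ?P / (8 * (x * (x + c)) * q)" and q: "q > 0"
    using hardy_gap[OF c n] False unfolding q_def x_def by blast+
  have "8 * (x * (x + c)) * q > 0"
    using n c q by (intro mult_pos_pos) (auto simp: x_def)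
  then have "0 \<le> ?P / (8 * (x * (x + c)) * q) \<longleftrightarrow> 0 \<le> ?P"
    by (simp only: zero_le_divide_iff) linarith
  then show ?thesis
    unfolding gap[symmetric] hardy_condition_def x_def[symmetric] by linarith
qed

text \<open>
  Replacing one factor \<open>n\<close> of the leading term by \<open>c\<^sup>2 / 2 + 1\<close> absorbs the negative term \<open>- 2 c\<^sup>4 n\<close>, the
  only one of high order in \<open>c\<close>.
\<close>

lemma hardy_condition_large:
  assumes c: "c \<ge> 0" and x: "real n \<ge> c\<^sup>2 / 2 + 1"
  shows "hardy_condition c n"
proof -
  define x where "x = real n"
  have x1: "x \<ge> 1" "x \<ge> c\<^sup>2 / 2 + 1" using x zero_le_power2[of c] unfolding x_def by linarith+
  then have n: "n \<ge> 1" unfolding x_def by linarith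
  \<comment> \<open>Every summand on the right is nonnegative in the given range.\<close>
  have "(4 * c\<^sup>2 + 4) * x\<^sup>2 - (2 * c ^ 4 - 4 * c ^ 3 - 4 * c\<^sup>2 - 4 * c + 4) * x + (c ^ 4 - 2 * c ^ 3 + c\<^sup>2 - 2 * c)
     = (4 * c\<^sup>2 + 4) * (x * (x - (c\<^sup>2 / 2 + 1))) + 4 * (c ^ 3 * (x - 1)) + 10 * (c\<^sup>2 * x) + 4 * (c * (x - 1))
        + c ^ 4 + 2 * c ^ 3 + c\<^sup>2 + 2 * c"
    by (simp add: power2_eq_square power3_eq_cube power4_eq_xxxx algebra_simps)
  also have "\<dots> \<ge> 0"
    using c x1 by (intro add_nonneg_nonneg mult_nonneg_nonneg) auto
  finally show ?thesis
    unfolding hardy_condition_polynomial[OF c n] x_def[symmetric] .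
qed

lemma hardy_condition_small:
  assumes n: "n \<ge> 1"
  shows "hardy_condition 0 n" "hardy_condition 2 n" "hardy_condition 3 n" "hardy_condition 4 n"
proof -
  define x where "x = real n"
  have x: "x \<ge> 1" using n by (simp add: x_def)
  have "0 \<le> 4 * x * (x - 1)" using x by simp
  then show "hardy_condition 0 n"
    unfolding hardy_condition_polynomial[OF order_refl n] x_def[symmetric]
    by (simp add: power2_eq_square algebra_simps)
  have "0 \<le> 20 * x * (x + 1)" using x by simp
  then show "hardy_condition 2 n"
    using hardy_condition_polynomial[OF _ n, of 2] unfolding x_def[symmetric]
    by (simp add: power2_eq_square algebra_simps)
  \<comment> \<open>The quadratic expanded at \<open>x = 1\<close>, and, for \<open>c = 4\<close>, with the square completed.\<close>
  have "0 \<le> 40 * (x - 1)\<^sup>2 + 70 * (x - 1) + 60" using x by (intro add_nonneg_nonneg) auto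
  then show "hardy_condition 3 n"
    using hardy_condition_polynomial[OF _ n, of 3] unfolding x_def[symmetric]
    by (simp add: power2_eq_square algebra_simps)
  have "0 \<le> 68 * (x - 45/34)\<^sup>2 + 574/34" by simp
  then show "hardy_condition 4 n"
    using hardy_condition_polynomial[OF _ n, of 4] unfolding x_def[symmetric]
    by (simp add: power2_eq_square algebra_simps)
qed

section \<open>Optimality of the constant\<close>

subsection \<open>Trial sequences\<close>

lemma shifted_harmonic_unbounded:
  assumes c: "c \<ge> (0 :: real)"
  shows "\<exists>L\<ge>K. R \<le> (\<Sum>n\<in>{K..<L}. 1 / (real n + c + 1))"
proof -
  have "eventually (\<lambda>L. harm L \<ge> (1 + c) * R + (harm K :: real)) sequentially"
    using harm_at_top by (simp add: filterlim_at_top)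
  then obtain L where L: "L \<ge> K" "harm L \<ge> (1 + c) * R + (harm K :: real)"
    using eventually_ge_at_top[of K] unfolding eventually_sequentially by (meson linear order_trans)
  have "(1 + c) * R \<le> harm L - harm K" using L by simp
  also have "harm L - harm K = (\<Sum>n\<in>{K..<L}. 1 / (real n + 1))"
    using L(1) sum_diff_nat_ivl[of 0 K L "\<lambda>n. 1 / (real n + 1)"]
    by (simp add: harm_altdef atLeast0LessThan inverse_eq_divide add.commute)
  also have "\<dots> \<le> (\<Sum>n\<in>{K..<L}. (1 + c) * (1 / (real n + c + 1)))"
    using c by (intro sum_mono) (simp add: field_simps)
  also have "\<dots> = (1 + c) * (\<Sum>n\<in>{K..<L}. 1 / (real n + c + 1))"
    by (rule sum_distrib_left[symmetric])
  finally show ?thesis using L(1) c by (intro exI[of _ L]) (simp add: mult_le_cancel_left_pos)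
qed

text \<open>
  The trial sequence is the ground state, whose squares are \<open>\<omega>\<close>, times a cutoff \<open>\<phi>\<close> that vanishes
  below \<open>K'\<close>, equals \<open>1\<close> up to \<open>L\<close> and then decays to \<open>0\<close> logarithmically. Splitting off the ground state
  writes the quadratic form as \<open>\<Sum> (1 - p\<^sub>n - r\<^sub>n) \<omega>\<^sub>n \<phi>\<^sub>n\<^sup>2 + \<Sum> p\<^sub>n \<omega>\<^sub>n (\<phi>\<^sub>n - \<phi>\<^bsub>n+1\<^esub>)\<^sup>2\<close>. The second sum, the cost
  of the cutoff, is bounded independently of \<open>L\<close>: the jump at \<open>K'\<close> costs a fixed amount, and the slope
  of the decay is chosen such that it costs at most \<open>1\<close>. The sum weighted with \<open>1 / (n (n + c))\<close>, however,
  grows like the harmonic series.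
\<close>

lemma trial_sequence_exists:
  fixes \<omega> p r :: "nat \<Rightarrow> real"
  assumes c: "c \<ge> 0" and \<epsilon>: "\<epsilon> > 0"
    and pr: "\<And>n. n \<ge> 1 \<Longrightarrow> p n * \<omega> n = r (Suc n) * \<omega> (Suc n)"
    and p: "\<And>n. n \<ge> 1 \<Longrightarrow> 0 \<le> p n \<and> p n \<le> 1"
    and c1: "c1 > 0" and \<omega>: "\<And>n. n \<ge> 1 \<Longrightarrow> c1 * real n \<le> \<omega> n \<and> \<omega> n \<le> c2 * real n"
    and ev: "eventually (\<lambda>n. 1 - p n - r n \<le> (B + \<epsilon>) / (real n * (real n + c))) sequentially"
  shows "\<exists>\<phi> M. (\<forall>n<K. \<phi> n = 0) \<and> (\<forall>n\<ge>M. \<phi> n = 0) \<and>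
     (\<Sum>n<M. \<omega> n * (\<phi> n)\<^sup>2) - 2 * (\<Sum>n<M. p n * \<omega> n * (\<phi> n * \<phi> (Suc n)))
       < (B + 2 * \<epsilon>) * (\<Sum>n<M. \<omega> n * (\<phi> n)\<^sup>2 / (real n * (real n + c)))"
proof -
  obtain N0 where N0: "\<And>n. n \<ge> N0 \<Longrightarrow> 1 - p n - r n \<le> (B + \<epsilon>) / (real n * (real n + c))"
    using ev by (auto simp: eventually_sequentially)
  \<comment> \<open>The recursion between \<open>p\<close>, \<open>r\<close> and \<open>\<omega>\<close> is assumed from \<open>1\<close> on only, so \<open>\<phi>\<close> must vanish at \<open>0\<close> and \<open>1\<close>.\<close>
  define K' where "K' = max (max K N0) 2"
  have K': "K' \<ge> K" "K' \<ge> N0" "K' \<ge> 2" by (auto simp: K'_def)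
  have c2: "c2 > 0" using \<omega>[of 1] c1 by simp
  have \<omega>0: "\<omega> n \<ge> 0" if "n \<ge> 1" for n using \<omega>[OF that] c1 that by (meson mult_nonneg_nonneg less_imp_le of_nat_0_le_iff order_trans)
  define J where "J = \<omega> (K' - 1)"
  have J: "J \<ge> 0" unfolding J_def using K' by (intro \<omega>0) auto
  obtain L where L: "L \<ge> K'" "(J + 2) / (\<epsilon> * c1) \<le> (\<Sum>n\<in>{K'..<L}. 1 / (real n + c + 1))"
    using shifted_harmonic_unbounded[OF c] by blast
  define T where "T n = (\<Sum>j\<in>{L..<n}. 1 / (c2 * (real j + 1)))" for n
  obtain M where M: "M \<ge> L" "c2 * 1 \<le> (\<Sum>n\<in>{L..<M}. 1 / (real n + 0 + 1))"
    using shifted_harmonic_unbounded[of 0 L "c2 * 1"] by blast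
  have TSuc: "T (Suc n) = T n + 1 / (c2 * (real n + 1))" if "n \<ge> L" for n
    unfolding T_def using that by simp
  have Tmono: "T m \<le> T n" if "m \<le> n" for m n
    unfolding T_def using that c2 by (intro sum_mono2) auto
  have TL: "T n = 0" if "n \<le> L" for n unfolding T_def using that by simp
  have TM: "T M \<ge> 1"
  proof -
    have "T M = (1 / c2) * (\<Sum>n\<in>{L..<M}. 1 / (real n + 0 + 1))"
      unfolding T_def sum_distrib_left by (intro sum.cong) auto
    also have "\<dots> \<ge> (1 / c2) * (c2 * 1)" using M(2) c2 by (intro mult_left_mono) auto
    finally show ?thesis using c2 by simp
  qed
  define \<phi> where "\<phi> n = (if n < K' then 0 else max 0 (1 - T n))" for n
  have \<phi>_left: "\<phi> n = 0" if "n < K'" for n using that by (simp add: \<phi>_def)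
  have \<phi>_mid: "\<phi> n = 1" if "n \<ge> K'" "n \<le> L" for n using that TL by (simp add: \<phi>_def)
  have \<phi>_right: "\<phi> n = 0" if "n \<ge> M" for n
    using TM Tmono[OF that] by (simp add: \<phi>_def)
  have step: "p n * \<omega> n * (\<phi> n - \<phi> (Suc n))\<^sup>2 \<le> \<phi> n - \<phi> (Suc n)" if n: "n \<ge> K'" for n
  proof -
    have n1: "n \<ge> 1" using n K' by simp
    define \<Delta> where "\<Delta> = \<phi> n - \<phi> (Suc n)"
    have \<Delta>: "0 \<le> \<Delta>" "c2 * (real n * \<Delta>) \<le> 1"
    proof -
      show "0 \<le> \<Delta>" using n Tmono[of n "Suc n"] by (simp add: \<Delta>_def \<phi>_def)
      have "\<Delta> \<le> 1 / (c2 * (real n + 1))"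
      proof (cases "n \<ge> L")
        case True
        define s where "s = 1 / (c2 * (real n + 1))"
        have "s \<ge> 0" "T (Suc n) = T n + s" using c2 TSuc[OF True] by (simp_all add: s_def)
        then have "\<Delta> \<le> s" using n by (auto simp: \<Delta>_def \<phi>_def max_def)
        then show ?thesis by (simp only: s_def)
      next
        case False
        then have "\<Delta> = 0" using \<phi>_mid[of n] \<phi>_mid[of "Suc n"] n by (simp add: \<Delta>_def)
        then show ?thesis using c2 by simp
      qed
      moreover have "c2 * (real n + 1) > 0" using c2 by simp
      ultimately have "(c2 * (real n + 1)) * \<Delta> \<le> 1"
        by (simp only: pos_le_divide_eq mult.commute[of \<Delta>])
      moreover have "c2 * (real n * \<Delta>) \<le> (c2 * (real n + 1)) * \<Delta>"
        using c2 \<open>0 \<le> \<Delta>\<close> by (simp add: algebra_simps)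
      ultimately show "c2 * (real n * \<Delta>) \<le> 1" by linarith
    qed
    have "p n * \<omega> n \<le> 1 * (c2 * real n)"
      using p[OF n1] \<omega>[OF n1] \<omega>0[OF n1] by (intro mult_mono) auto
    then have "p n * \<omega> n * \<Delta>\<^sup>2 \<le> (c2 * real n) * \<Delta>\<^sup>2"
      by (intro mult_right_mono) auto
    also have "\<dots> = (c2 * (real n * \<Delta>)) * \<Delta>" by (simp add: power2_eq_square)
    also have "\<dots> \<le> 1 * \<Delta>" using \<Delta> by (intro mult_right_mono) auto
    finally show ?thesis by (simp add: \<Delta>_def)
  qed
  define cost where "cost = (\<Sum>n<M. p n * \<omega> n * (\<phi> n - \<phi> (Suc n))\<^sup>2)"
  have cost: "cost \<le> J + 1"
  proof -
    have split: "{..<M} = {..<K' - 1} \<union> ({K' - 1} \<union> {K'..<M})" using K' L M by auto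
    have "cost = (\<Sum>n<K' - 1. p n * \<omega> n * (\<phi> n - \<phi> (Suc n))\<^sup>2)
        + (p (K' - 1) * \<omega> (K' - 1) * (\<phi> (K' - 1) - \<phi> (Suc (K' - 1)))\<^sup>2
           + (\<Sum>n\<in>{K'..<M}. p n * \<omega> n * (\<phi> n - \<phi> (Suc n))\<^sup>2))"
      unfolding cost_def split using K' by (subst sum.union_disjoint; (subst sum.union_disjoint)?) auto
    also have "(\<Sum>n<K' - 1. p n * \<omega> n * (\<phi> n - \<phi> (Suc n))\<^sup>2) = 0"
      by (intro sum.neutral) (auto simp: \<phi>_left)
    also have "p (K' - 1) * \<omega> (K' - 1) * (\<phi> (K' - 1) - \<phi> (Suc (K' - 1)))\<^sup>2 \<le> 1 * J"
    proof -
      have "\<phi> (K' - 1) = 0" "\<phi> (Suc (K' - 1)) = 1"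
        using K' L \<phi>_left[of "K' - 1"] \<phi>_mid[of K'] by simp_all
      moreover have "p (K' - 1) * \<omega> (K' - 1) \<le> 1 * J"
        using p[of "K' - 1"] K' J unfolding J_def by (intro mult_right_mono) auto
      ultimately show ?thesis by simp
    qed
    also have "(\<Sum>n\<in>{K'..<M}. p n * \<omega> n * (\<phi> n - \<phi> (Suc n))\<^sup>2) \<le> (\<Sum>n\<in>{K'..<M}. \<phi> n - \<phi> (Suc n))"
      by (intro sum_mono step) auto
    also have "\<dots> = \<phi> K' - \<phi> M"
    proof -
      have "(\<Sum>n\<in>{K'..<M}. \<phi> (Suc n) - \<phi> n) = \<phi> M - \<phi> K'"
        using L M by (intro sum_Suc_diff') auto
      then show ?thesis by (simp add: sum_subtractf)
    qed
    also have "\<dots> = 1" using \<phi>_mid[of K'] \<phi>_right[of M] L by simp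
    finally show ?thesis by simp
  qed
  define Q where "Q = (\<Sum>n<M. \<omega> n * (\<phi> n)\<^sup>2 / (real n * (real n + c)))"
  have Q_terms: "\<omega> n * (\<phi> n)\<^sup>2 / (real n * (real n + c)) \<ge> 0" for n
    using \<omega>0[of n] c by (cases "n = 0") auto
  have Q: "J + 2 \<le> \<epsilon> * Q"
  proof -
    have "c1 * (\<Sum>n\<in>{K'..<L}. 1 / (real n + c + 1)) \<le> (\<Sum>n\<in>{K'..<L}. \<omega> n * (\<phi> n)\<^sup>2 / (real n * (real n + c)))"
      unfolding sum_distrib_left
    proof (rule sum_mono)
      fix n assume n: "n \<in> {K'..<L}"
      then have n1: "n \<ge> 1" using K' by auto
      have "c1 * (1 / (real n + c + 1)) \<le> c1 * (1 / (real n + c))"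
        using c1 c n1 by (intro mult_left_mono divide_left_mono mult_pos_pos) auto
      also have "\<dots> = (c1 * real n) / (real n * (real n + c))" using n1 by simp
      also have "\<dots> \<le> \<omega> n / (real n * (real n + c))"
        using \<omega>[OF n1] c by (intro divide_right_mono) auto
      also have "\<dots> = \<omega> n * (\<phi> n)\<^sup>2 / (real n * (real n + c))"
        using \<phi>_mid[of n] n by simp
      finally show "c1 * (1 / (real n + c + 1)) \<le> \<omega> n * (\<phi> n)\<^sup>2 / (real n * (real n + c))" .
    qed
    also have "\<dots> \<le> Q"
      unfolding Q_def using M by (intro sum_mono2 Q_terms) auto
    finally have "\<epsilon> * (c1 * (\<Sum>n\<in>{K'..<L}. 1 / (real n + c + 1))) \<le> \<epsilon> * Q"
      using \<epsilon> by (intro mult_left_mono) auto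
    moreover have "J + 2 \<le> \<epsilon> * (c1 * (\<Sum>n\<in>{K'..<L}. 1 / (real n + c + 1)))"
      using L(2) \<epsilon> c1 by (simp add: divide_le_eq mult_ac)
    ultimately show ?thesis by linarith
  qed
  have \<phi>01: "\<phi> 0 = 0" "\<phi> 1 = 0" using K' by (auto intro: \<phi>_left)
  \<comment> \<open>The squares of \<open>\<phi> (n + 1)\<close> are collected with those of \<open>\<phi> n\<close>; the boundary terms vanish.\<close>
  have shift: "(\<Sum>n<M. p n * \<omega> n * (\<phi> (Suc n))\<^sup>2) = (\<Sum>n<M. r n * \<omega> n * (\<phi> n)\<^sup>2)"
  proof -
    have "(\<Sum>n<M. p n * \<omega> n * (\<phi> (Suc n))\<^sup>2) = (\<Sum>n<M. r (Suc n) * \<omega> (Suc n) * (\<phi> (Suc n))\<^sup>2)"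
    proof (intro sum.cong refl)
      fix n show "p n * \<omega> n * (\<phi> (Suc n))\<^sup>2 = r (Suc n) * \<omega> (Suc n) * (\<phi> (Suc n))\<^sup>2"
        using pr[of n] \<phi>01 by (cases "n = 0") auto
    qed
    moreover have "(\<Sum>n<M. r (Suc n) * \<omega> (Suc n) * (\<phi> (Suc n))\<^sup>2) - (\<Sum>n<M. r n * \<omega> n * (\<phi> n)\<^sup>2)
        = r M * \<omega> M * (\<phi> M)\<^sup>2 - r 0 * \<omega> 0 * (\<phi> 0)\<^sup>2"
      unfolding sum_subtractf[symmetric] by (rule sum_lessThan_telescope)
    ultimately show ?thesis using \<phi>_right[of M] \<phi>01 by simp
  qed
  have "cost = (\<Sum>n<M. p n * \<omega> n * (\<phi> n)\<^sup>2) + (\<Sum>n<M. p n * \<omega> n * (\<phi> (Suc n))\<^sup>2)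
      - 2 * (\<Sum>n<M. p n * \<omega> n * (\<phi> n * \<phi> (Suc n)))"
    unfolding cost_def sum_distrib_left sum.distrib[symmetric] sum_subtractf[symmetric]
    by (intro sum.cong refl) (simp add: power2_eq_square algebra_simps)
  then have "(\<Sum>n<M. \<omega> n * (\<phi> n)\<^sup>2) - 2 * (\<Sum>n<M. p n * \<omega> n * (\<phi> n * \<phi> (Suc n)))
      = (\<Sum>n<M. \<omega> n * (\<phi> n)\<^sup>2) - (\<Sum>n<M. p n * \<omega> n * (\<phi> n)\<^sup>2) - (\<Sum>n<M. r n * \<omega> n * (\<phi> n)\<^sup>2) + cost"
    unfolding shift by simp
  also have "(\<Sum>n<M. \<omega> n * (\<phi> n)\<^sup>2) - (\<Sum>n<M. p n * \<omega> n * (\<phi> n)\<^sup>2) - (\<Sum>n<M. r n * \<omega> n * (\<phi> n)\<^sup>2)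
     = (\<Sum>n<M. (1 - p n - r n) * (\<omega> n * (\<phi> n)\<^sup>2))"
    unfolding sum_subtractf[symmetric] by (intro sum.cong refl) (simp add: algebra_simps)
  also have "\<dots> \<le> (\<Sum>n<M. (B + \<epsilon>) * (\<omega> n * (\<phi> n)\<^sup>2 / (real n * (real n + c))))"
  proof (rule sum_mono)
    fix n
    show "(1 - p n - r n) * (\<omega> n * (\<phi> n)\<^sup>2) \<le> (B + \<epsilon>) * (\<omega> n * (\<phi> n)\<^sup>2 / (real n * (real n + c)))"
    proof (cases "n < K'")
      case True
      then show ?thesis by (simp add: \<phi>_left)
    next
      case False
      then have "n \<ge> N0" "n \<ge> 1" using K' by auto
      then have "(1 - p n - r n) * (\<omega> n * (\<phi> n)\<^sup>2) \<le> (B + \<epsilon>) / (real n * (real n + c)) * (\<omega> n * (\<phi> n)\<^sup>2)"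
        using N0 \<omega>0 by (intro mult_right_mono) auto
      then show ?thesis by simp
    qed
  qed
  also have "\<dots> = (B + \<epsilon>) * Q" unfolding Q_def by (rule sum_distrib_left[symmetric])
  finally have "(\<Sum>n<M. \<omega> n * (\<phi> n)\<^sup>2) - 2 * (\<Sum>n<M. p n * \<omega> n * (\<phi> n * \<phi> (Suc n))) \<le> (B + \<epsilon>) * Q + cost"
    by simp
  also have "\<dots> < (B + 2 * \<epsilon>) * Q"
    using cost Q by (simp add: algebra_simps)
  finally show ?thesis
    unfolding Q_def using \<phi>_left \<phi>_right K' by (intro exI[of _ \<phi>] exI[of _ M]) auto
qed

lemma hardy_gap_eventually:
  assumes c: "c \<ge> 0" and \<epsilon>: "\<epsilon> > 0"
  shows "eventually (\<lambda>n. 1 - hweight n - hdual c n \<le> ((c - 1)\<^sup>2 / 8 + \<epsilon>) / (real n * (real n + c))) sequentially"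
proof -
  define q where "q x = (2 * x - 2 + c) * (2 * x + c) * (2 * x - 1)" for x :: real
  define a2 a1 a0 where "a2 = 4 * c\<^sup>2 + 4" and "a1 = 2 * c ^ 4 - 4 * c ^ 3 - 4 * c\<^sup>2 - 4 * c + 4"
    and "a0 = c ^ 4 - 2 * c ^ 3 + c\<^sup>2 - 2 * c"
  have "((\<lambda>n. (real n)\<^sup>2 / q (real n)) \<longlongrightarrow> 0) sequentially" "((\<lambda>n. real n / q (real n)) \<longlongrightarrow> 0) sequentially"
    "((\<lambda>n. 1 / q (real n)) \<longlongrightarrow> 0) sequentially"
    unfolding q_def by real_asymp+
  then have "((\<lambda>n. (a2 * ((real n)\<^sup>2 / q (real n)) - a1 * (real n / q (real n)) + a0 * (1 / q (real n))) / 8)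
      \<longlongrightarrow> (a2 * 0 - a1 * 0 + a0 * 0) / 8) sequentially"
    by (intro tendsto_intros) auto
  then have "((\<lambda>n. (a2 * (real n)\<^sup>2 - a1 * real n + a0) / (8 * q (real n))) \<longlongrightarrow> 0) sequentially"
    by (simp add: add_divide_distrib diff_divide_distrib mult.commute)
  then have "eventually (\<lambda>n. (a2 * (real n)\<^sup>2 - a1 * real n + a0) / (8 * q (real n)) < \<epsilon>) sequentially"
    using \<epsilon> by (rule order_tendstoD)
  with eventually_ge_at_top[of 2] show ?thesis
  proof eventually_elim
    case (elim n)
    define s where "s = real n * (real n + c)"
    have s: "s > 0" using elim(1) c by (simp add: s_def)
    have gap: "1 - hweight n - hdual c n - (c - 1)\<^sup>2 / (8 * s) = (a2 * (real n)\<^sup>2 - a1 * real n + a0) / (8 * s * q (real n))"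
      using hardy_gap(1)[OF c, of n] elim(1) unfolding s_def q_def a2_def a1_def a0_def by simp
    have "(a2 * (real n)\<^sup>2 - a1 * real n + a0) / (8 * s * q (real n)) = (a2 * (real n)\<^sup>2 - a1 * real n + a0) / (8 * q (real n)) / s"
      by (simp add: mult_ac)
    also have "\<dots> \<le> \<epsilon> / s" using elim(2) s by (intro divide_right_mono) auto
    finally have "1 - hweight n - hdual c n \<le> (c - 1)\<^sup>2 / (8 * s) + \<epsilon> / s" using gap by linarith
    also have "\<dots> = ((c - 1)\<^sup>2 / 8 + \<epsilon>) / s" by (simp add: add_divide_distrib)
    finally show ?case by (simp add: s_def)
  qed
qed

subsection \<open>Zonal trial functions\<close>

text \<open>
  The coefficients of the ground state with respect to the zonal harmonics. They are chosen such that
  the coupling of the degrees \<open>n\<close> and \<open>n + 1\<close> equals \<open>hweight n\<close> times the squared norm in degree \<open>n\<close>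
  and also \<open>hdual\<close> at \<open>n + 1\<close> times the squared norm in degree \<open>n + 1\<close>.
\<close>

primrec trial_coeff :: "real \<Rightarrow> nat \<Rightarrow> real" where
  "trial_coeff c 0 = 1"
| "trial_coeff c (Suc n) = (if n = 0 then 1 else trial_coeff c n * hweight n / jacobi_sq c n)"

lemma jacobi_sq_pos: "c \<ge> 0 \<Longrightarrow> n \<ge> 1 \<Longrightarrow> jacobi_sq c n > 0"
  by (simp add: jacobi_sq_def add_pos_nonneg)

text \<open>
  The squared norms of the ground state grow linearly. The quotient of \<open>\<omega> n / n\<close> at consecutive degrees is
  \<open>\<rho> n = (1 + 1 / (4 n (n + 1))) (1 + c (c - 2) / (4 (n + 1) (n + c)))\<close>, which is at least \<open>1\<close> and at most the
  exponential of a term of a telescoping series. The excluded range \<open>0 < c < 1\<close> contains no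
  dimension.
\<close>

lemma weight_growth:
  fixes \<omega> :: "nat \<Rightarrow> real"
  assumes c: "c = 0 \<or> c \<ge> 1" and pos: "\<omega> 1 > 0"
    and rec: "\<And>n. n \<ge> 1 \<Longrightarrow> \<omega> (Suc n) = \<omega> n * ((hweight n)\<^sup>2 / jacobi_sq c n)"
    and n: "n \<ge> 1"
  shows "\<omega> 1 * real n \<le> \<omega> n" and "\<omega> n \<le> \<omega> 1 * exp ((1 + c\<^sup>2) / 4) * real n"
proof -
  have c0: "c \<ge> 0" using c by auto
  define \<rho> where "\<rho> n = (1 + 1 / (4 * (real n * (real n + 1)))) * (1 + c * (c - 2) / (4 * ((real n + 1) * (real n + c))))" for n
  have step: "\<omega> (Suc n) = \<omega> n / real n * \<rho> n * real (Suc n)" if n: "n \<ge> 1" for n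
  proof -
    define x where "x = real n"
    have x: "x \<ge> 1" using n by (simp add: x_def)
    have nz: "x \<noteq> 0" "x + 1 \<noteq> 0" "x + c \<noteq> 0" using x c0 by auto
    have "\<rho> n = ((4 * (x * (x + 1)) + 1) / (4 * (x * (x + 1)))) * ((4 * ((x + 1) * (x + c)) + c * (c - 2)) / (4 * ((x + 1) * (x + c))))"
      unfolding \<rho>_def x_def[symmetric] using nz by (simp add: add_divide_distrib)
    also have "4 * (x * (x + 1)) + 1 = (2 * x + 1)\<^sup>2" by (simp add: power2_eq_square algebra_simps)
    also have "4 * ((x + 1) * (x + c)) + c * (c - 2) = (2 * x + c) * (2 * x + c + 2)" by (simp add: algebra_simps)
    finally have \<rho>: "\<rho> n = (2 * x + 1)\<^sup>2 * ((2 * x + c) * (2 * x + c + 2)) / ((4 * (x * (x + 1))) * (4 * ((x + 1) * (x + c))))"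
      by simp
    have "(hweight n)\<^sup>2 / jacobi_sq c n = (2 * x + 1)\<^sup>2 / (4 * x)\<^sup>2 * (((2 * x + c) * (2 * x + c + 2)) / ((x + 1) * (x + c)))"
      unfolding hweight_def jacobi_sq_def x_def[symmetric] by (simp add: power_divide)
    also have "\<dots> = (1 / x) * \<rho> n * (x + 1)"
    proof -
      have "P\<^sup>2 / (4 * x)\<^sup>2 * (S / (a * m)) = (1 / x) * (P\<^sup>2 * S / ((4 * (x * a)) * (4 * (a * m)))) * a"
        if "a \<noteq> 0" "m \<noteq> 0" for P S a m :: real
        using nz(1) that by (simp add: power2_eq_square field_simps)
      from this[OF nz(2,3)] show ?thesis unfolding \<rho> .
    qed
    finally show ?thesis
      unfolding rec[OF n] x_def by (simp add: add.commute)
  qed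
  have \<rho>1: "\<rho> n \<ge> 1" if n: "n \<ge> 1" for n
  proof -
    define x where "x = real n"
    have x: "x \<ge> 1" using n by (simp add: x_def)
    define a b where "a = 4 * (x * (x + 1))" and "b = 4 * ((x + 1) * (x + c))"
    have ab: "a > 0" "b > 0" using x c0 by (simp_all add: a_def b_def)
    have key: "b + c * (c - 2) + a * (c * (c - 2)) \<ge> 0"
    proof (cases "c = 0")
      case True
      then show ?thesis using ab by simp
    next
      case False
      then have c1: "c \<ge> 1" using c by simp
      have "b + c * (c - 2) + a * (c * (c - 2)) = (a + 1) * (c - 1)\<^sup>2 + (4 * (c * (x + 1)) - 1)"
        by (simp add: a_def b_def power2_eq_square algebra_simps)
      moreover have "c * (x + 1) \<ge> 1 * 2" using c1 x by (intro mult_mono) auto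
      ultimately show ?thesis using ab by simp
    qed
    have "\<rho> n - 1 = (b + c * (c - 2) + a * (c * (c - 2))) / (a * b)"
      unfolding \<rho>_def x_def[symmetric] a_def[symmetric] b_def[symmetric] using ab by (simp add: field_simps)
    then show ?thesis using key ab by (smt (verit) divide_nonneg_pos mult_pos_pos)
  qed
  have \<rho>2: "\<rho> n \<le> exp ((1 + c\<^sup>2) / 4 * (1 / real n - 1 / real (Suc n)))" if n: "n \<ge> 1" for n
  proof -
    define x where "x = real n"
    have x: "x \<ge> 1" using n by (simp add: x_def)
    define u where "u = 1 / (4 * (x * (x + 1)))"
    have u: "u \<ge> 0" using x by (simp add: u_def)
    have "c * (c - 2) / (4 * ((x + 1) * (x + c))) \<le> c\<^sup>2 / (4 * ((x + 1) * (x + c)))"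
      using x c0 by (intro divide_right_mono) (auto simp: power2_eq_square algebra_simps)
    also have "\<dots> \<le> c\<^sup>2 / (4 * (x * (x + 1)))"
      using x c0 by (intro divide_left_mono mult_pos_pos) (auto simp: algebra_simps)
    also have "\<dots> = c\<^sup>2 * u" by (simp add: u_def)
    finally have "\<rho> n \<le> (1 + u) * (1 + c\<^sup>2 * u)"
      unfolding \<rho>_def x_def[symmetric] u_def[symmetric] using u by (intro mult_left_mono) auto
    also have "\<dots> \<le> exp u * exp (c\<^sup>2 * u)"
      using u by (intro mult_mono) (auto intro: add_nonneg_nonneg)
    also have "\<dots> = exp ((1 + c\<^sup>2) * u)" by (simp add: exp_add[symmetric] algebra_simps)
    also have "(1 + c\<^sup>2) * u = (1 + c\<^sup>2) / 4 * (1 / real n - 1 / real (Suc n))"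
      using x unfolding u_def x_def by (simp add: field_simps)
    finally show ?thesis .
  qed
  have both: "\<omega> 1 * real n \<le> \<omega> n \<and> \<omega> n \<le> \<omega> 1 * exp ((1 + c\<^sup>2) / 4 * (1 - 1 / real n)) * real n"
    using n
  proof (induction n rule: dec_induct)
    case base
    show ?case by simp
  next
    case (step n)
    have n1: "real n > 0" using step by simp
    define v where "v = \<omega> n / real n"
    have v: "\<omega> 1 \<le> v" "v \<le> \<omega> 1 * exp ((1 + c\<^sup>2) / 4 * (1 - 1 / real n))"
      using step.IH n1 by (simp_all add: v_def field_simps)
    have v0: "v \<ge> 0" using v pos by linarith
    have S: "\<omega> (Suc n) = v * \<rho> n * real (Suc n)"
      unfolding v_def using \<open>\<And>n. n \<ge> 1 \<Longrightarrow> \<omega> (Suc n) = \<omega> n / real n * \<rho> n * real (Suc n)\<close> step(1) by simp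
    have "\<omega> 1 * 1 \<le> v * \<rho> n"
      using v \<rho>1[of n] step(1) pos by (intro mult_mono) auto
    then have "\<omega> 1 * real (Suc n) \<le> \<omega> (Suc n)"
      unfolding S by (intro mult_right_mono) auto
    moreover have "v * \<rho> n \<le> (\<omega> 1 * exp ((1 + c\<^sup>2) / 4 * (1 - 1 / real n))) * exp ((1 + c\<^sup>2) / 4 * (1 / real n - 1 / real (Suc n)))"
      using v \<rho>2[of n] \<rho>1[of n] step(1) pos by (intro mult_mono) auto
    then have "v * \<rho> n \<le> \<omega> 1 * exp ((1 + c\<^sup>2) / 4 * (1 - 1 / real (Suc n)))"
      by (simp only: mult.assoc exp_add[symmetric] distrib_left[symmetric]) simp
    then have "\<omega> (Suc n) \<le> \<omega> 1 * exp ((1 + c\<^sup>2) / 4 * (1 - 1 / real (Suc n))) * real (Suc n)"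
      unfolding S by (intro mult_right_mono) auto
    ultimately show ?case by blast
  qed
  then show "\<omega> 1 * real n \<le> \<omega> n" by blast
  have "exp ((1 + c\<^sup>2) / 4 * (1 - 1 / real n)) \<le> exp ((1 + c\<^sup>2) / 4)"
    using n by (simp add: mult_left_le)
  then have "\<omega> 1 * exp ((1 + c\<^sup>2) / 4 * (1 - 1 / real n)) * real n \<le> \<omega> 1 * exp ((1 + c\<^sup>2) / 4) * real n"
    using pos by (intro mult_right_mono mult_left_mono) auto
  with both show "\<omega> n \<le> \<omega> 1 * exp ((1 + c\<^sup>2) / 4) * real n" by linarith
qed

lemma trial_harmonics_exist:
  fixes e :: "real ^ 'n"
  assumes d: "CARD('n) \<ge> 2" and e: "norm e = 1" and \<epsilon>: "\<epsilon> > 0"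
  defines "c \<equiv> real CARD('n) - 2"
  shows "\<exists>Y M. (\<forall>n. Y n \<in> spherical_harmonics n) \<and> (\<forall>n<K. Y n = (\<lambda>x. 0)) \<and> (\<forall>n\<ge>M. Y n = (\<lambda>x. 0)) \<and>
     (\<Sum>n<M. ip (Y n) (Y n)) - 2 * (\<Sum>n<M. tip e (Y n) (Y (Suc n)))
       < ((c - 1)\<^sup>2 / 8 + 2 * \<epsilon>) * (\<Sum>n<M. ip (Y n) (Y n) / (real n * (real n + c)))"
proof -
  have c: "c = 0 \<or> c \<ge> 1" "c \<ge> 0" using d unfolding c_def by (auto simp: le_Suc_eq numeral_eq_Suc)
  define Z where "Z = zonal e"
  define z where "z n = ip (Z n) (Z n)" for n
  define b where "b = trial_coeff c"
  define \<omega> where "\<omega> n = (b n)\<^sup>2 * z n" for n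
  have ZH: "Z n \<in> spherical_harmonics n" for n unfolding Z_def by (rule zonal_harmonic)
  have tipZ: "tip e (Z n) (Z (Suc n)) = z (Suc n)" for n
    using sint_zonal_Suc_square[OF d, of e n] by (simp add: tip_eq z_def ip_self Z_def del: zonal.simps)
  have zSuc: "z (Suc n) = jacobi_sq c n * z n" if "n \<ge> 1" for n
  proof -
    have "jacobi_sq c n = (real n + 1) * (real n + real CARD('n) - 2) / ((2 * real n + real CARD('n) - 2) * (2 * real n + real CARD('n)))"
      by (simp add: jacobi_sq_def c_def add_diff_eq)
    then show ?thesis
      using sint_linear_zonal[OF d e that] sint_zonal_Suc_square[OF d, of e n]
      by (simp add: z_def ip_self Z_def del: zonal.simps)
  qed
  have z0: "z 0 > 0"
  proof -
    have "z 0 \<noteq> 0"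
    proof
      assume "z 0 = 0"
      then have "sint (\<lambda>x :: real ^ 'n. (1 :: real)\<^sup>2) = 0" by (simp add: z_def ip_self Z_def)
      then show False using sint_square_zero[of "\<lambda>x :: real ^ 'n. 1" e] e by simp
    qed
    then show ?thesis using ip_nonneg[of "Z 0"] by (simp add: z_def less_le)
  qed
  have z1: "z 1 > 0"
  proof -
    have "z 1 = sint (\<lambda>x. (x \<bullet> e) * (zonal e 0 x * zonal e (Suc 0) x))"
      using sint_zonal_Suc_square[OF d, of e 0] by (simp add: z_def ip_self Z_def del: zonal.simps)
    also have "\<dots> = z 0 / real CARD('n)"
      unfolding sint_linear_harmonics_Suc[OF d zonal_harmonic zonal_harmonic] pd_zonal_Suc[OF d e]
      by (simp add: z_def ip_def Z_def)
    finally show ?thesis using z0 by simp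
  qed
  have \<omega>Suc: "\<omega> (Suc n) = \<omega> n * ((hweight n)\<^sup>2 / jacobi_sq c n)" if n: "n \<ge> 1" for n
    using n jacobi_sq_pos[OF c(2) n] unfolding \<omega>_def zSuc[OF n] b_def
    by (simp add: power2_eq_square)
  have \<omega>1: "\<omega> 1 > 0" using z1 by (simp add: \<omega>_def b_def)
  have pr: "hweight n * \<omega> n = hdual c (Suc n) * \<omega> (Suc n)" if n: "n \<ge> 1" for n
    using n jacobi_sq_pos[OF c(2) n] unfolding \<omega>Suc[OF n] hdual_def
    by (simp add: power2_eq_square hweight_def)
  have p: "0 \<le> hweight n \<and> hweight n \<le> 1" if "n \<ge> 1" for n
    using that by (simp add: hweight_def field_simps)
  have "\<exists>\<phi> M. (\<forall>n<max K 1. \<phi> n = 0) \<and> (\<forall>n\<ge>M. \<phi> n = 0) \<and>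
     (\<Sum>n<M. \<omega> n * (\<phi> n)\<^sup>2) - 2 * (\<Sum>n<M. hweight n * \<omega> n * (\<phi> n * \<phi> (Suc n)))
       < ((c - 1)\<^sup>2 / 8 + 2 * \<epsilon>) * (\<Sum>n<M. \<omega> n * (\<phi> n)\<^sup>2 / (real n * (real n + c)))"
    by (rule trial_sequence_exists[OF c(2) \<epsilon> pr p \<omega>1 _ hardy_gap_eventually[OF c(2) \<epsilon>]])
       (use weight_growth[OF c(1) \<omega>1 \<omega>Suc] in auto)
  then obtain \<phi> M where \<phi>: "\<And>n. n < max K 1 \<Longrightarrow> \<phi> n = 0" "\<And>n. n \<ge> M \<Longrightarrow> \<phi> n = 0"
    "(\<Sum>n<M. \<omega> n * (\<phi> n)\<^sup>2) - 2 * (\<Sum>n<M. hweight n * \<omega> n * (\<phi> n * \<phi> (Suc n)))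
       < ((c - 1)\<^sup>2 / 8 + 2 * \<epsilon>) * (\<Sum>n<M. \<omega> n * (\<phi> n)\<^sup>2 / (real n * (real n + c)))"
    by blast
  define Y where "Y n = (\<lambda>x. (\<phi> n * b n) * Z n x)" for n
  have ipY: "ip (Y n) (Y n) = \<omega> n * (\<phi> n)\<^sup>2" for n
    unfolding Y_def ip_cmult_left ip_cmult_right by (simp add: \<omega>_def z_def power2_eq_square)
  have tipY: "tip e (Y n) (Y (Suc n)) = hweight n * \<omega> n * (\<phi> n * \<phi> (Suc n))" for n
  proof (cases "n \<ge> 1")
    case True
    have "tip e (Y n) (Y (Suc n)) = \<phi> n * b n * (\<phi> (Suc n) * b (Suc n)) * (jacobi_sq c n * z n)"
      unfolding Y_def tip_cmult_left tip_cmult_right tipZ zSuc[OF True] by simp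
    also have "b (Suc n) = b n * hweight n / jacobi_sq c n" using True by (simp add: b_def)
    finally show ?thesis
      using jacobi_sq_pos[OF c(2) True] by (simp add: \<omega>_def power2_eq_square)
  next
    case False
    then have "\<phi> n = 0" using \<phi>(1)[of n] by simp
    then show ?thesis by (simp add: Y_def tip_def ip_def)
  qed
  have "Y n \<in> spherical_harmonics n" for n
    unfolding Y_def by (intro harmonic_cmult ZH)
  moreover have "Y n = (\<lambda>x. 0)" if "n < K \<or> n \<ge> M" for n
    using that \<phi>(1)[of n] \<phi>(2)[of n] by (auto simp: Y_def)
  ultimately show ?thesis
    using \<phi>(3) by (intro exI[of _ Y] exI[of _ M]) (simp add: ipY tipY)
qed

text \<open>
  In dimension three the hypothesis on \<open>C\<close> is void, so that no finite constant survives.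
\<close>

lemma hardy_inequality_real_sharp:
  fixes e :: "real ^ 'n"
  assumes d: "CARD('n) \<ge> 2" and e: "norm e = 1" and C: "C \<ge> 0" "C * ((real CARD('n) - 3)\<^sup>2 / 8) < 1"
  shows "\<exists>f g :: real ^ 'n \<Rightarrow> real. f \<in> L2_orth k \<and> is_frac_LB (1/2) f g \<and> C * weighted_integral g e < ip f f"
proof -
  define c where "c = real CARD('n) - 2"
  have c: "c \<ge> 0" using d by (simp add: c_def)
  define B where "B = (c - 1)\<^sup>2 / 8"
  have CB: "C * B < 1" using C(2) by (simp add: B_def c_def)
  \<comment> \<open>The loss allowed by the gap between \<open>C\<close> and the optimal constant \<open>1 / B\<close>.\<close>
  define \<epsilon> where "\<epsilon> = (1 - C * B) / (C + 1) / 2"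
  have \<epsilon>: "\<epsilon> > 0" using CB C by (simp add: \<epsilon>_def)
  have C\<epsilon>: "C * (B + 2 * \<epsilon>) \<le> 1"
  proof -
    have half: "2 * (u / 2) = u" for u :: real by simp
    have "C * (2 * \<epsilon>) = (C / (C + 1)) * (1 - C * B)"
      unfolding \<epsilon>_def half by (simp only: times_divide_eq_right times_divide_eq_left)
    also have "\<dots> \<le> 1 * (1 - C * B)" using C CB by (intro mult_right_mono) auto
    finally show ?thesis by (simp add: distrib_left)
  qed
  obtain Y M where Y: "\<And>n. Y n \<in> spherical_harmonics n" "\<And>n. n < Suc k \<Longrightarrow> Y n = (\<lambda>x. 0)" "\<And>n. n \<ge> M \<Longrightarrow> Y n = (\<lambda>x. 0)"
    and lt: "(\<Sum>n<M. ip (Y n) (Y n)) - 2 * (\<Sum>n<M. tip e (Y n) (Y (Suc n)))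
       < (B + 2 * \<epsilon>) * (\<Sum>n<M. ip (Y n) (Y n) / (real n * (real n + c)))"
    using trial_harmonics_exist[OF d e \<epsilon>, of "Suc k"] unfolding c_def[symmetric] B_def by blast
  define l where "l n = real n * (real n + real CARD('n) - 2)" for n
  have l: "l n > 0" if "n \<ge> 1" for n using that d by (simp add: l_def)
  define X where "X n = (\<lambda>x. l n powr (- 1 / 2) * Y n x)" for n
  have X: "X n \<in> spherical_harmonics n" for n unfolding X_def by (intro harmonic_cmult Y)
  define g where "g = (\<lambda>x. \<Sum>n\<le>M. Y n x)"
  define f where "f = (\<lambda>x. \<Sum>n\<le>M. X n x)"
  have gL: "g \<in> L2" and fL: "f \<in> L2"
    unfolding g_def f_def by (intro L2_sum L2_harmonic[OF Y(1)], intro L2_sum L2_harmonic[OF X])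
  have zero: "ip (\<lambda>x. 0) h = 0" "ip h (\<lambda>x. 0) = 0" for h :: "real ^ 'n \<Rightarrow> real" by (simp_all add: ip_def)
  have Wg: "weighted_integral g e = (\<Sum>n<M. ip (Y n) (Y n)) - 2 * (\<Sum>n<M. tip e (Y n) (Y (Suc n)))"
  proof -
    have "ip g g = (\<Sum>n\<le>M. ip (Y n) (Y n))"
      unfolding g_def by (rule ip_harmonic_sum[OF d Y(1)]) simp
    also have "\<dots> = (\<Sum>n<M. ip (Y n) (Y n))"
      by (simp add: lessThan_Suc_atMost[symmetric] Y(3)[of M] zero)
    finally show ?thesis
      unfolding weighted_integral_real[OF gL] unfolding g_def tip_harmonic_sum[OF d Y(1)] by simp
  qed
  have ipX: "ip (X n) (X n) = ip (Y n) (Y n) / (real n * (real n + c))" for n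
  proof (cases "n \<ge> 1")
    case True
    have "ip (X n) (X n) = (l n powr (- 1 / 2) * l n powr (- 1 / 2)) * ip (Y n) (Y n)"
      unfolding X_def ip_cmult_left ip_cmult_right by simp
    also have "l n powr (- 1 / 2) * l n powr (- 1 / 2) = 1 / l n"
      using l[OF True] by (simp add: powr_add[symmetric] powr_minus_divide)
    finally show ?thesis by (simp add: l_def c_def add_diff_eq)
  next
    case False
    then show ?thesis using Y(2)[of n] by (simp add: X_def zero)
  qed
  have ff: "ip f f = (\<Sum>n<M. ip (Y n) (Y n) / (real n * (real n + c)))"
  proof -
    have "ip f f = (\<Sum>n\<le>M. ip (X n) (X n))"
      unfolding f_def by (rule ip_harmonic_sum[OF d X]) simp
    also have "\<dots> = (\<Sum>n<M. ip (Y n) (Y n) / (real n * (real n + c)))"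
      unfolding ipX by (simp add: lessThan_Suc_atMost[symmetric] Y(3)[of M] zero)
    finally show ?thesis .
  qed
  have frac: "is_frac_LB (1/2) f g"
    unfolding is_frac_LB_def
  proof (intro conjI allI impI ballI gL)
    fix x :: "real ^ 'n"
    show "proj 0 g x = 0"
      unfolding g_def proj_harmonic_sum[OF d Y(1) finite_atMost] using Y(2)[of 0] by simp
    fix n :: nat assume n: "1 \<le> n"
    have "l n powr (1 / 2) * (l n powr (- 1 / 2) * y) = y" for y
      using l[OF n] by (simp add: mult.assoc[symmetric] powr_add[symmetric])
    then show "proj n g x = ((real n * (real n + real CARD('n) - 2)) powr (1 / 2)) *\<^sub>R proj n f x"
      unfolding g_def f_def proj_harmonic_sum[OF d Y(1) finite_atMost] proj_harmonic_sum[OF d X finite_atMost] l_def[symmetric]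
      by (simp add: X_def)
  qed
  have orth: "f \<in> L2_orth k"
    unfolding L2_orth_iff
  proof (intro conjI fL ballI)
    fix P :: "real ^ 'n \<Rightarrow> real" assume "P \<in> spherical_polys k"
    then obtain Q where Q: "\<And>m. hpoly m (Q m)" "\<And>x. P x = (\<Sum>m\<le>k. Q m x)"
      using spherical_polys_decompose by blast
    have QL: "Q m \<in> L2" for m by (intro L2_continuous hpoly_continuous_on[OF Q(1)])
    have PL: "P \<in> L2" unfolding Q(2)[abs_def] by (intro L2_sum QL)
    have "ip (X n) P = 0" for n
    proof (cases "n \<le> k")
      case True
      then show ?thesis using Y(2)[of n] by (simp add: X_def zero)
    next
      case False
      have "ip (Q m) (X n) = 0" if "m \<le> k" for m
        using sint_hpoly_harmonic[OF d Q(1) X, of m n] that False by (simp add: ip_def)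
      then have "ip P (X n) = 0"
        unfolding Q(2)[abs_def] by (simp add: ip_sum_left[OF QL L2_harmonic[OF X]])
      then show ?thesis by (simp add: ip_commute)
    qed
    then show "ip f P = 0"
      unfolding f_def by (simp add: ip_sum_left[OF L2_harmonic[OF X] PL])
  qed
  have "C * weighted_integral g e < ip f f"
  proof -
    have ff0: "ip f f \<ge> 0" by (rule ip_nonneg)
    have lt': "weighted_integral g e < (B + 2 * \<epsilon>) * ip f f" using lt unfolding Wg ff .
    show ?thesis
    proof (cases "C = 0")
      case True
      have "B + 2 * \<epsilon> > 0" using \<epsilon> by (simp add: B_def add_nonneg_pos)
      moreover have "0 < (B + 2 * \<epsilon>) * ip f f" using weighted_integral_nonneg[OF e, of g] lt' by linarith
      ultimately show ?thesis using True by (simp add: zero_less_mult_iff)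
    next
      case False
      then have "C * weighted_integral g e < C * ((B + 2 * \<epsilon>) * ip f f)"
        using lt' C by (intro mult_strict_left_mono) auto
      also have "\<dots> = (C * (B + 2 * \<epsilon>)) * ip f f" by simp
      also have "\<dots> \<le> 1 * ip f f" by (intro mult_right_mono C\<epsilon> ff0)
      finally show ?thesis by simp
    qed
  qed
  with orth frac show ?thesis by blast
qed

section \<open>Vector-valued functions\<close>

text \<open>
  All notions involved decompose into the coordinates of the values, which reduces the case of
  complex-valued functions on the circle to real-valued functions.
\<close>

lemma borel_measurable_sphere_inner:
  fixes f :: "real ^ 'n \<Rightarrow> 'b::euclidean_space"
  shows "f \<in> borel_measurable sphere_measure \<longleftrightarrow> (\<forall>b\<in>Basis. (\<lambda>x. f x \<bullet> b) \<in> borel_measurable sphere_measure)"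
  by (rule borel_measurable_euclidean_space)

lemma norm_square_Basis:
  fixes u :: "'b::euclidean_space"
  shows "(norm u)\<^sup>2 = (\<Sum>b\<in>Basis. (u \<bullet> b)\<^sup>2)"
  unfolding power2_norm_eq_inner by (subst euclidean_inner) (simp add: power2_eq_square)

lemma L2_components:
  fixes f :: "real ^ 'n \<Rightarrow> 'b::euclidean_space"
  shows "f \<in> L2 \<longleftrightarrow> (\<forall>b\<in>Basis. (\<lambda>x. f x \<bullet> b) \<in> L2)"
proof
  assume f: "f \<in> L2"
  show "\<forall>b\<in>Basis. (\<lambda>x. f x \<bullet> b) \<in> L2"
  proof
    fix b :: 'b assume b: "b \<in> Basis"
    have meas: "(\<lambda>x. f x \<bullet> b) \<in> borel_measurable sphere_measure"
      using f b borel_measurable_sphere_inner[of f] by (simp add: L2_def)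
    have "integrable sphere_measure (\<lambda>x. (f x \<bullet> b)\<^sup>2)"
    proof (rule Bochner_Integration.integrable_bound)
      show "integrable sphere_measure (\<lambda>x. (norm (f x))\<^sup>2)" using f by (simp add: L2_def)
      show "(\<lambda>x. (f x \<bullet> b)\<^sup>2) \<in> borel_measurable sphere_measure" using meas by simp
      have "(f x \<bullet> b)\<^sup>2 \<le> (norm (f x))\<^sup>2" for x
        using Basis_le_norm[OF b, of "f x"] power_mono[of "\<bar>f x \<bullet> b\<bar>" "norm (f x)" 2] by simp
      then show "AE x in sphere_measure. norm ((f x \<bullet> b)\<^sup>2) \<le> norm ((norm (f x))\<^sup>2)"
        by (intro AE_I2) simp
    qed
    with meas show "(\<lambda>x. f x \<bullet> b) \<in> L2" by (simp add: L2_real_iff)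
  qed
next
  assume f: "\<forall>b\<in>Basis. (\<lambda>x. f x \<bullet> b) \<in> L2"
  then have "f \<in> borel_measurable sphere_measure"
    using borel_measurable_sphere_inner[of f] by (simp add: L2_real_iff)
  moreover have "integrable sphere_measure (\<lambda>x. (norm (f x))\<^sup>2)"
    unfolding norm_square_Basis using f by (intro Bochner_Integration.integrable_sum) (simp add: L2_real_iff)
  ultimately show "f \<in> L2" by (simp add: L2_def)
qed

lemma sint_inner_components:
  fixes f g :: "real ^ 'n \<Rightarrow> 'b::euclidean_space"
  assumes "f \<in> L2" "g \<in> L2"
  shows "sint (\<lambda>x. f x \<bullet> g x) = (\<Sum>b\<in>Basis. ip (\<lambda>x. f x \<bullet> b) (\<lambda>x. g x \<bullet> b))"
  unfolding euclidean_inner[of "f _" "g _"] ip_def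
  using assms by (intro Bochner_Integration.integral_sum L2_integrable_mult) (simp_all add: L2_components[of f] L2_components[of g])

lemma sint_norm_square_components:
  fixes f :: "real ^ 'n \<Rightarrow> 'b::euclidean_space"
  assumes "f \<in> L2"
  shows "sint (\<lambda>x. (norm (f x))\<^sup>2) = (\<Sum>b\<in>Basis. ip (\<lambda>x. f x \<bullet> b) (\<lambda>x. f x \<bullet> b))"
  using sint_inner_components[OF assms assms] by (simp add: power2_norm_eq_inner)

lemma weighted_integral_components:
  fixes g :: "real ^ 'n \<Rightarrow> 'b::euclidean_space"
  assumes "g \<in> L2"
  shows "weighted_integral g e = (\<Sum>b\<in>Basis. weighted_integral (\<lambda>x. g x \<bullet> b) e)"
  unfolding weighted_integral_def norm_square_Basis[of "g _"] sum_distrib_left real_norm_def power2_abs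
  using assms by (intro Bochner_Integration.integral_sum integrable_weighted) (simp add: L2_components[of g])

lemma poly_funs_components:
  fixes P :: "real ^ 'n \<Rightarrow> 'b::euclidean_space"
  shows "P \<in> poly_funs A \<longleftrightarrow> (\<forall>b\<in>Basis. (\<lambda>x. P x \<bullet> b) \<in> poly_funs A)"
proof
  assume "P \<in> poly_funs A"
  then obtain c where c: "P = (\<lambda>x. \<Sum>\<alpha>\<in>A. (\<Prod>i\<in>UNIV. x $ i ^ \<alpha> i) *\<^sub>R c \<alpha>)"
    unfolding poly_funs_def by auto
  show "\<forall>b\<in>Basis. (\<lambda>x. P x \<bullet> b) \<in> poly_funs A"
  proof
    fix b :: 'b
    show "(\<lambda>x. P x \<bullet> b) \<in> poly_funs A"
      unfolding c poly_funs_def by (intro CollectI exI[of _ "\<lambda>\<alpha>. c \<alpha> \<bullet> b"]) (simp add: inner_sum_left)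
  qed
next
  assume "\<forall>b\<in>Basis. (\<lambda>x. P x \<bullet> b) \<in> poly_funs A"
  then have "\<forall>b\<in>Basis. \<exists>c :: _ \<Rightarrow> real. (\<lambda>x. P x \<bullet> b) = (\<lambda>x. \<Sum>\<alpha>\<in>A. (\<Prod>i\<in>UNIV. x $ i ^ \<alpha> i) *\<^sub>R c \<alpha>)"
    unfolding poly_funs_def by auto
  then obtain c :: "'b \<Rightarrow> _ \<Rightarrow> real" where
    c: "\<And>b. b \<in> Basis \<Longrightarrow> (\<lambda>x. P x \<bullet> b) = (\<lambda>x. \<Sum>\<alpha>\<in>A. (\<Prod>i\<in>UNIV. x $ i ^ \<alpha> i) *\<^sub>R c b \<alpha>)"
    by (auto simp: bchoice_iff)
  have "P = (\<lambda>x. \<Sum>\<alpha>\<in>A. (\<Prod>i\<in>UNIV. x $ i ^ \<alpha> i) *\<^sub>R (\<Sum>b\<in>Basis. c b \<alpha> *\<^sub>R b))"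
  proof
    fix x
    have "P x = (\<Sum>b\<in>Basis. (P x \<bullet> b) *\<^sub>R b)" by (rule euclidean_representation[symmetric])
    also have "\<dots> = (\<Sum>b\<in>Basis. (\<Sum>\<alpha>\<in>A. (\<Prod>i\<in>UNIV. x $ i ^ \<alpha> i) *\<^sub>R c b \<alpha>) *\<^sub>R b)"
      using fun_cong[OF c] by (intro sum.cong refl) (simp only:)
    also have "\<dots> = (\<Sum>b\<in>Basis. \<Sum>\<alpha>\<in>A. (\<Prod>i\<in>UNIV. x $ i ^ \<alpha> i) *\<^sub>R (c b \<alpha> *\<^sub>R b))"
      by (simp add: scaleR_sum_left)
    also have "\<dots> = (\<Sum>\<alpha>\<in>A. \<Sum>b\<in>Basis. (\<Prod>i\<in>UNIV. x $ i ^ \<alpha> i) *\<^sub>R (c b \<alpha> *\<^sub>R b))"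
      by (rule sum.swap)
    finally show "P x = (\<Sum>\<alpha>\<in>A. (\<Prod>i\<in>UNIV. x $ i ^ \<alpha> i) *\<^sub>R (\<Sum>b\<in>Basis. c b \<alpha> *\<^sub>R b))"
      by (simp only: scaleR_sum_right)
  qed
  then show "P \<in> poly_funs A"
    unfolding poly_funs_def mem_Collect_eq
    by (rule exI[where x = "\<lambda>\<alpha>. \<Sum>b\<in>Basis. c b \<alpha> *\<^sub>R b"])
qed

lemma pd_sum_scaleR:
  fixes P :: "'b::euclidean_space \<Rightarrow> real ^ 'n \<Rightarrow> real"
  assumes "\<And>b. b \<in> Basis \<Longrightarrow> P b differentiable (at x)"
  shows "pd v (\<lambda>x. \<Sum>b\<in>Basis. P b x *\<^sub>R b) x = (\<Sum>b\<in>Basis. pd v (P b) x *\<^sub>R b)"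
proof -
  have "\<forall>b\<in>Basis. \<exists>P'. (P b has_derivative P') (at x)"
    using assms by (auto simp: differentiable_def)
  then obtain P' where P': "\<And>b. b \<in> Basis \<Longrightarrow> (P b has_derivative P' b) (at x)"
    by (auto simp: bchoice_iff)
  have "((\<lambda>x. \<Sum>b\<in>Basis. P b x *\<^sub>R b) has_derivative (\<lambda>h. \<Sum>b\<in>Basis. P' b h *\<^sub>R b)) (at x)"
    by (intro has_derivative_sum has_derivative_scaleR_left P')
  then have "pd v (\<lambda>x. \<Sum>b\<in>Basis. P b x *\<^sub>R b) x = (\<Sum>b\<in>Basis. P' b v *\<^sub>R b)"
    by (rule pd_eq)
  also have "\<dots> = (\<Sum>b\<in>Basis. pd v (P b) x *\<^sub>R b)"
    by (intro sum.cong refl) (simp only: pd_eq[OF P'])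
  finally show ?thesis .
qed

lemma laplacian_component:
  fixes Y :: "real ^ 'n \<Rightarrow> 'b::euclidean_space"
  assumes Y: "\<And>b. b \<in> Basis \<Longrightarrow> hpoly n (\<lambda>x. Y x \<bullet> b)" and b: "b \<in> Basis"
  shows "laplacian Y x \<bullet> b = laplacian (\<lambda>x. Y x \<bullet> b) x"
proof -
  define P where "P b = (\<lambda>x. Y x \<bullet> b)" for b
  have hP: "hpoly n (P b)" if "b \<in> Basis" for b using Y[OF that] by (simp add: P_def)
  have Yeq: "Y = (\<lambda>x. \<Sum>b\<in>Basis. P b x *\<^sub>R b)"
    by (simp add: P_def euclidean_representation)
  have "pd v Y = (\<lambda>x. \<Sum>b\<in>Basis. pd v (P b) x *\<^sub>R b)" for v
    unfolding Yeq by (intro ext pd_sum_scaleR hpoly_differentiable[OF hP])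
  then have "pd v (pd v Y) x = (\<Sum>b\<in>Basis. pd v (pd v (P b)) x *\<^sub>R b)" for v
    by (simp only:) (intro pd_sum_scaleR hpoly_differentiable[OF pd_hpoly(1)[OF hP]])
  then have "pd v (pd v Y) x \<bullet> b = pd v (pd v (P b)) x" for v
    using b by (simp only: inner_sum_left inner_scaleR_left) (simp add: inner_Basis if_distrib cong: if_cong)
  then show ?thesis
    by (simp only: laplacian_eq_sum_pd inner_sum_left P_def)
qed

lemma spherical_harmonics_components:
  fixes Y :: "real ^ 'n \<Rightarrow> 'b::euclidean_space"
  shows "Y \<in> spherical_harmonics n \<longleftrightarrow> (\<forall>b\<in>Basis. (\<lambda>x. Y x \<bullet> b) \<in> spherical_harmonics n)"
proof (cases "\<forall>b\<in>Basis. hpoly n (\<lambda>x. Y x \<bullet> b)")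
  case True
  have poly: "Y \<in> poly_funs {\<alpha>. (\<Sum>i\<in>UNIV. \<alpha> i) = n}"
    using True unfolding poly_funs_components[of Y] by (simp add: poly_funs_homogeneous)
  have "(\<forall>x. laplacian Y x = 0) \<longleftrightarrow> (\<forall>b\<in>Basis. \<forall>x. laplacian (\<lambda>x. Y x \<bullet> b) x = 0)"
  proof -
    have "laplacian Y x = 0 \<longleftrightarrow> (\<forall>b\<in>Basis. laplacian (\<lambda>x. Y x \<bullet> b) x = 0)" for x
    proof -
      have "laplacian Y x \<bullet> b = laplacian (\<lambda>x. Y x \<bullet> b) x" if "b \<in> Basis" for b
        by (rule laplacian_component[OF _ that, of n]) (use True in blast)
      then show ?thesis by (subst euclidean_eq_iff) simp
    qed
    then show ?thesis by blast
  qed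
  with poly True show ?thesis
    unfolding spherical_harmonics_iff by (simp add: spherical_harmonics_def)
next
  case False
  have "Y \<notin> poly_funs {\<alpha>. (\<Sum>i\<in>UNIV. \<alpha> i) = n}"
    using False unfolding poly_funs_components[of Y] by (simp add: poly_funs_homogeneous)
  with False show ?thesis
    unfolding spherical_harmonics_iff by (auto simp: spherical_harmonics_def)
qed

lemma L2_harmonic_vector:
  fixes Y :: "real ^ 'n \<Rightarrow> 'b::euclidean_space"
  shows "Y \<in> spherical_harmonics n \<Longrightarrow> Y \<in> L2"
  using L2_harmonic unfolding spherical_harmonics_components[of Y] L2_components[of Y] by blast

lemma L2_diff_vector:
  fixes f g :: "real ^ 'n \<Rightarrow> 'b::euclidean_space"
  shows "f \<in> L2 \<Longrightarrow> g \<in> L2 \<Longrightarrow> (\<lambda>x. f x - g x) \<in> L2"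
  using L2_diff unfolding L2_components[of f] L2_components[of g] L2_components[of "\<lambda>x. f x - g x"] inner_diff_left
  by blast

text \<open>
  The projection is defined by a unique description, so both existence and uniqueness are transferred
  from the coordinates; uniqueness uses test functions with a single nonzero coordinate.
\<close>

lemma proj_component:
  fixes f :: "real ^ 'n \<Rightarrow> 'b::euclidean_space"
  assumes f: "f \<in> L2" and b: "b \<in> Basis"
  shows "proj n f x \<bullet> b = proj n (\<lambda>x. f x \<bullet> b) x"
proof -
  define h where "h x = (\<Sum>b\<in>Basis. proj n (\<lambda>x. f x \<bullet> b) x *\<^sub>R b)" for x
  have fb: "(\<lambda>x. f x \<bullet> b) \<in> L2" if "b \<in> Basis" for b
    using f that by (simp add: L2_components[of f])
  have hb: "(\<lambda>x. h x \<bullet> b) = proj n (\<lambda>x. f x \<bullet> b)" if "b \<in> Basis" for b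
    using that by (simp add: h_def fun_eq_iff inner_sum_left inner_Basis if_distrib cong: if_cong)
  have h: "h \<in> spherical_harmonics n"
    using hb proj_real(1)[OF fb] by (simp add: spherical_harmonics_components[of h])
  have "proj n f = h"
    unfolding proj_def
  proof (rule the_equality)
    have "sint (\<lambda>x. (f x - h x) \<bullet> Y x) = 0" if Y: "Y \<in> spherical_harmonics n" for Y
    proof -
      have "ip (\<lambda>x. (f x - h x) \<bullet> b) (\<lambda>x. Y x \<bullet> b) = 0" if "b \<in> Basis" for b
        using proj_real(2)[OF fb[OF that], of "\<lambda>x. Y x \<bullet> b" n] Y that fun_cong[OF hb[OF that]]
        by (simp add: inner_diff_left spherical_harmonics_components[of Y])
      then show ?thesis
        by (subst sint_inner_components[OF L2_diff_vector[OF f L2_harmonic_vector[OF h]] L2_harmonic_vector[OF Y]]) simp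
    qed
    with h show "h \<in> spherical_harmonics n \<and> (\<forall>Y\<in>spherical_harmonics n. sint (\<lambda>x. (f x - h x) \<bullet> Y x) = 0)"
      by blast
  next
    fix g assume "g \<in> spherical_harmonics n \<and> (\<forall>Y\<in>spherical_harmonics n. sint (\<lambda>x. (f x - g x) \<bullet> Y x) = 0)"
    then have g: "g \<in> spherical_harmonics n" and orth: "\<And>Y. Y \<in> spherical_harmonics n \<Longrightarrow> sint (\<lambda>x. (f x - g x) \<bullet> Y x) = 0"
      by auto
    have "proj n (\<lambda>x. f x \<bullet> b) = (\<lambda>x. g x \<bullet> b)" if b: "b \<in> Basis" for b
    proof (rule proj_eqI[OF fb[OF b]])
      show "(\<lambda>x. g x \<bullet> b) \<in> spherical_harmonics n"
        using g b by (simp add: spherical_harmonics_components[of g])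
      fix Z :: "real ^ 'n \<Rightarrow> real" assume Z: "Z \<in> spherical_harmonics n"
      have "(\<lambda>x. Z x *\<^sub>R b) \<in> spherical_harmonics n"
        using Z harmonic_zero b
        by (auto simp: spherical_harmonics_components[of "\<lambda>x. Z x *\<^sub>R b"] inner_Basis)
      from orth[OF this] show "ip (\<lambda>x. f x \<bullet> b - g x \<bullet> b) Z = 0"
        by (simp add: ip_def inner_diff_left mult.commute)
    qed
    then have "g x \<bullet> b = h x \<bullet> b" if "b \<in> Basis" for x b
      using fun_cong[OF hb[OF that], of x] that by simp
    then show "g = h" by (rule ext[OF euclidean_eqI])
  qed
  then show ?thesis using fun_cong[OF hb[OF b]] by simp
qed

lemma is_frac_LB_components:
  fixes f g :: "real ^ 'n \<Rightarrow> 'b::euclidean_space"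
  assumes f: "f \<in> L2"
  shows "is_frac_LB s f g \<longleftrightarrow> (\<forall>b\<in>Basis. is_frac_LB s (\<lambda>x. f x \<bullet> b) (\<lambda>x. g x \<bullet> b))"
proof (cases "g \<in> L2")
  case True
  note pc = proj_component[OF True, symmetric] proj_component[OF f, symmetric]
  have gb: "(\<lambda>x. g x \<bullet> b) \<in> L2" if "b \<in> Basis" for b using True that by (simp add: L2_components[of g])
  have zero: "proj 0 g x = 0 \<longleftrightarrow> (\<forall>b\<in>Basis. proj 0 (\<lambda>x. g x \<bullet> b) x = 0)" for x
    by (subst euclidean_eq_iff) (simp add: pc)
  have eq: "proj n g x = l *\<^sub>R proj n f x \<longleftrightarrow> (\<forall>b\<in>Basis. proj n (\<lambda>x. g x \<bullet> b) x = l *\<^sub>R proj n (\<lambda>x. f x \<bullet> b) x)" for n x l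
    by (subst euclidean_eq_iff) (simp add: pc)
  show ?thesis
    unfolding is_frac_LB_def zero eq using True gb by blast
next
  case False
  then show ?thesis unfolding is_frac_LB_def L2_components[of g] by blast
qed

lemma L2_orth_components:
  fixes f :: "real ^ 'n \<Rightarrow> 'b::euclidean_space"
  shows "f \<in> L2_orth k \<longleftrightarrow> (\<forall>b\<in>Basis. (\<lambda>x. f x \<bullet> b) \<in> L2_orth k)"
proof (cases "f \<in> L2")
  case True
  have fb: "(\<lambda>x. f x \<bullet> b) \<in> L2" if "b \<in> Basis" for b
    using True that by (simp add: L2_components[of f])
  have comp: "sint (\<lambda>x. P x *\<^sub>R f x) \<bullet> b = ip (\<lambda>x. f x \<bullet> b) P"
    if P: "P \<in> spherical_polys k" and b: "b \<in> Basis" for P :: "real ^ 'n \<Rightarrow> real" and b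
  proof -
    obtain Q where Q: "\<And>m. hpoly m (Q m)" "\<And>x. P x = (\<Sum>m\<le>k. Q m x)"
      using spherical_polys_decompose[OF P] by blast
    have PL: "P \<in> L2"
      unfolding Q(2)[abs_def] by (intro L2_sum L2_continuous hpoly_continuous_on[OF Q(1)])
    have "integrable sphere_measure (\<lambda>x. \<Sum>c\<in>Basis. (P x * (f x \<bullet> c)) *\<^sub>R c)"
      by (intro Bochner_Integration.integrable_sum integrable_scaleR_left L2_integrable_mult PL fb)
    moreover have "(\<Sum>c\<in>Basis. (P x * (f x \<bullet> c)) *\<^sub>R c) = P x *\<^sub>R f x" for x
      using euclidean_representation[of "P x *\<^sub>R f x"] by simp
    ultimately have "integrable sphere_measure (\<lambda>x. P x *\<^sub>R f x)" by simp
    from integral_inner_left[OF this, of b] show ?thesis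
      by (simp add: ip_def mult.commute)
  qed
  have "sint (\<lambda>x. P x *\<^sub>R f x) = 0 \<longleftrightarrow> (\<forall>b\<in>Basis. ip (\<lambda>x. f x \<bullet> b) P = 0)"
    if "P \<in> spherical_polys k" for P :: "real ^ 'n \<Rightarrow> real"
    using comp[OF that] by (subst euclidean_eq_iff) simp
  then show ?thesis
    unfolding L2_orth_iff using True fb unfolding L2_orth_def by blast
next
  case False
  then have "\<not> (\<forall>b\<in>Basis. (\<lambda>x. f x \<bullet> b) \<in> L2)" by (simp add: L2_components[of f])
  with False show ?thesis unfolding L2_orth_iff unfolding L2_orth_def by blast
qed

text \<open>
  Completeness of the spherical harmonics: the projections determine \<open>(-\<Delta>\<^sub>0)\<^sup>s f\<close> up to a null set, and null
  sets do not affect the weighted integral.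
\<close>

lemma frac_LB_unique:
  fixes f g g' :: "real ^ 'n \<Rightarrow> real"
  assumes d: "CARD('n) \<ge> 2" and g: "is_frac_LB s f g" and g': "is_frac_LB s f g'"
  shows "weighted_integral g e = weighted_integral g' e"
proof -
  have L: "g \<in> L2" "g' \<in> L2" using g g' by (auto simp: is_frac_LB_def)
  have same: "proj n g = proj n g'" for n
  proof (rule harmonic_eqI[OF proj_real(1)[OF L(1)] proj_real(1)[OF L(2)]])
    fix x :: "real ^ 'n" assume "x \<in> sphere 0 1"
    then show "proj n g x = proj n g' x"
      using g g' by (cases "n = 0") (simp_all add: is_frac_LB_def)
  qed
  define h where "h = (\<lambda>x. g x - g' x)"
  have hL: "h \<in> L2" unfolding h_def by (rule L2_diff[OF L])
  have "proj n h = (\<lambda>x. 0)" for n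
  proof (rule proj_eqI[OF hL harmonic_zero])
    fix Y :: "real ^ 'n \<Rightarrow> real" assume Y: "Y \<in> spherical_harmonics n"
    have "ip h Y = ip g Y - ip g' Y" unfolding h_def by (rule ip_diff_left[OF L L2_harmonic[OF Y]])
    also have "\<dots> = 0" unfolding ip_proj[OF L(1) Y, symmetric] ip_proj[OF L(2) Y, symmetric] same by simp
    finally show "ip (\<lambda>x. h x - 0) Y = 0" by simp
  qed
  then have "(\<lambda>N. \<Sum>n\<le>N. 0 :: real) \<longlonglongrightarrow> ip h h"
    using parseval[OF d hL] by (simp add: ip_def)
  then have "ip h h = 0" by (simp add: LIMSEQ_const_iff)
  from ip_self_zero(1)[OF hL this] have ae: "AE x in sphere_measure. g x = g' x"
    by (simp add: h_def)
  have meas: "(\<lambda>x. (1 - x \<bullet> e) * (norm (u x))\<^sup>2) \<in> borel_measurable sphere_measure" if "u \<in> L2" for u :: "real ^ 'n \<Rightarrow> real"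
    using integrable_weighted[OF that, of e] by (simp add: borel_measurable_integrable)
  show ?thesis
    unfolding weighted_integral_def
    by (rule integral_cong_AE[OF meas[OF L(1)] meas[OF L(2)]]) (use ae in eventually_elim, simp)
qed

section \<open>The inequality and its optimality\<close>

lemma frac_LB_is_frac_LB:
  assumes "f \<in> W21"
  shows "is_frac_LB (1/2) f (frac_LB (1/2) f)"
proof -
  have "\<exists>g. is_frac_LB (1/2) f g" using assms by (simp add: W21_def)
  then show ?thesis unfolding frac_LB_def by (rule someI_ex)
qed

lemma ineq_holds_on_hardy:
  assumes d: "CARD('n) \<ge> 2" "CARD('n) \<noteq> 3"
    and cond: "\<And>n. n > k \<Longrightarrow> hardy_condition (real CARD('n) - 2) n"
  shows "ineq_holds_on (L2_orth k \<inter> W21 :: (real ^ 'n \<Rightarrow> 'b::euclidean_space) set) (8 / (real CARD('n) - 3)\<^sup>2)"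
  unfolding ineq_holds_on_def
proof
  fix f :: "real ^ 'n \<Rightarrow> 'b" assume f: "f \<in> L2_orth k \<inter> W21"
  define g where "g = frac_LB (1/2) f"
  have fL: "f \<in> L2" using f by (simp add: W21_def)
  have fg: "is_frac_LB (1/2) f g" unfolding g_def using f by (intro frac_LB_is_frac_LB) simp
  then have gL: "g \<in> L2" by (simp add: is_frac_LB_def)
  obtain e where e: "e \<in> sphere 0 1" "weighted_integral g e = (INF e \<in> sphere 0 1. weighted_integral g e)"
    using weighted_integral_attains_min[OF gL] by blast
  have "(real CARD('n) - 3)\<^sup>2 / 8 * ip (\<lambda>x. f x \<bullet> b) (\<lambda>x. f x \<bullet> b) \<le> weighted_integral (\<lambda>x. g x \<bullet> b) e"
    if b: "b \<in> Basis" for b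
  proof (rule hardy_inequality_real[OF d(1) _ _ _ cond])
    show "(\<lambda>x. f x \<bullet> b) \<in> L2_orth k" using f b by (simp add: L2_orth_components[of f])
    show "is_frac_LB (1/2) (\<lambda>x. f x \<bullet> b) (\<lambda>x. g x \<bullet> b)"
      using fg b by (simp add: is_frac_LB_components[OF fL])
    show "norm e = 1" using e(1) by simp
  qed
  then have "(real CARD('n) - 3)\<^sup>2 / 8 * sint (\<lambda>x. (norm (f x))\<^sup>2) \<le> weighted_integral g e"
    unfolding sint_norm_square_components[OF fL] weighted_integral_components[OF gL] sum_distrib_left
    by (rule sum_mono)
  moreover have "(real CARD('n) - 3)\<^sup>2 > 0"
    using d(2) by (simp add: of_nat_eq_iff[of "CARD('n)" 3, where 'a = real, simplified])
  ultimately have "sint (\<lambda>x. (norm (f x))\<^sup>2) \<le> 8 / (real CARD('n) - 3)\<^sup>2 * weighted_integral g e"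
    by (simp add: field_simps)
  then show "sint (\<lambda>x. (norm (f x))\<^sup>2) \<le> 8 / (real CARD('n) - 3)\<^sup>2 * (INF e \<in> sphere 0 1. weighted_integral (frac_LB (1/2) f) e)"
    using e(2) by (simp add: g_def)
qed

text \<open>
  The scalar trial function is placed in one coordinate. A negative \<open>C\<close> may be replaced by \<open>0\<close>, since the
  right-hand side of the inequality is monotone in \<open>C\<close>.
\<close>

lemma not_ineq_holds_on:
  assumes d: "CARD('n) \<ge> 2" and C: "C * ((real CARD('n) - 3)\<^sup>2 / 8) < 1"
  shows "\<not> ineq_holds_on (L2_orth k \<inter> W21 :: (real ^ 'n \<Rightarrow> 'b::euclidean_space) set) C"
proof
  assume ineq: "ineq_holds_on (L2_orth k \<inter> W21 :: (real ^ 'n \<Rightarrow> 'b) set) C"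
  define C' where "C' = max C 0"
  have C': "C' \<ge> 0" "C' * ((real CARD('n) - 3)\<^sup>2 / 8) < 1" "C \<le> C'"
    using C by (auto simp: C'_def max_def)
  define e :: "real ^ 'n" where "e = axis undefined 1"
  have e: "norm e = 1" by (simp add: e_def)
  obtain f0 g0 :: "real ^ 'n \<Rightarrow> real" where f0: "f0 \<in> L2_orth k" and fg0: "is_frac_LB (1/2) f0 g0"
    and lt: "C' * weighted_integral g0 e < ip f0 f0"
    using hardy_inequality_real_sharp[OF d e C'(1,2), of k] by blast
  obtain b0 :: 'b where b0: "b0 \<in> Basis" using nonempty_Basis by blast
  define f where "f = (\<lambda>x. f0 x *\<^sub>R b0)"
  define g where "g = (\<lambda>x. g0 x *\<^sub>R b0)"
  have fb: "(\<lambda>x. f x \<bullet> b) = (if b = b0 then f0 else (\<lambda>x. 0))"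
    and gb: "(\<lambda>x. g x \<bullet> b) = (if b = b0 then g0 else (\<lambda>x. 0))" if "b \<in> Basis" for b
    using that b0 by (auto simp: f_def g_def inner_Basis)
  have proj0: "proj n (\<lambda>x :: real ^ 'n. 0 :: real) = (\<lambda>x. 0)" for n
    by (intro proj_eqI L2_zero harmonic_zero) (simp add: ip_def)
  have zero_orth: "(\<lambda>x :: real ^ 'n. 0 :: real) \<in> L2_orth k"
    by (simp add: L2_orth_iff L2_zero ip_def)
  have zero_frac: "is_frac_LB (1/2) (\<lambda>x :: real ^ 'n. 0 :: real) (\<lambda>x. 0)"
    by (simp add: is_frac_LB_def L2_zero proj0)
  have f_orth: "f \<in> L2_orth k"
    using f0 zero_orth by (simp add: L2_orth_components[of f] fb)
  have fL: "f \<in> L2" using f_orth by (simp add: L2_orth_def)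
  have fg: "is_frac_LB (1/2) f g"
    using fg0 zero_frac by (simp add: is_frac_LB_components[OF fL] fb gb)
  then have fW: "f \<in> W21" using fL by (auto simp: W21_def)
  define g' where "g' = frac_LB (1/2) f"
  have fg': "is_frac_LB (1/2) f g'" unfolding g'_def by (rule frac_LB_is_frac_LB[OF fW])
  have L: "g \<in> L2" "g' \<in> L2" using fg fg' by (auto simp: is_frac_LB_def)
  have W: "weighted_integral g' e = weighted_integral g0 e"
  proof -
    have "weighted_integral g' e = (\<Sum>b\<in>Basis. weighted_integral (\<lambda>x. g x \<bullet> b) e)"
      unfolding weighted_integral_components[OF L(2)]
      using fg fg' by (intro sum.cong refl frac_LB_unique[OF d]) (auto simp: is_frac_LB_components[OF fL])
    also have "\<dots> = (\<Sum>b\<in>Basis. if b = b0 then weighted_integral g0 e else 0)"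
      by (intro sum.cong refl) (simp add: gb weighted_integral_def)
    also have "\<dots> = weighted_integral g0 e" using b0 by simp
    finally show ?thesis .
  qed
  have norm_f: "sint (\<lambda>x. (norm (f x))\<^sup>2) = ip f0 f0"
  proof -
    have "norm b0 = 1" using b0 by simp
    then show ?thesis by (simp add: f_def ip_self)
  qed
  define I where "I = (INF e \<in> sphere 0 1. weighted_integral g' e)"
  have I0: "I \<ge> 0"
    unfolding I_def by (rule cINF_greatest) (auto intro: weighted_integral_nonneg)
  have I: "I \<le> weighted_integral g' e"
    unfolding I_def using e by (intro cINF_lower bdd_belowI2[of _ 0]) (auto intro: weighted_integral_nonneg)
  have "ip f0 f0 \<le> C * I"
    using ineq f_orth fW unfolding ineq_holds_on_def norm_f[symmetric] I_def g'_def by blast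
  also have "\<dots> \<le> C' * I" using C'(3) I0 by (rule mult_right_mono)
  also have "\<dots> \<le> C' * weighted_integral g' e" using I C'(1) by (rule mult_left_mono)
  also have "\<dots> < ip f0 f0" using lt W by simp
  finally show False by simp
qed

lemma optimal_constant_hardy:
  assumes d: "CARD('n) \<ge> 2" "CARD('n) \<noteq> 3"
    and cond: "\<And>n. n > k \<Longrightarrow> hardy_condition (real CARD('n) - 2) n"
  shows "optimal_constant (L2_orth k \<inter> W21 :: (real ^ 'n \<Rightarrow> 'b::euclidean_space) set) (8 / (real CARD('n) - 3)\<^sup>2)"
  unfolding optimal_constant_def
proof (intro conjI allI impI ineq_holds_on_hardy[OF d cond])
  fix C :: real assume C: "C < 8 / (real CARD('n) - 3)\<^sup>2"
  have "(real CARD('n) - 3)\<^sup>2 > 0"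
    using d(2) by (simp add: of_nat_eq_iff[of "CARD('n)" 3, where 'a = real, simplified])
  with C have "C * ((real CARD('n) - 3)\<^sup>2 / 8) < 1" by (simp add: field_simps)
  then show "\<not> ineq_holds_on (L2_orth k \<inter> W21 :: (real ^ 'n \<Rightarrow> 'b) set) C"
    by (rule not_ineq_holds_on[OF d(1)])
qed

text \<open>
  For \<open>c = d - 2 \<ge> 4\<close> the bound \<open>3 c\<^sup>3 / 16\<close> exceeds \<open>c\<^sup>2 / 2 + 1\<close>, because \<open>3 c\<^sup>3 / 16 \<ge> 3 c\<^sup>2 / 4\<close> and \<open>c\<^sup>2 / 4 \<ge> 4\<close>. In
  dimensions four and five there is no restriction on the degree.
\<close>

lemma degree_bound_exists:
  assumes d: "d \<ge> 4"
  shows "\<exists>k::nat. real k \<le> 3 * (real d - 2) ^ 3 / 16 \<and> (\<forall>n>k. hardy_condition (real d - 2) n)"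
proof (cases "d \<le> 5")
  case True
  then have "d = 4 \<or> d = 5" using d by auto
  then show ?thesis
    using hardy_condition_small by (intro exI[of _ 0]) auto
next
  case False
  define c where "c = real d - 2"
  have c: "c \<ge> 4" using False by (simp add: c_def)
  define k where "k = nat \<lfloor>3 * c ^ 3 / 16\<rfloor>"
  have pos: "3 * c ^ 3 / 16 \<ge> 0" using c by simp
  have k: "real k \<le> 3 * c ^ 3 / 16" unfolding k_def using pos by linarith
  have "hardy_condition c n" if n: "n > k" for n
  proof (rule hardy_condition_large)
    have "3 * c ^ 3 / 16 < real n" using n pos unfolding k_def by linarith
    moreover have "c ^ 3 \<ge> 4 * c\<^sup>2" using c by (simp add: power3_eq_cube power2_eq_square)
    moreover have "c\<^sup>2 \<ge> 4 * 4" unfolding power2_eq_square using c by (intro mult_mono) auto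
    ultimately show "c\<^sup>2 / 2 + 1 \<le> real n" by linarith
  qed (use c in simp)
  with k show ?thesis unfolding c_def by blast
qed

theorem theorem3p8:
  shows
    "(CARD('n::finite) \<ge> 4 \<longrightarrow>
        (\<exists>k::nat. real k \<le> 3 * (real CARD('n) - 2) ^ 3 / 16 \<and>
           optimal_constant (L2_orth k \<inter> W21 :: (real ^ 'n \<Rightarrow> real) set)
             (8 / (real CARD('n) - 3)\<^sup>2)))
   \<and> (CARD('n) = 2 \<longrightarrow>
        optimal_constant (L2_orth 0 \<inter> W21 :: (real ^ 'n \<Rightarrow> complex) set)
          (8 / (real CARD('n) - 3)\<^sup>2)
      \<and> optimal_constant (L2_orth 0 \<inter> W21 :: (real ^ 'n \<Rightarrow> real) set)
          (8 / (real CARD('n) - 3)\<^sup>2))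
   \<and> (CARD('n) = 4 \<or> CARD('n) = 5 \<longrightarrow>
        optimal_constant (L2_orth 0 \<inter> W21 :: (real ^ 'n \<Rightarrow> real) set)
          (8 / (real CARD('n) - 3)\<^sup>2))
   \<and> (CARD('n) = 6 \<longrightarrow>
        optimal_constant (L2_orth 4 \<inter> W21 :: (real ^ 'n \<Rightarrow> real) set)
          (8 / (real CARD('n) - 3)\<^sup>2))
   \<and> (CARD('n) = 3 \<longrightarrow>
        \<not> (\<exists>C::real. ineq_holds_on (L2_orth 0 \<inter> W21 :: (real ^ 'n \<Rightarrow> real) set) C))"
proof (intro conjI impI)
  assume d: "CARD('n) \<ge> 4"
  then obtain k :: nat where k: "real k \<le> 3 * (real CARD('n) - 2) ^ 3 / 16"
    "\<And>n. n > k \<Longrightarrow> hardy_condition (real CARD('n) - 2) n"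
    using degree_bound_exists[OF d] by blast
  show "\<exists>k::nat. real k \<le> 3 * (real CARD('n) - 2) ^ 3 / 16 \<and>
           optimal_constant (L2_orth k \<inter> W21 :: (real ^ 'n \<Rightarrow> real) set) (8 / (real CARD('n) - 3)\<^sup>2)"
    using k d by (intro exI[of _ k] conjI optimal_constant_hardy) auto
next
  assume d: "CARD('n) = 2"
  have cond: "hardy_condition (real CARD('n) - 2) n" if "n > 0" for n
    using hardy_condition_small(1)[of n] that d by simp
  show "optimal_constant (L2_orth 0 \<inter> W21 :: (real ^ 'n \<Rightarrow> complex) set) (8 / (real CARD('n) - 3)\<^sup>2)"
    by (rule optimal_constant_hardy[OF _ _ cond]) (use d in auto)
  show "optimal_constant (L2_orth 0 \<inter> W21 :: (real ^ 'n \<Rightarrow> real) set) (8 / (real CARD('n) - 3)\<^sup>2)"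
    by (rule optimal_constant_hardy[OF _ _ cond]) (use d in auto)
next
  assume d: "CARD('n) = 4 \<or> CARD('n) = 5"
  have cond: "hardy_condition (real CARD('n) - 2) n" if "n > 0" for n
    using hardy_condition_small(2,3)[of n] that d by auto
  show "optimal_constant (L2_orth 0 \<inter> W21 :: (real ^ 'n \<Rightarrow> real) set) (8 / (real CARD('n) - 3)\<^sup>2)"
    by (rule optimal_constant_hardy[OF _ _ cond]) (use d in auto)
next
  assume d: "CARD('n) = 6"
  have cond: "hardy_condition (real CARD('n) - 2) n" if "n > 4" for n
    using hardy_condition_small(4)[of n] that d by simp
  show "optimal_constant (L2_orth 4 \<inter> W21 :: (real ^ 'n \<Rightarrow> real) set) (8 / (real CARD('n) - 3)\<^sup>2)"
    by (rule optimal_constant_hardy[OF _ _ cond]) (use d in auto)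
next
  assume d: "CARD('n) = 3"
  have "\<not> ineq_holds_on (L2_orth 0 \<inter> W21 :: (real ^ 'n \<Rightarrow> real) set) C" for C
    by (rule not_ineq_holds_on) (use d in auto)
  then show "\<not> (\<exists>C::real. ineq_holds_on (L2_orth 0 \<inter> W21 :: (real ^ 'n \<Rightarrow> real) set) C)" by blast
qed

end
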